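(* Let $\mathfrak{g}_2\subseteq\mathfrak{so}(7)$ be given by the fundamental representation of dimension $7$ of $\mathfrak{g}_2$, and let $\mathfrak{so}(6)\subseteq\mathfrak{so}(7)$ be the Lie subalgebra preserving a nondegenerate hyperspace, so that $\mathfrak{sl}(3)=\mathfrak{g}_2\cap\mathfrak{so}(6)$. Then, under this equality of Lie algebras, the (adjoint) representation of $\mathfrak{sl}(3)$ on its orthogonal complement in $\mathfrak{g}_2$ can be identified with the representation of $\mathfrak{sl}(3)$ obtained by restricting the canonical ($6$-dimensional) representation of $\mathfrak{so}(6)$ (and with the direct sum of the two $3$-dimensional fundamental representations of $\mathfrak{sl}(3)$).
   Context: All Lie algebras are complex: $\mathfrak{g}_2$ is the simple complex Lie algebra of dimension $14$, $\mathfrak{so}(k)=\mathfrak{so}(k,\mathbb{C})$, $\mathfrak{sl}(3)=\mathfrak{sl}(3,\mathbb{C})$. A hyperspace of $\mathbb{C}^7$ is nondegenerate if the restriction to it of the given nondegenerate symmetric bilinear form is nondegenerate; elements of $\mathfrak{so}(7)$ preserving it then annihilate its orthogonal complement. The orthogonal complement of $\mathfrak{sl}(3)$ in $\mathfrak{g}_2$ is taken with respect to the Killing form. *)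

theory Defs
  imports "HOL-Analysis.Analysis"
begin

section \<open>Complex matrices as a complex vector space\<close>

text \<open>The library only provides the real vector space structure of \<^typ>\<open>complex^'n^'m\<close>.\<close>

definition mscale :: "complex \<Rightarrow> complex^'n^'m \<Rightarrow> complex^'n^'m" where
  "mscale c A = (\<chi> i j. c * A $ i $ j)"

global_interpretation cmat: vector_space "mscale :: complex \<Rightarrow> complex^'n^'m \<Rightarrow> complex^'n^'m"
  by standard (simp_all add: mscale_def vec_eq_iff algebra_simps)

definition linear_on ::
  "(complex \<Rightarrow> 'a::ab_group_add \<Rightarrow> 'a) \<Rightarrow> (complex \<Rightarrow> 'b::ab_group_add \<Rightarrow> 'b) \<Rightarrow>
     'a set \<Rightarrow> ('a \<Rightarrow> 'b) \<Rightarrow> bool" where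
  "linear_on s t V f \<longleftrightarrow>
     (\<forall>x\<in>V. \<forall>y\<in>V. f (x + y) = f x + f y) \<and> (\<forall>c. \<forall>x\<in>V. f (s c x) = t c (f x))"

text \<open>The trace of an endomorphism \<open>f\<close> of a subspace \<open>S\<close>: the sum of the diagonal
  coefficients of \<open>f\<close> in a basis of \<open>S\<close> (the value does not depend on the basis chosen).\<close>

definition trace_on :: "(complex^'n^'m) set \<Rightarrow> (complex^'n^'m \<Rightarrow> complex^'n^'m) \<Rightarrow> complex" where
  "trace_on S f =
     (let B = (SOME B. cmat.independent B \<and> cmat.span B = S)
      in \<Sum>b\<in>B. cmat.representation B (f b) b)"


section \<open>Linear Lie algebras\<close>

definition lie_bracket :: "complex^'n^'n \<Rightarrow> complex^'n^'n \<Rightarrow> complex^'n^'n" where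
  "lie_bracket A B = A ** B - B ** A"

definition lie_algebra :: "(complex^'n^'n) set \<Rightarrow> bool" where
  "lie_algebra L \<longleftrightarrow> cmat.subspace L \<and> (\<forall>A\<in>L. \<forall>B\<in>L. lie_bracket A B \<in> L)"

definition lie_ideal :: "(complex^'n^'n) set \<Rightarrow> (complex^'n^'n) set \<Rightarrow> bool" where
  "lie_ideal I L \<longleftrightarrow> cmat.subspace I \<and> I \<subseteq> L \<and> (\<forall>A\<in>L. \<forall>B\<in>I. lie_bracket A B \<in> I)"

definition simple_lie_algebra :: "(complex^'n^'n) set \<Rightarrow> bool" where
  "simple_lie_algebra L \<longleftrightarrow>
     lie_algebra L \<and> (\<exists>A\<in>L. \<exists>B\<in>L. lie_bracket A B \<noteq> 0) \<and>
     (\<forall>I. lie_ideal I L \<longrightarrow> I = {0} \<or> I = L)"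

definition lie_isomorphism ::
  "(complex^'n^'n) set \<Rightarrow> (complex^'m^'m) set \<Rightarrow> (complex^'n^'n \<Rightarrow> complex^'m^'m) \<Rightarrow> bool" where
  "lie_isomorphism L M \<phi> \<longleftrightarrow>
     linear_on mscale mscale L \<phi> \<and> bij_betw \<phi> L M \<and>
     (\<forall>A\<in>L. \<forall>B\<in>L. \<phi> (lie_bracket A B) = lie_bracket (\<phi> A) (\<phi> B))"

definition killing_form ::
  "(complex^'n^'n) set \<Rightarrow> complex^'n^'n \<Rightarrow> complex^'n^'n \<Rightarrow> complex" where
  "killing_form L X Y = trace_on L (\<lambda>Z. lie_bracket X (lie_bracket Y Z))"

definition killing_complement ::
  "(complex^'n^'n) set \<Rightarrow> (complex^'n^'n) set \<Rightarrow> (complex^'n^'n) set" where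
  "killing_complement L K = {X \<in> L. \<forall>Y\<in>K. killing_form L X Y = 0}"

definition sl :: "(complex^'n^'n) set" where
  "sl = {A. trace A = 0}"


section \<open>Representations\<close>

text \<open>\<open>\<rho>\<close> is a representation of \<open>L\<close> on the subspace \<open>V\<close> of the complex vector space with
  scalar multiplication \<open>s\<close>; nothing is required of \<open>\<rho>\<close> outside \<open>L\<close> and \<open>V\<close>.\<close>

definition lie_rep ::
  "(complex^'n^'n) set \<Rightarrow> (complex \<Rightarrow> 'a::ab_group_add \<Rightarrow> 'a) \<Rightarrow> 'a set \<Rightarrow>
     (complex^'n^'n \<Rightarrow> 'a \<Rightarrow> 'a) \<Rightarrow> bool" where
  "lie_rep L s V \<rho> \<longleftrightarrow>
     vector_space s \<and> module.subspace s V \<and>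
     (\<forall>A\<in>L. linear_on s s V (\<rho> A) \<and> \<rho> A ` V \<subseteq> V) \<and>
     (\<forall>v\<in>V. linear_on mscale s L (\<lambda>A. \<rho> A v)) \<and>
     (\<forall>A\<in>L. \<forall>B\<in>L. \<forall>v\<in>V. \<rho> (lie_bracket A B) v = \<rho> A (\<rho> B v) - \<rho> B (\<rho> A v))"

definition equivalent_reps ::
  "(complex^'n^'n) set \<Rightarrow>
     (complex \<Rightarrow> 'a::ab_group_add \<Rightarrow> 'a) \<Rightarrow> 'a set \<Rightarrow> (complex^'n^'n \<Rightarrow> 'a \<Rightarrow> 'a) \<Rightarrow>
     (complex \<Rightarrow> 'b::ab_group_add \<Rightarrow> 'b) \<Rightarrow> 'b set \<Rightarrow> (complex^'n^'n \<Rightarrow> 'b \<Rightarrow> 'b) \<Rightarrow> bool" where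
  "equivalent_reps L s V \<rho> t W \<sigma> \<longleftrightarrow>
     lie_rep L s V \<rho> \<and> lie_rep L t W \<sigma> \<and>
     (\<exists>f. linear_on s t V f \<and> bij_betw f V W \<and>
          (\<forall>A\<in>L. \<forall>v\<in>V. f (\<rho> A v) = \<sigma> A (f v)))"

definition acts_irreducibly :: "(complex^'n^'n) set \<Rightarrow> bool" where
  "acts_irreducibly L \<longleftrightarrow>
     (\<forall>W. vec.subspace W \<and> (\<forall>A\<in>L. \<forall>w\<in>W. A *v w \<in> W) \<longrightarrow> W = {0} \<or> W = UNIV)"

definition pair_scale :: "complex \<Rightarrow> (complex^'n) \<times> (complex^'m) \<Rightarrow> (complex^'n) \<times> (complex^'m)" where
  "pair_scale c p = (c *s fst p, c *s snd p)"

text \<open>The direct sum of the defining representation and its dual (contragredient)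
  representation; for \<open>sl(3)\<close> the two summands are the two fundamental representations.\<close>

definition std_plus_dual ::
  "complex^'n^'n \<Rightarrow> (complex^'n) \<times> (complex^'n) \<Rightarrow> (complex^'n) \<times> (complex^'n)" where
  "std_plus_dual A p = (A *v fst p, - (transpose A *v snd p))"


section \<open>Symmetric bilinear forms and orthogonal Lie algebras\<close>

definition symmetric_form :: "(complex^'n \<Rightarrow> complex^'n \<Rightarrow> complex) \<Rightarrow> bool" where
  "symmetric_form \<beta> \<longleftrightarrow>
     (\<forall>x. Vector_Spaces.linear (*s) (*) (\<beta> x)) \<and> (\<forall>x y. \<beta> x y = \<beta> y x)"

definition nondegenerate_on ::
  "(complex^'n \<Rightarrow> complex^'n \<Rightarrow> complex) \<Rightarrow> (complex^'n) set \<Rightarrow> bool" where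
  "nondegenerate_on \<beta> W \<longleftrightarrow> (\<forall>x\<in>W. (\<forall>y\<in>W. \<beta> x y = 0) \<longrightarrow> x = 0)"

definition so :: "(complex^'n \<Rightarrow> complex^'n \<Rightarrow> complex) \<Rightarrow> (complex^'n^'n) set" where
  "so \<beta> = {A. \<forall>x y. \<beta> (A *v x) y + \<beta> x (A *v y) = 0}"

definition so_preserving ::
  "(complex^'n \<Rightarrow> complex^'n \<Rightarrow> complex) \<Rightarrow> (complex^'n) set \<Rightarrow> (complex^'n^'n) set" where
  "so_preserving \<beta> H = {A \<in> so \<beta>. \<forall>x\<in>H. A *v x \<in> H}"

text \<open>\<open>\<gg>\<close> is the simple complex Lie algebra of dimension 14, embedded in \<open>so \<beta> \<cong> so(7)\<close>
  so that the inclusion is an irreducible representation of dimension 7. As \<open>\<gg>\<^sub>2\<close> has a single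
  irreducible representation of dimension 7, this is its fundamental representation of
  that dimension.\<close>

definition g2_in_so7 :: "(complex^7 \<Rightarrow> complex^7 \<Rightarrow> complex) \<Rightarrow> (complex^7^7) set \<Rightarrow> bool" where
  "g2_in_so7 \<beta> \<gg> \<longleftrightarrow>
     simple_lie_algebra \<gg> \<and> cmat.dim \<gg> = 14 \<and> \<gg> \<subseteq> so \<beta> \<and> acts_irreducibly \<gg>"

end

(*
  Let m be the orthogonal complement of g = g2 in so(7) for the trace form, so that dim m = 7 and
  so(7) = g + m. For a nonzero X in m the orbit [g, X] lies in m and is orthogonal to X, so the
  centralizer of X in g has dimension at least 8, and that in so(7) at least 9. Decomposing C^7
  into generalized eigenspaces, this bound leaves two possibilities for X with tr X^2 <> 0: a
  multiple of X acts as 1, -1, 0 on spaces of dimensions 3, 3, 1, or X has rank two. If only the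
  second possibility occurred, polarizing the Pluecker relation would give so(T) <= g for the
  complement T of a hyperbolic plane, and this plane would be g-invariant.
  For X of the first kind the centralizer of X in g is all of sl(3), and decomposing
  so(7) = gl(3) + 2 (C^3 + dual of C^3) under sl(3) determines g up to one parameter: g is the
  usual sl(3) + C^3 + dual of C^3. From this description m is isomorphic to C^7 as a g-module by
  an explicit map, which shows that every e with b(e,e) = -1 is the kernel vector of some X of the
  first kind. Applied to the normal vector e of H this gives g cap so(6) = sl(3), the Killing
  complement is C^3 + dual of C^3, and A |-> A e identifies it with H.
*)

theory Submission
  imports Defs "HOL-Computational_Algebra.Fundamental_Theorem_Algebra"
begin

section \<open>Linear functionals and dimension\<close>

text \<open>The hypotheses give \<open>g\<close> only as a simple algebra of dimension 14 acting
  irreducibly, so there are no roots, octonions or model to compute with; structure has to come from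
  counting dimensions. The bound 9 on the centralizer makes the counting decisive: if
  \<open>E\<close> is the generalized eigenspace of a nonzero eigenvalue, 7 = dim T + 2 dim E leaves
  dim E = 1, 2, 3, and every unwanted shape of \<open>X\<close> has a centralizer of dimension at
  most 8. Simplicity makes the trace form nondegenerate on \<open>g\<close>, hence on
  \<open>m\<close>; this supplies some \<open>X\<close> in \<open>m\<close> with tr X^2 <> 0, and so
  a nonzero eigenvalue. The free parameter in the normal form reflects the choice of frame:
  multiplying all \<open>x i\<close> by s and all \<open>y i\<close> by 1/s multiplies \<gamma> by
  s^3 and \<delta> by s^-3, so only their product is determined. Its value, 1 + 2 \<gamma> \<delta>
  = 0, expresses that brackets of elements of \<open>g\<close> stay orthogonal to \<open>X\<close>.
  The normalization b(e,e) = -1 goes with eigenvalues 1 and -1 of \<open>X\<close>.\<close>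

definition functional :: "(complex \<Rightarrow> 'a::ab_group_add \<Rightarrow> 'a) \<Rightarrow> ('a \<Rightarrow> complex) \<Rightarrow> bool" where
  "functional s f \<longleftrightarrow> (\<forall>x y. f (x + y) = f x + f y) \<and> (\<forall>c x. f (s c x) = c * f x)"

lemma functional_add: "functional s f \<Longrightarrow> functional s g \<Longrightarrow> functional s (\<lambda>x. f x + g x)"
  by (simp add: functional_def algebra_simps)

lemma functional_zero: "module s \<Longrightarrow> functional s f \<Longrightarrow> f 0 = 0"
  by (metis functional_def module.scale_zero_left mult_zero_left)

lemma subspace_kernel_vec: "functional (*s) f \<Longrightarrow> vec.subspace {x. f x = 0}"
  using functional_zero[OF vec.module_axioms, of f]
  by (auto simp: functional_def vec.subspace_def)

lemma subspace_kernel_cmat: "functional mscale f \<Longrightarrow> cmat.subspace {A. f A = 0}"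
  using functional_zero[OF cmat.module_axioms, of f]
  by (auto simp: functional_def cmat.subspace_def)

lemma dim_le_dim_kernel:
  fixes s :: "complex \<Rightarrow> 'a::ab_group_add \<Rightarrow> 'a"
  assumes fd: "finite_dimensional_vector_space s Bas"
    and S: "module.subspace s S" and f: "functional s f"
  shows "module.subspace s {x\<in>S. f x = 0}"
    and "vector_space.dim s S \<le> vector_space.dim s {x\<in>S. f x = 0} + 1"
proof -
  interpret finite_dimensional_vector_space s Bas by (fact fd)
  have fa: "f (x + y) = f x + f y" and fs: "f (s c x) = c * f x" for x y c
    using f by (auto simp: functional_def)
  have f0: "f 0 = 0" using fs[of 0 0] by simp
  have fd: "f (x - y) = f x - f y" for x y
    using fa[of "x - y" y] by simp
  show sub: "subspace {x\<in>S. f x = 0}"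
    using S by (auto simp: subspace_def fa fs f0)
  let ?K = "{x\<in>S. f x = 0}"
  show "dim S \<le> dim ?K + 1"
  proof (cases "\<forall>x\<in>S. f x = 0")
    case True
    then have "?K = S" by auto
    then show ?thesis by simp
  next
    case False
    then obtain c where c: "c \<in> S" "f c \<noteq> 0" by auto
    have "S \<subseteq> span (insert c ?K)"
    proof
      fix x assume x: "x \<in> S"
      have "x - s (f x / f c) c \<in> ?K"
        using x c S by (simp add: subspace_diff subspace_scale fd fs)
      then have "x - s (f x / f c) c \<in> span ?K" by (rule span_base)
      then show "x \<in> span (insert c ?K)" by (auto simp: span_insert)
    qed
    then have "dim S \<le> dim (insert c ?K)" by (rule dim_mono)
    also have "\<dots> \<le> dim ?K + 1" by (simp add: dim_insert)
    finally show ?thesis .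
  qed
qed

lemma dim_le_dim_common_kernel:
  fixes s :: "complex \<Rightarrow> 'a::ab_group_add \<Rightarrow> 'a"
  assumes fd: "finite_dimensional_vector_space s Bas"
    and S: "module.subspace s S" and "finite I" and "\<And>i. i \<in> I \<Longrightarrow> functional s (f i)"
  shows "module.subspace s {x\<in>S. \<forall>i\<in>I. f i x = 0} \<and>
    vector_space.dim s S \<le> vector_space.dim s {x\<in>S. \<forall>i\<in>I. f i x = 0} + card I"
  using assms(3,4)
proof (induction I rule: finite_induct)
  case empty
  then show ?case using S by simp
next
  case (insert i I)
  let ?K = "{x\<in>S. \<forall>i\<in>I. f i x = 0}"
  have eq: "{x\<in>S. \<forall>i\<in>insert i I. f i x = 0} = {x\<in>?K. f i x = 0}" by auto
  have "module.subspace s ?K" and le: "vector_space.dim s S \<le> vector_space.dim s ?K + card I"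
    using insert by auto
  from dim_le_dim_kernel[OF fd this(1), of "f i"] insert(4)[of i] le insert(1,2)
  show ?case unfolding eq by simp
qed

text \<open>Each functional lowers the dimension by at most one. All upper bounds for centralizers
  below consist in listing enough matrix coefficients to force an element to vanish.\<close>

lemma common_zero_imp_dim_le:
  fixes s :: "complex \<Rightarrow> 'a::ab_group_add \<Rightarrow> 'a"
  assumes fd: "finite_dimensional_vector_space s Bas"
    and S: "module.subspace s S" and I: "finite I" "\<And>i. i \<in> I \<Longrightarrow> functional s (f i)"
    and z: "\<And>x. x \<in> S \<Longrightarrow> (\<And>i. i \<in> I \<Longrightarrow> f i x = 0) \<Longrightarrow> x = 0"
  shows "vector_space.dim s S \<le> card I"
proof -
  interpret finite_dimensional_vector_space s Bas by (fact fd)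
  have "{x\<in>S. \<forall>i\<in>I. f i x = 0} \<subseteq> {0}" using z by auto
  from dim_subset[OF this] have "dim {x\<in>S. \<forall>i\<in>I. f i x = 0} = 0" by simp
  then show ?thesis using dim_le_dim_common_kernel[OF fd S I(1), where f = f, OF I(2)] by linarith
qed

lemma common_zero_list_imp_dim_le:
  fixes s :: "complex \<Rightarrow> 'a::ab_group_add \<Rightarrow> 'a"
  assumes fd: "finite_dimensional_vector_space s Bas"
    and S: "module.subspace s S" and fs: "\<And>f. f \<in> set fs \<Longrightarrow> functional s f"
    and z: "\<And>x. x \<in> S \<Longrightarrow> (\<forall>f\<in>set fs. f x = 0) \<Longrightarrow> x = 0"
  shows "vector_space.dim s S \<le> length fs"
proof -
  have "vector_space.dim s S \<le> card {..<length fs}"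
  proof (rule common_zero_imp_dim_le[OF fd S, where f = "\<lambda>i. fs ! i"])
    show "x = 0" if "x \<in> S" "\<And>i. i \<in> {..<length fs} \<Longrightarrow> (fs ! i) x = 0" for x
      using that by (intro z) (auto simp: in_set_conv_nth)
  qed (use fs in auto)
  then show ?thesis by simp
qed

text \<open>Cutting \<open>V\<close> by a basis of \<open>U\<close> bounds the complement from
  below; separating \<open>U\<close> by the part of a basis of \<open>V\<close> outside the
  complement bounds it from above. Applied to \<open>b\<close> on vectors and to the trace form on
  \<open>so b\<close>.\<close>

lemma dim_orthogonal:
  fixes s :: "complex \<Rightarrow> 'a::ab_group_add \<Rightarrow> 'a"
  assumes fd: "finite_dimensional_vector_space s Bas"
    and V: "module.subspace s V" and U: "module.subspace s U" "U \<subseteq> V"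
    and f: "\<And>x. functional s (f x)" "\<And>y. functional s (\<lambda>x. f x y)"
    and nd: "\<And>x. x \<in> V \<Longrightarrow> (\<And>y. y \<in> V \<Longrightarrow> f x y = 0) \<Longrightarrow> x = 0"
  shows "vector_space.dim s U + vector_space.dim s {y\<in>V. \<forall>x\<in>U. f x y = 0} = vector_space.dim s V"
proof (rule antisym)
  interpret finite_dimensional_vector_space s Bas by (fact fd)
  let ?P = "{y\<in>V. \<forall>x\<in>U. f x y = 0}"
  have add: "f (x + x') y = f x y + f x' y" "f x (y + y') = f x y + f x y'"
    and scale: "f (s c x) y = c * f x y" "f x (s c y) = c * f x y" for x x' y y' c
    using f by (auto simp: functional_def)
  have zero: "f 0 y = 0" "f x 0 = 0" for x y using scale(1)[of 0 0] scale(2)[of _ 0 0] by simp_all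
  have subl: "subspace {x. f x y = 0}" for y by (auto simp: subspace_def add scale zero)
  have subr: "subspace {y. f x y = 0}" for x by (auto simp: subspace_def add scale zero)
  obtain B where B: "B \<subseteq> U" "independent B" "U \<subseteq> span B" "card B = dim U"
    using basis_exists by blast
  have fB: "finite B" using B(2) by (rule finiteI_independent)
  have "f x y = 0" if "\<forall>x\<in>B. f x y = 0" "x \<in> U" for x y
    using span_minimal[OF _ subl, of B y] that B by auto
  then have "{y\<in>V. \<forall>x\<in>B. f x y = 0} = ?P" using B(1) by auto
  with dim_le_dim_common_kernel[OF fd V fB, where f = f, OF f(1)] B(4)
  show "dim V \<le> dim U + dim ?P" by simp
  obtain C where C: "C \<subseteq> ?P" "independent C" "?P \<subseteq> span C" "card C = dim ?P"
    using basis_exists by blast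
  obtain D where D: "C \<subseteq> D" "D \<subseteq> V" "independent D" "V \<subseteq> span D"
    using maximal_independent_subset_extend[of C V] C(1,2) by auto
  have fD: "finite D" using D(3) by (rule finiteI_independent)
  have cD: "card D = dim V" using basis_card_eq_dim D by blast
  \<comment> \<open>Vectors of \<open>C\<close> pair to zero with all of \<open>U\<close>, so only
    \<open>D - C\<close> can detect elements of \<open>U\<close>, and by nondegeneracy it detects
    all of them.\<close>
  have "dim U \<le> card (D - C)"
  proof (rule common_zero_imp_dim_le[OF fd U(1), where f = "\<lambda>d x. f x d"])
    show "finite (D - C)" using fD by simp
    show "functional s (\<lambda>x. f x i)" for i by (rule f(2))
    fix x assume x: "x \<in> U" and z: "\<And>i. i \<in> D - C \<Longrightarrow> f x i = 0"
    have "D \<subseteq> {y. f x y = 0}" using z C(1) x by blast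
    then have "span D \<subseteq> {y. f x y = 0}" using subr by (rule span_minimal)
    then show "x = 0" using D(4) x U(2) by (intro nd) auto
  qed
  also have "card (D - C) = card D - card C" using D fD by (intro card_Diff_subset) (auto intro: finite_subset)
  finally show "dim U + dim ?P \<le> dim V"
    using C(4) cD card_mono[OF fD D(1)] by simp
qed

section \<open>Matrix units, finite dimension of matrix spaces, and matrix arithmetic\<close>

definition matrix_unit :: "'m \<Rightarrow> 'n \<Rightarrow> complex^'n^'m" where
  "matrix_unit i j = (\<chi> k l. if k = i \<and> l = j then 1 else 0)"

lemma matrix_unit_nth: "matrix_unit i j $ k $ l = (if k = i \<and> l = j then 1 else 0)"
  by (simp add: matrix_unit_def)

lemma mscale_nth [simp]: "mscale c A $ i $ j = c * A $ i $ j"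
  by (simp add: mscale_def)

lemma cmat_sum_units: "A = (\<Sum>(i,j)\<in>UNIV. mscale (A $ i $ j) (matrix_unit i j))"
proof -
  have "(\<Sum>(i,j)\<in>UNIV. mscale (A $ i $ j) (matrix_unit i j)) $ k $ l = A $ k $ l" for k l
  proof -
    have "(\<Sum>(i,j)\<in>UNIV. mscale (A $ i $ j) (matrix_unit i j)) $ k $ l =
        (\<Sum>p\<in>UNIV. if p = (k,l) then A $ k $ l else 0)"
      unfolding sum_component by (intro sum.cong) (auto simp: matrix_unit_nth split: if_splits)
    then show ?thesis by simp
  qed
  then show ?thesis by (simp add: vec_eq_iff)
qed

lemma inj_matrix_unit: "inj (\<lambda>(i,j). matrix_unit i j :: complex^'n^'m)"
proof (rule injI)
  fix p q :: "'m \<times> 'n" assume "(\<lambda>(i,j). matrix_unit i j :: complex^'n^'m) p = (\<lambda>(i,j). matrix_unit i j) q"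
  then have "(\<lambda>(i,j). matrix_unit i j :: complex^'n^'m) p $ fst p $ snd p =
    (\<lambda>(i,j). matrix_unit i j :: complex^'n^'m) q $ fst p $ snd p" by simp
  then show "p = q" by (auto simp: matrix_unit_nth split: prod.splits if_splits)
qed

lemma cmat_finite_dimensional:
  "finite_dimensional_vector_space (mscale :: complex \<Rightarrow> complex^'n^'m \<Rightarrow> complex^'n^'m)
     (range (\<lambda>(i,j). matrix_unit i j))"
proof unfold_locales
  let ?E = "\<lambda>(i,j). matrix_unit i j :: complex^'n^'m"
  show "finite (range ?E)" by simp
  have inj: "inj ?E" by (rule inj_matrix_unit)
  show "cmat.independent (range ?E)"
  proof (rule cmat.independent_if_scalars_zero)
    fix f x assume sum0: "(\<Sum>x\<in>range ?E. mscale (f x) x) = 0" and "x \<in> range ?E"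
    then obtain k l where x: "x = matrix_unit k l" by auto
    have "(\<Sum>p\<in>UNIV. mscale (f (?E p)) (?E p)) = 0"
      using sum0 by (simp add: sum.reindex[OF inj] o_def)
    then have "(\<Sum>p\<in>UNIV. mscale (f (?E p)) (?E p)) $ k $ l = 0" by simp
    moreover have "(\<Sum>p\<in>UNIV. mscale (f (?E p)) (?E p)) $ k $ l =
        (\<Sum>p\<in>UNIV. if p = (k,l) then f (matrix_unit k l) else 0)"
      unfolding sum_component by (intro sum.cong) (auto simp: matrix_unit_nth split: if_splits)
    ultimately show "f x = 0" using x by simp
  qed simp
  have "A \<in> cmat.span (range ?E)" for A
    by (subst cmat_sum_units[of A])
      (rule cmat.span_sum, clarsimp, rule cmat.span_scale, rule cmat.span_base, auto)
  then show "cmat.span (range ?E) = UNIV" by auto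
qed

global_interpretation cmatf: finite_dimensional_vector_space
  "mscale :: complex \<Rightarrow> complex^'n^'m \<Rightarrow> complex^'n^'m" "range (\<lambda>(i,j). matrix_unit i j)"
  by (rule cmat_finite_dimensional)

lemma cmat_dim_UNIV: "cmat.dim (UNIV :: (complex^'n^'m) set) = CARD('m) * CARD('n)"
  by (simp only: cmatf.dim_UNIV card_image[OF inj_matrix_unit])
    (simp flip: UNIV_Times_UNIV add: card_cartesian_product)

lemma mscale_mv: "mscale c A *v x = c *s (A *v x)"
  by (simp add: vec_eq_iff matrix_vector_mult_def sum_distrib_left mult.assoc)

lemma mscale_mm: "mscale c A ** B = mscale c (A ** B)" "A ** mscale c B = mscale c (A ** B)"
  by (simp_all add: vec_eq_iff matrix_matrix_mult_def sum_distrib_left mult.assoc mult.left_commute)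

lemma trace_mscale: "trace (mscale c A) = c * trace A"
  by (simp add: trace_def sum_distrib_left)

lemma mv_scale: "(A :: complex^'n^'m) *v (c *s x) = c *s (A *v x)"
  by (simp add: vec_eq_iff matrix_vector_mult_def sum_distrib_left mult.left_commute)

lemmas mv_simps = matrix_vector_mult_add_rdistrib matrix_vector_mult_diff_rdistrib
  matrix_vector_right_distrib matrix_vector_mult_diff_distrib mscale_mv mv_scale

lemma lie_bracket_mv: "lie_bracket A B *v x = A *v (B *v x) - B *v (A *v x)"
  by (simp add: lie_bracket_def mv_simps matrix_vector_mul_assoc)

lemma mv_axis: "(A :: complex^'n^'m) *v axis j 1 = column j A"
  by (simp add: vec_eq_iff matrix_vector_mult_def axis_def column_def if_distrib cong: if_cong)

lemma mm_simps:
  fixes A B :: "complex^'n^'m" and C D :: "complex^'k^'n"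
  shows "(A + B) ** C = A ** C + B ** C" "(A - B) ** C = A ** C - B ** C"
    "A ** (C + D) = A ** C + A ** D" "A ** (C - D) = A ** C - A ** D"
  by (simp_all add: vec_eq_iff matrix_matrix_mult_def ring_distribs sum.distrib sum_subtractf)

lemma mm_zero [simp]: "(0 :: complex^'n^'m) ** (C :: complex^'k^'n) = 0" "(A :: complex^'n^'m) ** (0 :: complex^'k^'n) = 0"
  by (simp_all add: vec_eq_iff matrix_matrix_mult_def)

lemma trace_zero [simp]: "trace (0 :: complex^'n^'n) = 0"
  by (simp add: trace_def)

section \<open>Nondegenerate symmetric bilinear forms\<close>

locale bform =
  fixes b :: "complex^'n \<Rightarrow> complex^'n \<Rightarrow> complex"
  assumes symf: "symmetric_form b" and nondeg: "nondegenerate_on b UNIV"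
begin

lemma b_commute: "b x y = b y x"
  using symf by (simp add: symmetric_form_def)

lemma b_linear: "Vector_Spaces.linear (*s) (*) (b x)"
  using symf by (simp add: symmetric_form_def)

lemma b_add_right: "b x (y + z) = b x y + b x z"
  using Vector_Spaces.linear_iff[THEN iffD1, OF b_linear] by blast

lemma b_scale_right: "b x (c *s y) = c * b x y"
  using Vector_Spaces.linear_iff[THEN iffD1, OF b_linear] by blast

lemma b_add_left: "b (x + y) z = b x z + b y z"
  using b_add_right b_commute by metis

lemma b_scale_left: "b (c *s x) y = c * b x y"
  using b_scale_right b_commute by metis

lemma b_zero [simp]: "b x 0 = 0" "b 0 x = 0"
  using b_scale_right[of x 0 0] b_scale_left[of 0 0 x] by simp_all

lemma b_minus_right: "b x (- y) = - b x y"
  using b_scale_right[of x "-1" y] by (simp add: vec.scale_minus_left)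

lemma b_minus_left: "b (- x) y = - b x y"
  using b_minus_right b_commute by metis

lemma b_diff_right: "b x (y - z) = b x y - b x z"
  using b_add_right[of x y "- z"] by (simp add: b_minus_right)

lemma b_diff_left: "b (x - y) z = b x z - b y z"
  using b_diff_right b_commute by metis

lemma b_sum_right: "b x (\<Sum>i\<in>I. f i) = (\<Sum>i\<in>I. b x (f i))"
  by (induction I rule: infinite_finite_induct) (auto simp: b_add_right)

lemma b_sum_left: "b (\<Sum>i\<in>I. f i) x = (\<Sum>i\<in>I. b (f i) x)"
  by (induction I rule: infinite_finite_induct) (auto simp: b_add_left)

lemmas b_simps = b_add_left b_add_right b_scale_left b_scale_right b_diff_left b_diff_right
  b_minus_left b_minus_right

lemma b_eq_0D: "(\<And>y. b x y = 0) \<Longrightarrow> x = 0"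
  using nondeg by (auto simp: nondegenerate_on_def)

lemma b_functional: "functional (*s) (b x)" "functional (*s) (\<lambda>y. b y x)"
  by (simp_all add: functional_def b_simps)

lemma b_matrix_functional: "functional mscale (\<lambda>A. b (A *v x) y)"
  by (simp add: functional_def b_simps mv_simps)

definition perp :: "(complex^'n) set \<Rightarrow> (complex^'n) set" where
  "perp U = {y. \<forall>x\<in>U. b x y = 0}"

lemma subspace_perp: "vec.subspace (perp U)"
  by (auto simp: vec.subspace_def perp_def b_simps)

lemma perp_span: "perp (vec.span U) = perp U"
proof
  show "perp (vec.span U) \<subseteq> perp U" by (auto simp: perp_def vec.span_base)
  show "perp U \<subseteq> perp (vec.span U)"
  proof
    fix y assume "y \<in> perp U"
    then have "U \<subseteq> {x. b x y = 0}" by (auto simp: perp_def)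
    moreover have "vec.subspace {x. b x y = 0}" by (auto simp: vec.subspace_def b_simps)
    ultimately have "vec.span U \<subseteq> {x. b x y = 0}" by (rule vec.span_minimal)
    then show "y \<in> perp (vec.span U)" by (auto simp: perp_def)
  qed
qed

lemma dim_perp:
  assumes U: "vec.subspace U"
  shows "vec.dim U + vec.dim (perp U) = CARD('n)"
  using dim_orthogonal[OF vec.finite_dimensional_vector_space_axioms vec.subspace_UNIV U, of b]
  by (simp add: perp_def b_functional b_eq_0D vec_dim_card del: vec.dim_UNIV)

text \<open>Otherwise adjoining \<open>x\<close> to \<open>U\<close> would raise its dimension by
  one and leave the orthogonal complement unchanged, against \<open>dim_perp\<close>.\<close>

lemma separate:
  assumes U: "vec.subspace U" and x: "x \<notin> U"
  obtains y where "\<And>u. u \<in> U \<Longrightarrow> b u y = 0" "b x y = 1"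
proof -
  have "\<exists>y\<in>perp U. b x y \<noteq> 0"
  proof (rule ccontr)
    assume "\<not> ?thesis"
    then have "perp U \<subseteq> perp (insert x U)" by (auto simp: perp_def)
    then have "vec.dim (perp U) \<le> vec.dim (perp (vec.span (insert x U)))"
      by (simp add: perp_span vec.dim_subset)
    moreover have "vec.dim (vec.span (insert x U)) = vec.dim U + 1"
      using x U by (simp add: vec.dim_insert vec.span_eq_iff[THEN iffD2])
    ultimately show False
      using dim_perp[OF U] dim_perp[OF vec.subspace_span, of "insert x U"] by simp
  qed
  then obtain y where y: "y \<in> perp U" "b x y \<noteq> 0" by auto
  show thesis
    by (rule that[of "(1 / b x y) *s y"]) (use y in \<open>auto simp: perp_def b_simps\<close>)
qed

lemma soD: "A \<in> so b \<Longrightarrow> b (A *v x) y = - b x (A *v y)"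
  by (simp add: so_def add_eq_0_iff2)

lemma so_self: "A \<in> so b \<Longrightarrow> b (A *v x) x = 0"
  using soD[of A x x] b_commute[of "A *v x" x] by simp

lemma soI: "(\<And>x y. b (A *v x) y = - b x (A *v y)) \<Longrightarrow> A \<in> so b"
  by (simp add: so_def)

lemma subspace_so: "cmat.subspace (so b)"
  by (auto simp: cmat.subspace_def intro!: soI) (simp_all add: mv_simps b_simps soD)

lemma so_bracket: "A \<in> so b \<Longrightarrow> B \<in> so b \<Longrightarrow> lie_bracket A B \<in> so b"
  by (rule soI) (simp add: lie_bracket_mv b_simps soD)

text \<open>The image of a decomposable bivector under the usual identification of the second
  exterior power with the orthogonal Lie algebra.\<close>

definition wedge :: "complex^'n \<Rightarrow> complex^'n \<Rightarrow> complex^'n^'n" where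
  "wedge x y = matrix (\<lambda>v. b x v *s y - b y v *s x)"

lemma wedge_mv: "wedge x y *v v = b x v *s y - b y v *s x"
  unfolding wedge_def
  by (rule matrix_works)
    (simp add: Vector_Spaces.linear_iff vec.vector_space_axioms b_simps vec.scale_left_distrib
      vec.scale_right_diff_distrib vec.scale_right_distrib)

lemma wedge_so: "wedge x y \<in> so b"
  by (rule soI) (simp add: wedge_mv b_simps b_commute)

lemma b_axis_sum: "b x y = (\<Sum>i\<in>UNIV. y $ i * b x (axis i 1))"
proof -
  have "y = (\<Sum>i\<in>UNIV. y $ i *s axis i 1)" by (simp add: basis_expansion)
  then have "b x y = b x (\<Sum>i\<in>UNIV. y $ i *s axis i 1)" by simp
  then show ?thesis by (simp only: b_sum_right b_scale_right)
qed

text \<open>Pairing with rank-two elements reads off the coefficients of \<open>A\<close> with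
  respect to \<open>b\<close>. Hence the trace form is nondegenerate on \<open>so b\<close>, and
  orthogonality to a wedge becomes the vanishing of one coefficient.\<close>

lemma trace_so_wedge:
  assumes A: "A \<in> so b"
  shows "trace (A ** wedge x y) = 2 * b (A *v y) x"
proof -
  have "(A ** wedge x y) $ i $ i = b x (axis i 1) * (A *v y) $ i - b y (axis i 1) * (A *v x) $ i" for i
  proof -
    have "(A ** wedge x y) $ i $ i = ((A ** wedge x y) *v axis i 1) $ i"
      by (simp add: mv_axis column_def)
    then show ?thesis
      by (simp flip: matrix_vector_mul_assoc add: wedge_mv mv_simps)
  qed
  then have "trace (A ** wedge x y) =
      (\<Sum>i\<in>UNIV. (A *v y) $ i * b x (axis i 1)) - (\<Sum>i\<in>UNIV. (A *v x) $ i * b y (axis i 1))"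
    by (simp add: trace_def sum_subtractf mult.commute)
  also have "\<dots> = b x (A *v y) - b y (A *v x)" by (simp flip: b_axis_sum)
  also have "\<dots> = 2 * b (A *v y) x"
    using soD[OF A, of y x] by (simp add: b_commute)
  finally show ?thesis .
qed

lemma trace_so_nondegenerate:
  assumes "A \<in> so b" "\<And>B. B \<in> so b \<Longrightarrow> trace (A ** B) = 0"
  shows "A = 0"
proof -
  have "A *v y = 0" for y
    using assms(2)[OF wedge_so] trace_so_wedge[OF assms(1), of _ y] by (intro b_eq_0D) simp
  then show ?thesis by (simp add: matrix_eq)
qed

end

lemma trace_bracket: "trace (lie_bracket A B ** C) = trace (A ** lie_bracket B C)"
proof -
  have "trace (B ** A ** C) = trace (A ** (C ** B))"
    by (metis matrix_mul_assoc trace_mul_sym)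
  then show ?thesis
    by (simp add: lie_bracket_def mm_simps trace_sub matrix_mul_assoc)
qed

section \<open>The dimension of so(7)\<close>

text \<open>The injection \<open>r\<close> serves as an arbitrary total order on the seven indices;
  21 and 28 count the strict and weak upper triangle.\<close>

lemma card_pairs_7:
  fixes r :: "7 \<Rightarrow> nat"
  assumes "inj r"
  shows "card {(i,j). r i < r j} = 21" "card {(i,j). r i \<le> r j} = 28"
proof -
  let ?L = "{(i,j). r i < r j}" and ?G = "{(i,j). r j < r i}" and ?E = "{(i,j). r i = r j}"
  have "card ?G = card (prod.swap ` ?L)"
    by (rule arg_cong[where f = card]) (auto simp: image_iff)
  then have GL: "card ?G = card ?L" by (simp add: card_image)
  have "card ?E = card (range (\<lambda>i::7. (i,i)))"
    by (rule arg_cong[where f = card]) (use assms in \<open>auto simp: inj_def\<close>)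
  then have E: "card ?E = 7" by (simp add: card_image inj_on_def)
  have "card (UNIV :: (7 \<times> 7) set) = card ((?L \<union> ?G) \<union> ?E)"
    by (rule arg_cong[where f = card]) auto
  also have "\<dots> = card ?L + card ?G + card ?E"
    by (subst card_Un_disjoint; (subst card_Un_disjoint)?) auto
  finally show L: "card ?L = 21" using GL E by simp
  have "card {(i,j). r i \<le> r j} = card (?L \<union> ?E)"
    by (rule arg_cong[where f = card]) auto
  also have "\<dots> = card ?L + card ?E" by (subst card_Un_disjoint) auto
  finally show "card {(i,j). r i \<le> r j} = 28" using L E by simp
qed

lemma (in bform) b_ext_axis:
  assumes "\<And>i. b x (axis i 1) = 0" shows "x = 0"
  using b_axis_sum[of x] assms by (intro b_eq_0D) simp

lemma axis_subspace_UNIV: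
  fixes S :: "(complex^'n) set"
  assumes "vec.subspace S" "\<And>i. axis i 1 \<in> S"
  shows "x \<in> S"
proof -
  have "(\<Sum>i\<in>UNIV. x $ i *s axis i 1) \<in> S"
    using assms by (intro vec.subspace_sum vec.subspace_scale) auto
  then show ?thesis by (simp add: basis_expansion)
qed

lemma dim_so_7:
  fixes b :: "complex^7 \<Rightarrow> complex^7 \<Rightarrow> complex"
  assumes "bform b"
  shows "cmat.dim (so b) = 21"
proof (rule antisym)
  interpret bform b by fact
  obtain r :: "7 \<Rightarrow> nat" where r: "inj r"
    using ex_bij_betw_finite_nat[of "UNIV :: 7 set"] by (auto simp: bij_betw_def)
  let ?e = "\<lambda>i. axis i 1 :: complex^7"
  have "cmat.dim (so b) \<le> card {(i,j). r i < r j}"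
  proof (rule common_zero_imp_dim_le[OF cmat_finite_dimensional subspace_so,
        where f = "\<lambda>(i,j) A. b (A *v ?e i) (?e j)"])
    fix A assume A: "A \<in> so b" and z: "\<And>p. p \<in> {(i,j). r i < r j} \<Longrightarrow> (case p of (i,j) \<Rightarrow> \<lambda>A. b (A *v ?e i) (?e j)) A = 0"
    have "b (A *v ?e i) (?e j) = 0" for i j
    proof -
      consider "r i < r j" | "r j < r i" | "i = j" using r by (meson injD linorder_cases)
      then show ?thesis
      proof cases
        case 1 then show ?thesis using z[of "(i,j)"] by simp
      next
        case 2 then show ?thesis using z[of "(j,i)"] soD[OF A, of "?e i" "?e j"] by (simp add: b_commute)
      next
        case 3 then show ?thesis using so_self[OF A] by simp
      qed
    qed
    then have "A *v ?e i = 0" for i by (rule b_ext_axis)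
    then have "column i A = 0" for i by (simp add: mv_axis)
    then show "A = 0" by (simp add: column_def vec_eq_iff)
  qed (auto simp: b_matrix_functional)
  then show "cmat.dim (so b) \<le> 21" by (simp add: card_pairs_7[OF r])
  let ?f = "\<lambda>(i,j) A. b (A *v ?e i) (?e j) + b (A *v ?e j) (?e i)"
  \<comment> \<open>Lower bound: skewness amounts to 28 linear equations on a space of dimension
    49.\<close>
  have "cmat.dim (UNIV :: (complex^7^7) set) \<le> cmat.dim {A\<in>UNIV. \<forall>p\<in>{(i,j). r i \<le> r j}. ?f p A = 0} + card {(i,j). r i \<le> r j}"
    using dim_le_dim_common_kernel[OF cmat_finite_dimensional cmat.subspace_UNIV, of "{(i,j). r i \<le> r j}" ?f]
    by (auto simp: functional_add b_matrix_functional)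
  moreover have "{A\<in>UNIV. \<forall>p\<in>{(i,j). r i \<le> r j}. ?f p A = 0} \<subseteq> so b"
  proof
    fix A assume "A \<in> {A\<in>UNIV. \<forall>p\<in>{(i,j). r i \<le> r j}. ?f p A = 0}"
    then have z: "b (A *v ?e i) (?e j) + b (A *v ?e j) (?e i) = 0" if "r i \<le> r j" for i j using that by auto
    have z: "b (A *v ?e i) (?e j) + b (?e i) (A *v ?e j) = 0" for i j
      using z[of i j] z[of j i] by (cases "r i \<le> r j") (auto simp: b_commute add.commute)
    show "A \<in> so b"
    proof (rule soI)
      fix x y
      have "functional (*s) (\<lambda>y. b (A *v ?e i) y + b (?e i) (A *v y))" for i
        by (simp add: functional_def mv_simps b_simps ring_distribs)
      from axis_subspace_UNIV[OF subspace_kernel_vec[OF this]] z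
      have y: "b (A *v ?e i) y + b (?e i) (A *v y) = 0" for i by simp
      have "functional (*s) (\<lambda>x. b (A *v x) y + b x (A *v y))"
        by (simp add: functional_def mv_simps b_simps ring_distribs)
      from axis_subspace_UNIV[OF subspace_kernel_vec[OF this]] y
      have "b (A *v x) y + b x (A *v y) = 0" by simp
      then show "b (A *v x) y = - b x (A *v y)" by (simp add: add_eq_0_iff2)
    qed
  qed
  ultimately show "21 \<le> cmat.dim (so b)"
    using cmatf.dim_subset[of "{A\<in>UNIV. \<forall>p\<in>{(i,j). r i \<le> r j}. ?f p A = 0}" "so b"]
    by (simp add: card_pairs_7[OF r] cmat_dim_UNIV del: cmatf.dim_UNIV)
qed

section \<open>Eigenvalues\<close>

text \<open>The polynomial det(1 - zA) has value 1 and derivative - tr A at 0. It is therefore not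
  constant, and the inverse of any root is a nonzero eigenvalue; the reversed characteristic
  polynomial is used because it cannot produce the eigenvalue 0.\<close>

lemma trace_nonzero_imp_eigenvalue:
  fixes A :: "complex^'n^'n"
  assumes tr: "trace A \<noteq> 0"
  obtains c v where "c \<noteq> 0" "v \<noteq> 0" "A *v v = c *s v"
proof -
  define M :: "complex poly^'n^'n" where "M = (\<chi> i j. [:if i = j then 1 else 0, - A $ i $ j:])"
  define P where "P = det M"
  have poly_P: "poly P z = det (mat 1 - mscale z A)" for z
  proof -
    have "poly (M $ i $ j) z = (mat 1 - mscale z A) $ i $ j" for i j
      by (simp add: M_def mat_def)
    then show ?thesis by (simp add: P_def det_def poly_sum poly_prod)
  qed
  let ?Q = "\<lambda>p. \<Prod>i\<in>UNIV. M $ i $ p i"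
  have pd: "pderiv (of_int (sign p) * ?Q p) = of_int (sign p) * pderiv (?Q p)" for p :: "'n \<Rightarrow> 'n"
    by (cases "evenperm p") (simp_all add: sign_def pderiv_minus)
  have pd_sum: "pderiv (\<Sum>i\<in>I. f i) = (\<Sum>i\<in>I. pderiv (f i))" for I :: "('n \<Rightarrow> 'n) set" and f :: "_ \<Rightarrow> complex poly"
    by (induction I rule: infinite_finite_induct) (auto simp: pderiv_add)
  \<comment> \<open>A permutation other than the identity moves at least two indices, so after one
    factor has been differentiated another one still vanishes at 0.\<close>
  have Q': "poly (pderiv (?Q p)) 0 = (if p = id then - trace A else 0)" if p: "p permutes UNIV" for p :: "'n \<Rightarrow> 'n"
  proof -
    have "poly (pderiv (?Q p)) 0 = (\<Sum>a\<in>UNIV. (\<Prod>i\<in>UNIV-{a}. if i = p i then 1 else 0) * - A $ a $ p a)"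
      by (simp add: pderiv_prod poly_sum poly_prod M_def pderiv_pCons mult.commute)
    also have "\<dots> = (if p = id then - trace A else 0)"
    proof (cases "p = id")
      case True
      then show ?thesis by (simp add: trace_def sum_negf)
    next
      case False
      then obtain k where k: "p k \<noteq> k" by (auto simp: fun_eq_iff)
      have k2: "p (p k) \<noteq> p k" using k p by (metis permutes_inj injD)
      have "(\<Prod>i\<in>UNIV-{a}. if i = p i then 1 else 0 :: complex) = 0" for a
      proof (rule prod_zero)
        show "\<exists>i\<in>UNIV - {a}. (if i = p i then 1 else 0 :: complex) = 0"
          using k k2 by (cases "a = k") (auto intro: bexI[of _ "p k"] bexI[of _ k])
      qed simp
      then have "(\<Sum>a\<in>UNIV. (\<Prod>i\<in>UNIV-{a}. if i = p i then 1 else 0) * - A $ a $ p a) = 0"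
        by (intro sum.neutral) simp
      then show ?thesis using False by simp
    qed
    finally show ?thesis .
  qed
  have "poly (pderiv P) 0 = (\<Sum>p | p permutes (UNIV :: 'n set). of_int (sign p) * poly (pderiv (?Q p)) 0)"
    by (simp add: P_def det_def pd poly_sum pd_sum)
  also have "\<dots> = (\<Sum>p | p permutes (UNIV :: 'n set). if p = id then - trace A else 0)"
    by (intro sum.cong) (auto simp: Q')
  also have "\<dots> = - trace A" by (simp add: permutes_id)
  finally have "pderiv P \<noteq> 0" using tr by auto
  then have "\<not> constant (poly P)"
    by (metis constant_degree pderiv_eq_0_iff)
  then obtain z where z: "poly P z = 0" using fundamental_theorem_of_algebra by blast
  have "z \<noteq> 0" using z poly_P[of 0] by auto
  have "\<not> invertible (mat 1 - mscale z A)" using z poly_P[of z] by (simp add: invertible_det_nz)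
  then obtain v where v: "v \<noteq> 0" "(mat 1 - mscale z A) *v v = 0"
    by (metis invertible_left_inverse matrix_left_invertible_ker)
  then have "v = z *s (A *v v)" by (simp add: mv_simps)
  then have "A *v v = (1 / z) *s v" using \<open>z \<noteq> 0\<close> by (simp add: vec_eq_iff field_simps)
  then show thesis using that[of "1 / z" v] v \<open>z \<noteq> 0\<close> by simp
qed

section \<open>The orthogonal complement of \<open>\<gg>\<^sub>2\<close> in \<open>\<ss>\<oo>(7)\<close>\<close>

lemma trace_functional: "functional mscale (\<lambda>A. trace (A ** B))" "functional mscale (\<lambda>A. trace (B ** A))"
  by (simp_all add: functional_def mm_simps trace_add mscale_mm trace_mscale)

context bform
begin

definition centralizer :: "complex^'n^'n \<Rightarrow> (complex^'n^'n) set" where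
  "centralizer X = {A \<in> so b. lie_bracket A X = 0}"

lemma subspace_centralizer: "cmat.subspace (centralizer X)"
  using subspace_so
  by (auto simp: centralizer_def cmat.subspace_def lie_bracket_def mm_simps mscale_mm)

lemma self_centralizer: "X \<in> so b \<Longrightarrow> X \<in> centralizer X"
  by (simp add: centralizer_def lie_bracket_def)

end

locale g2 = bform b for b :: "complex^7 \<Rightarrow> complex^7 \<Rightarrow> complex" +
  fixes g :: "(complex^7^7) set"
  assumes g2: "g2_in_so7 b g"
begin

lemma g_simple: "simple_lie_algebra g" and dim_g: "cmat.dim g = 14" and g_so: "g \<subseteq> so b"
  and g_irred: "acts_irreducibly g"
  using g2 by (auto simp: g2_in_so7_def)

lemma subspace_g: "cmat.subspace g"
  and g_bracket: "A \<in> g \<Longrightarrow> B \<in> g \<Longrightarrow> lie_bracket A B \<in> g"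
  and g_ideal: "lie_ideal I g \<Longrightarrow> I = {0} \<or> I = g"
  using g_simple by (auto simp: simple_lie_algebra_def lie_algebra_def)

lemma g_irredD:
  assumes "vec.subspace W" "\<And>A w. A \<in> g \<Longrightarrow> w \<in> W \<Longrightarrow> A *v w \<in> W"
  shows "W = {0} \<or> W = UNIV"
  using g_irred assms by (auto simp: acts_irreducibly_def)

lemma dim_so: "cmat.dim (so b) = 21"
  by (rule dim_so_7) unfold_locales

definition m :: "(complex^7^7) set" where
  "m = {A \<in> so b. \<forall>B\<in>g. trace (B ** A) = 0}"

lemma m_so: "A \<in> m \<Longrightarrow> A \<in> so b"
  and m_orth: "A \<in> m \<Longrightarrow> B \<in> g \<Longrightarrow> trace (B ** A) = 0"
  by (auto simp: m_def)

lemma dim_m: "cmat.dim m = 7"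
  using dim_orthogonal[OF cmat_finite_dimensional subspace_so subspace_g g_so, of "\<lambda>A B. trace (A ** B)"]
    trace_so_nondegenerate dim_so dim_g
  by (simp add: m_def trace_functional)

lemma subspace_m: "cmat.subspace m"
  using subspace_so by (auto simp: m_def cmat.subspace_def mm_simps trace_add mscale_mm trace_mscale)

lemma g_m_bracket:
  assumes "A \<in> g" "X \<in> m" shows "lie_bracket A X \<in> m"
proof -
  have "trace (B ** lie_bracket A X) = 0" if "B \<in> g" for B
    using m_orth[OF assms(2) g_bracket[OF that assms(1)]] by (simp add: trace_bracket)
  then show ?thesis using assms g_so by (auto simp: m_def so_bracket)
qed

text \<open>This intersection is the radical of the trace form on \<open>g\<close>, an ideal by
  invariance of the form, and it is too small to be \<open>g\<close> because 7 < 14.\<close>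

lemma g_inter_m: "g \<inter> m = {0}"
proof -
  have "lie_ideal (g \<inter> m) g"
    using subspace_g subspace_m g_m_bracket g_bracket
    by (auto simp: lie_ideal_def intro: cmat.subspace_inter)
  moreover have "g \<inter> m \<noteq> g"
  proof
    assume "g \<inter> m = g"
    then have "cmat.dim g \<le> cmat.dim m" by (metis cmatf.dim_subset inf.cobounded2)
    then show False by (simp add: dim_m dim_g)
  qed
  ultimately show ?thesis using g_ideal by blast
qed

lemma so_decomp:
  assumes "A \<in> so b"
  obtains B X where "B \<in> g" "X \<in> m" "A = B + X"
proof -
  let ?S = "{x + y |x y. x \<in> g \<and> y \<in> m}"
  have "cmat.dim ?S + cmat.dim (g \<inter> m) = cmat.dim g + cmat.dim m"
    by (rule cmatf.dim_sums_Int[OF subspace_g subspace_m])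
  then have "cmat.dim ?S = 21" by (simp add: g_inter_m dim_g dim_m)
  moreover have "?S \<subseteq> so b" using g_so m_so subspace_so by (auto intro: cmat.subspace_add)
  ultimately have "?S = so b"
    by (intro cmatf.subspace_dim_equal cmat.subspace_sums subspace_g subspace_m subspace_so)
      (simp_all add: dim_so)
  then show thesis using that assms by blast
qed

text \<open>The \<open>m\<close>-component of such an \<open>A\<close> is trace-orthogonal both to
  \<open>m\<close> and to \<open>g\<close>, hence to all of \<open>so b\<close>, and
  vanishes.\<close>

lemma in_gI:
  assumes "A \<in> so b" "\<And>X. X \<in> m \<Longrightarrow> trace (A ** X) = 0"
  shows "A \<in> g"
proof -
  obtain B Y where BY: "B \<in> g" "Y \<in> m" "A = B + Y" using so_decomp[OF assms(1)] .
  have "trace (Y ** Z) = 0" if Z: "Z \<in> so b" for Z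
  proof -
    obtain C X where CX: "C \<in> g" "X \<in> m" "Z = C + X" using so_decomp[OF Z] .
    have "trace (Y ** X) = 0"
      using assms(2)[OF CX(2)] m_orth[OF CX(2) BY(1)] by (simp add: BY(3) mm_simps trace_add)
    moreover have "trace (Y ** C) = 0" using m_orth[OF BY(2) CX(1)] by (metis trace_mul_sym)
    ultimately show ?thesis by (simp add: CX(3) mm_simps trace_add)
  qed
  then have "Y = 0" using trace_so_nondegenerate[of Y] BY(2) m_so by blast
  then show ?thesis using BY by simp
qed

lemma in_mI:
  assumes "A \<in> so b" "\<And>B. B \<in> g \<Longrightarrow> trace (B ** A) = 0"
  shows "A \<in> m"
  using assms by (simp add: m_def)

lemma m_zeroI:
  assumes "Y \<in> m" "\<And>X. X \<in> m \<Longrightarrow> trace (Y ** X) = 0" shows "Y = 0"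
  using in_gI[OF m_so[OF assms(1)] assms(2)] assms(1) g_inter_m by auto

lemma exists_nonisotropic_in_m: "\<exists>X\<in>m. trace (X ** X) \<noteq> 0"
proof (rule ccontr)
  assume "\<not> ?thesis"
  then have z: "trace (X ** X) = 0" if "X \<in> m" for X using that by blast
  have "trace (Y ** X) = 0" if "Y \<in> m" "X \<in> m" for X Y
  proof -
    have "trace ((Y + X) ** (Y + X)) = 0" using that subspace_m by (intro z cmat.subspace_add)
    then show ?thesis
      using z[OF that(1)] z[OF that(2)] trace_mul_sym[of X Y] by (simp add: mm_simps trace_add)
  qed
  then have "m \<subseteq> {0}" using m_zeroI by blast
  then have "cmat.dim m = 0" by simp
  then show False by (simp add: dim_m)
qed

lemma dim_centralizer_g:
  assumes X: "X \<in> m" "X \<noteq> 0"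
  shows "8 \<le> cmat.dim (g \<inter> centralizer X)"
proof -
  obtain B where B: "{X} \<subseteq> B" "B \<subseteq> m" "cmat.independent B" "m \<subseteq> cmat.span B"
    using cmat.maximal_independent_subset_extend[of "{X}" m] X by auto
  have fB: "finite B" using B(3) by (rule cmatf.finiteI_independent)
  have cB: "card B = 7" using cmat.basis_card_eq_dim[OF B(2,4,3)] dim_m by simp
  let ?f = "\<lambda>Z A. trace (lie_bracket A X ** Z)"
  have fun_f: "functional mscale (?f Z)" for Z
    by (simp add: functional_def lie_bracket_def mm_simps mscale_mm trace_add trace_sub trace_mscale algebra_simps)
  have "cmat.dim g \<le> cmat.dim {A\<in>g. \<forall>Z\<in>B - {X}. ?f Z A = 0} + card (B - {X})"
    using dim_le_dim_common_kernel[OF cmat_finite_dimensional subspace_g, of "B - {X}" ?f] fB fun_f by auto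
  moreover
  have "{A\<in>g. \<forall>Z\<in>B - {X}. ?f Z A = 0} \<subseteq> g \<inter> centralizer X"
  proof
    fix A assume "A \<in> {A\<in>g. \<forall>Z\<in>B - {X}. ?f Z A = 0}"
    then have A: "A \<in> g" and z: "\<forall>Z\<in>B - {X}. ?f Z A = 0" by auto
    \<comment> \<open>Since tr([A,X]X) = 0, the basis vector \<open>X\<close> imposes no condition:
      six equations remain and 14 - 6 = 8.\<close>
    have "?f X A = 0" by (simp add: trace_bracket) (simp add: lie_bracket_def trace_def)
    then have "B \<subseteq> {Z. ?f Z A = 0}" using z by auto
    moreover have "cmat.subspace {Z. ?f Z A = 0}"
      by (intro subspace_kernel_cmat trace_functional)
    ultimately have "cmat.span B \<subseteq> {Z. ?f Z A = 0}" by (rule cmat.span_minimal)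
    then have "lie_bracket A X = 0"
      using B(4) by (intro m_zeroI g_m_bracket A X(1)) auto
    then show "A \<in> g \<inter> centralizer X" using A g_so by (auto simp: centralizer_def)
  qed
  then have "cmat.dim {A\<in>g. \<forall>Z\<in>B - {X}. ?f Z A = 0} \<le> cmat.dim (g \<inter> centralizer X)"
    by (rule cmatf.dim_subset)
  moreover have "card (B - {X}) = 6" using B(1) cB by simp
  ultimately show ?thesis using dim_g by linarith
qed

text \<open>\<open>X\<close> commutes with itself and lies outside \<open>g\<close>, which adds one
  to the bound 8.\<close>

lemma dim_centralizer:
  assumes X: "X \<in> m" "X \<noteq> 0"
  shows "9 \<le> cmat.dim (centralizer X)"
proof -
  have sub: "cmat.subspace (g \<inter> centralizer X)" by (intro cmat.subspace_inter subspace_g subspace_centralizer)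
  have "X \<notin> g" using X g_inter_m by auto
  then have "X \<notin> cmat.span (g \<inter> centralizer X)" using sub by (metis IntD1 cmat.span_eq_iff)
  then have "cmat.dim (insert X (g \<inter> centralizer X)) = cmat.dim (g \<inter> centralizer X) + 1"
    by (simp add: cmatf.dim_insert)
  moreover
  have "insert X (g \<inter> centralizer X) \<subseteq> centralizer X"
    using self_centralizer m_so X by auto
  then have "cmat.dim (insert X (g \<inter> centralizer X)) \<le> cmat.dim (centralizer X)"
    by (rule cmatf.dim_subset)
  ultimately show ?thesis using dim_centralizer_g[OF X] by linarith
qed

end

section \<open>Generalized eigenspaces of a skew matrix\<close>

lemma matrix_zero_mv [simp]: "(0 :: complex^'n^'m) *v x = 0"
  by (simp add: vec_eq_iff matrix_vector_mult_def)

lemma centralizer_mv: "lie_bracket A X = 0 \<Longrightarrow> A *v (X *v v) = X *v (A *v v)"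
  using lie_bracket_mv[of A X v] by simp

definition pw :: "complex^'n^'n \<Rightarrow> complex \<Rightarrow> nat \<Rightarrow> complex^'n \<Rightarrow> complex^'n" where
  "pw X c n = (\<lambda>v. X *v v - c *s v) ^^ n"

lemma pw_0 [simp]: "pw X c 0 v = v"
  and pw_Suc: "pw X c (Suc n) v = X *v pw X c n v - c *s pw X c n v"
  by (simp_all add: pw_def)

lemma pw_Suc': "pw X c (Suc n) v = pw X c n (X *v v - c *s v)"
  by (simp only: pw_def funpow_Suc_right o_apply)

lemma pw_pw: "pw X c i (pw X c j v) = pw X c (i + j) v"
  by (simp add: pw_def funpow_add)

lemma pw_add: "pw X c n (v + w) = pw X c n v + pw X c n w"
  by (induction n) (simp_all add: pw_Suc mv_simps vec.scale_right_distrib)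

lemma pw_scale: "pw X c n (d *s v) = d *s pw X c n v"
  by (induction n) (simp_all add: pw_Suc mv_simps vec.scale_right_diff_distrib vec.scale_left_commute)

lemma pw_zero [simp]: "pw X c n 0 = 0"
  using pw_scale[of X c n 0 0] by simp

lemma pw_commute: "lie_bracket A X = 0 \<Longrightarrow> A *v pw X c n v = pw X c n (A *v v)"
proof (induction n)
  case (Suc n)
  then show ?case using centralizer_mv[of A X "pw X c n v"] by (simp add: pw_Suc mv_simps)
qed simp

lemma pw_mono: "pw X c i v = 0 \<Longrightarrow> i \<le> j \<Longrightarrow> pw X c j v = 0"
  using pw_pw[of X c "j - i" i v] by simp

lemma pw_eigen: "X *v v - c *s v = d *s v \<Longrightarrow> pw X c n v = d ^ n *s v"
  by (induction n) (simp_all add: pw_Suc' pw_scale mult.commute)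

definition geig :: "complex^'n^'n \<Rightarrow> complex \<Rightarrow> nat \<Rightarrow> (complex^'n) set" where
  "geig X c n = {v. pw X c n v = 0}"

lemma subspace_geig: "vec.subspace (geig X c n)"
  by (auto simp: geig_def vec.subspace_def pw_add pw_scale)

lemma geig_invariant: "lie_bracket A X = 0 \<Longrightarrow> v \<in> geig X c n \<Longrightarrow> A *v v \<in> geig X c n"
  by (simp add: geig_def flip: pw_commute)

text \<open>The kernels increase with the exponent and their dimensions are bounded, so the chain is
  constant from the first exponent of maximal dimension on.\<close>

lemma geig_stable:
  fixes X :: "complex^'n^'n"
  shows "\<exists>k. \<forall>j\<ge>k. geig X c j = geig X c k"
proof -
  let ?d = "\<lambda>n. vec.dim (geig X c n)"
  have bound: "?d n \<le> vec.dim (UNIV :: (complex^'n) set)" for n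
    by (intro vec.dim_subset) simp
  have "\<exists>k. \<forall>j. ?d j \<le> ?d k"
    using ex_has_greatest_nat[of "\<lambda>_. True" 0 ?d "Suc (vec.dim (UNIV :: (complex^'n) set))"] bound
    by (meson le_imp_less_Suc)
  then obtain k where k: "\<And>j. ?d j \<le> ?d k" by auto
  have "geig X c k = geig X c j" if "j \<ge> k" for j
  proof (rule vec.subspace_dim_equal[OF subspace_geig subspace_geig])
    show "geig X c k \<subseteq> geig X c j" using that by (auto simp: geig_def pw_mono)
  qed (rule k)
  then show ?thesis by metis
qed

lemma span3_of_dim3:
  assumes "vec.subspace S" "vec.dim S = 3"
  obtains x y z where "x \<in> S" "y \<in> S" "z \<in> S" "S = vec.span {x, y, z :: complex^'n}"
proof -
  obtain B where B: "B \<subseteq> S" "vec.independent B" "S \<subseteq> vec.span B" "card B = vec.dim S"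
    using vec.basis_exists by blast
  moreover obtain x y z where "B = {x, y, z}" using B(4) assms(2) by (auto simp: card_3_iff)
  ultimately show thesis
    using that[of x y z] assms(1) by (metis insert_subset vec.span_subspace)
qed

lemma span2_of_dim2:
  assumes "vec.subspace S" "vec.dim S = 2"
  obtains x y where "x \<in> S" "y \<in> S" "S = vec.span {x, y :: complex^'n}"
proof -
  obtain B where B: "B \<subseteq> S" "vec.independent B" "S \<subseteq> vec.span B" "card B = vec.dim S"
    using vec.basis_exists by blast
  moreover obtain x y where "B = {x, y}" using B(4) assms(2) by (auto simp: card_2_iff)
  ultimately show thesis
    using that[of x y] assms(1) by (metis insert_subset vec.span_subspace)
qed

lemma span1_of_dim1:
  assumes "vec.subspace S" "vec.dim S = 1" "x \<in> S" "x \<noteq> 0"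
  shows "S = vec.span {x :: complex^'n}"
proof (rule sym, rule vec.subspace_dim_equal)
  show "vec.span {x} \<subseteq> S" using assms by (intro vec.span_minimal) auto
qed (use assms in auto)

text \<open>Used with \<open>y\<close> built from the image of \<open>x\<close> under
  \<open>X\<close>: an element commuting with \<open>X\<close> that kills \<open>x\<close> then
  kills \<open>y\<close>, so \<open>y\<close> costs no further coefficients.\<close>

lemma extend_pair:
  fixes x y :: "complex^'n"
  assumes S: "vec.subspace S" and xy: "x \<in> S" "y \<in> S" "x \<noteq> 0" "y \<notin> vec.span {x}"
  obtains C where "C \<subseteq> S" "finite C" "card C + 2 = vec.dim S" "S = vec.span (insert x (insert y C))"
proof -
  have neq: "y \<noteq> x" using xy(4) vec.span_base[of x "{x}"] by auto
  have ind: "vec.independent {y, x}"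
    using xy by (auto simp: vec.independent_insert)
  then obtain B where B: "{y, x} \<subseteq> B" "B \<subseteq> S" "vec.independent B" "S \<subseteq> vec.span B"
    using vec.maximal_independent_subset_extend[of "{y, x}" S] xy by auto
  have fB: "finite B" using B(3) by (rule vec.finiteI_independent)
  have cB: "card B = vec.dim S" using vec.basis_card_eq_dim[OF B(2,4,3)] .
  have "card (B - {y, x}) = card B - card {y, x}" using B(1) fB by (intro card_Diff_subset) auto
  moreover have "card {y, x} \<le> card B" using B(1) fB by (rule card_mono[rotated])
  ultimately have "card (B - {y, x}) + 2 = vec.dim S" using cB neq by simp
  moreover have "insert x (insert y (B - {y, x})) = B" using B(1) by auto
  moreover have "S = vec.span B" using B(2,4) S by (metis vec.span_subspace)
  ultimately show thesis using that[of "B - {y, x}"] B(2) fB by auto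
qed

context bform
begin

lemma orth_span:
  assumes "\<And>x. x \<in> S \<Longrightarrow> b v x = 0" "y \<in> vec.span S"
  shows "b v y = 0"
  using vec.span_minimal[OF _ subspace_kernel_vec[OF b_functional(1)], of S v] assms by auto

lemma mv_zero_span:
  assumes "\<And>x. x \<in> S \<Longrightarrow> (A :: complex^'n^'n) *v x = 0" "y \<in> vec.span S"
  shows "A *v y = 0"
proof -
  have "vec.subspace {x. A *v x = 0}" by (auto simp: vec.subspace_def mv_simps)
  from vec.span_minimal[OF _ this, of S] assms show ?thesis by auto
qed

text \<open>By induction b((X - c)x, y) and b(x, (X - d)y) both vanish, and by skewness they add up
  to -(c + d) b(x, y).\<close>

lemma geig_orth:
  assumes X: "X \<in> so b" and cd: "c + d \<noteq> 0"
  shows "pw X c i x = 0 \<Longrightarrow> pw X d j y = 0 \<Longrightarrow> b x y = 0"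
proof (induction "i + j" arbitrary: i j x y rule: less_induct)
  case less
  show ?case
  proof (cases i; cases j)
    fix i' j' assume ij: "i = Suc i'" "j = Suc j'"
    have "b (X *v x - c *s x) y = 0"
      by (rule less.hyps[of i' j]) (use less.prems ij in \<open>auto simp: pw_Suc'\<close>)
    moreover have "b x (X *v y - d *s y) = 0"
      by (rule less.hyps[of i j']) (use less.prems ij in \<open>auto simp: pw_Suc'\<close>)
    ultimately have "(c + d) * b x y = 0"
      using soD[OF X, of x y] by (simp add: b_simps ring_distribs) (metis add.right_inverse add.commute)
    then show ?thesis using cd by simp
  qed (use less.prems in auto)
qed

lemma pw_adjoint: "X \<in> so b \<Longrightarrow> b (pw X c n x) y = (-1) ^ n * b x (pw X (- c) n y)"
proof (induction n arbitrary: x)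
  case (Suc n)
  have "b (pw X c (Suc n) x) y = (-1) ^ n * b (X *v x - c *s x) (pw X (- c) n y)"
    using Suc by (simp add: pw_Suc')
  also have "b (X *v x - c *s x) (pw X (- c) n y) = - b x (pw X (- c) (Suc n) y)"
    using soD[OF Suc.prems] by (simp add: pw_Suc b_simps vec.scale_minus_left)
  finally show ?case by simp
qed simp

text \<open>The range of (X - c)^k contains every vector orthogonal to the kernel of (X + c)^k. So x
  = (X - c)^k z, and stabilization of the kernels puts \<open>z\<close> already into the kernel of
  the k-th power.\<close>

lemma geig_pairing:
  assumes X: "X \<in> so b" and st: "geig X c (k + k) = geig X c k"
    and x: "x \<in> geig X c k" and orth: "\<And>y. y \<in> geig X (- c) k \<Longrightarrow> b x y = 0"
  shows "x = 0"
proof -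
  let ?I = "range (pw X c k)"
  have "vec.subspace ?I"
    unfolding vec.subspace_def by (auto simp flip: pw_add pw_scale intro: range_eqI[of _ _ 0])
  have "x \<in> ?I"
  proof (rule ccontr)
    assume "x \<notin> ?I"
    then obtain y where y: "\<And>u. u \<in> ?I \<Longrightarrow> b u y = 0" "b x y = 1"
      using separate[OF \<open>vec.subspace ?I\<close>] by blast
    have "b z (pw X (- c) k y) = 0" for z
      using y(1)[of "pw X c k z"] pw_adjoint[OF X, of c k z y] by simp
    then have "pw X (- c) k y = 0" using b_eq_0D b_commute by metis
    then show False using orth[of y] y(2) by (simp add: geig_def)
  qed
  then obtain z where z: "x = pw X c k z" by auto
  with x have "z \<in> geig X c (k + k)" by (simp add: geig_def pw_pw)
  then have "z \<in> geig X c k" using st by simp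
  then show ?thesis using z by (simp add: geig_def)
qed

end

text \<open>Two dual generalized eigenspaces \<open>E\<close>, \<open>E'\<close> for \<open>\<plusminus>a\<close> and the orthogonal complement \<open>T\<close>
  of their sum.\<close>

locale fitting = bform b for b :: "complex^7 \<Rightarrow> complex^7 \<Rightarrow> complex" +
  fixes X :: "complex^7^7" and a :: complex and k :: nat and E E' T
  assumes X: "X \<in> so b" and a: "a \<noteq> 0"
    and st: "geig X a (k + k) = geig X a k" "geig X (- a) (k + k) = geig X (- a) k"
  defines "E \<equiv> geig X a k" and "E' \<equiv> geig X (- a) k" and "T \<equiv> perp (E \<union> E')"
begin

lemma sub: "vec.subspace E" "vec.subspace E'" "vec.subspace T"
  by (simp_all add: E_def E'_def T_def subspace_geig subspace_perp)

lemma E_isotropic: "x \<in> E \<Longrightarrow> y \<in> E \<Longrightarrow> b x y = 0"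
  using geig_orth[OF X, of a a k x k y] a by (simp add: E_def geig_def)

lemma E'_isotropic: "x \<in> E' \<Longrightarrow> y \<in> E' \<Longrightarrow> b x y = 0"
  using geig_orth[OF X, of "- a" "- a" k x k y] a by (simp add: E'_def geig_def)

lemma E_pairing: "x \<in> E \<Longrightarrow> (\<And>y. y \<in> E' \<Longrightarrow> b x y = 0) \<Longrightarrow> x = 0"
  using geig_pairing[OF X st(1)] by (simp add: E_def E'_def)

lemma E'_pairing: "x \<in> E' \<Longrightarrow> (\<And>y. y \<in> E \<Longrightarrow> b x y = 0) \<Longrightarrow> x = 0"
  using geig_pairing[OF X st(2)] by (simp add: E_def E'_def)

lemma T_orth: "t \<in> T \<Longrightarrow> x \<in> E \<union> E' \<Longrightarrow> b t x = 0"
  by (auto simp: T_def perp_def b_commute)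

lemma dim_le_of_pairing:
  assumes S: "vec.subspace S" and z: "\<And>x. x \<in> S \<Longrightarrow> (\<And>y. y \<in> R \<Longrightarrow> b x y = 0) \<Longrightarrow> x = 0"
  shows "vec.dim S \<le> vec.dim R"
proof -
  obtain B where B: "B \<subseteq> R" "vec.independent B" "R \<subseteq> vec.span B" "card B = vec.dim R"
    using vec.basis_exists by blast
  have "vec.dim S \<le> card B"
  proof (rule common_zero_imp_dim_le[OF vec.finite_dimensional_vector_space_axioms S, where f = "\<lambda>y x. b x y"])
    show "finite B" using B(2) by (rule vec.finiteI_independent)
    fix x assume "x \<in> S" "\<And>i. i \<in> B \<Longrightarrow> b x i = 0"
    then show "x = 0" using orth_span[of B x] B(3) by (intro z) auto
  qed (rule b_functional)
  then show ?thesis using B(4) by simp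
qed

lemma dim_E': "vec.dim E' = vec.dim E"
  by (rule antisym[OF dim_le_of_pairing[OF sub(2) E'_pairing] dim_le_of_pairing[OF sub(1) E_pairing]])

text \<open>\<open>E\<close> and \<open>E'\<close> are isotropic and in duality. Hence they meet in
  0 and have equal dimension, \<open>b\<close> is nondegenerate on their sum, and \<open>T\<close>
  is a complement to that sum.\<close>

lemma dim_T_and_sum: "vec.dim T + 2 * vec.dim E = 7 \<and> (\<forall>v. \<exists>x\<in>E. \<exists>y\<in>E'. \<exists>t\<in>T. v = x + y + t)"
proof -
  let ?S = "{x + y |x y. x \<in> E \<and> y \<in> E'}"
  have subS: "vec.subspace ?S" by (intro vec.subspace_sums sub)
  have "E \<inter> E' = {0}"
    using E_pairing E'_isotropic vec.subspace_0[OF sub(1)] vec.subspace_0[OF sub(2)] by blast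
  then have dS: "vec.dim ?S = 2 * vec.dim E"
    using vec.dim_sums_Int[OF sub(1,2)] by (simp add: dim_E')
  have "perp ?S = T"
  proof
    show "perp ?S \<subseteq> T"
    proof
      fix t assume t: "t \<in> perp ?S"
      have "E \<union> E' \<subseteq> ?S"
        using vec.subspace_0[OF sub(1)] vec.subspace_0[OF sub(2)] by force
      then show "t \<in> T" using t unfolding T_def perp_def by blast
    qed
    show "T \<subseteq> perp ?S" by (auto simp: T_def perp_def b_simps)
  qed
  then have dT: "vec.dim T + 2 * vec.dim E = 7" using dim_perp[OF subS] dS by simp
  have "?S \<inter> T = {0}"
  proof -
    have "x + y = 0" if "x \<in> E" "y \<in> E'" "x + y \<in> T" for x y
    proof -
      have "x = 0"
      proof (rule E_pairing[OF that(1)])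
        fix z assume "z \<in> E'"
        then show "b x z = 0" using T_orth[OF that(3), of z] E'_isotropic[OF that(2), of z] by (simp add: b_simps)
      qed
      moreover have "y = 0"
      proof (rule E'_pairing[OF that(2)])
        fix z assume "z \<in> E"
        then show "b y z = 0" using T_orth[OF that(3), of z] E_isotropic[OF that(1), of z] by (simp add: b_simps)
      qed
      ultimately show ?thesis by simp
    qed
    moreover have "0 \<in> ?S" "0 \<in> T" using vec.subspace_0[OF subS] vec.subspace_0[OF sub(3)] by blast+
    ultimately show ?thesis by blast
  qed
  then have "vec.dim {x + y |x y. x \<in> ?S \<and> y \<in> T} = 7"
    using vec.dim_sums_Int[OF subS sub(3)] dS dT by simp
  then have "{x + y |x y. x \<in> ?S \<and> y \<in> T} = UNIV"
    using vec.subspace_dim_equal[OF vec.subspace_sums[OF subS sub(3)] vec.subspace_UNIV]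
    by (simp add: vec_dim_card del: vec.dim_UNIV)
  then have "v \<in> {x + y |x y. x \<in> ?S \<and> y \<in> T}" for v by simp
  then have "\<exists>x\<in>E. \<exists>y\<in>E'. \<exists>t\<in>T. v = x + y + t" for v by blast
  with dT show ?thesis by simp
qed

lemma dim_T: "vec.dim T + 2 * vec.dim E = 7"
  using dim_T_and_sum by simp

lemma decomp:
  obtains x y t where "x \<in> E" "y \<in> E'" "t \<in> T" "v = x + y + t"
  using conjunct2[OF dim_T_and_sum] by blast

lemma T_nondeg: "t \<in> T \<Longrightarrow> (\<And>s. s \<in> T \<Longrightarrow> b t s = 0) \<Longrightarrow> t = 0"
proof (rule b_eq_0D)
  fix v assume t: "t \<in> T" "\<And>s. s \<in> T \<Longrightarrow> b t s = 0"
  obtain x y s where "x \<in> E" "y \<in> E'" "s \<in> T" "v = x + y + s" by (rule decomp)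
  then show "b t v = 0" using t T_orth by (simp add: b_simps)
qed

lemma invariant:
  assumes A: "A \<in> so b" "lie_bracket A X = 0"
  shows "x \<in> E \<Longrightarrow> A *v x \<in> E" "x \<in> E' \<Longrightarrow> A *v x \<in> E'" "x \<in> T \<Longrightarrow> A *v x \<in> T"
proof -
  show E: "A *v x \<in> E" if "x \<in> E" for x using that geig_invariant[OF A(2)] by (simp add: E_def)
  show E': "A *v x \<in> E'" if "x \<in> E'" for x using that geig_invariant[OF A(2)] by (simp add: E'_def)
  show "A *v x \<in> T" if "x \<in> T"
  proof -
    have "b y (A *v x) = 0" if y: "y \<in> E \<union> E'" for y
    proof -
      have "A *v y \<in> E \<union> E'" using y E E' by blast
      then have "b x (A *v y) = 0" using T_orth \<open>x \<in> T\<close> by blast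
      then show ?thesis using soD[OF A(1), of x y] b_commute[of y "A *v x"] by simp
    qed
    then show ?thesis by (simp add: T_def perp_def)
  qed
qed

lemma X_invariant: "x \<in> E \<Longrightarrow> X *v x \<in> E" "x \<in> E' \<Longrightarrow> X *v x \<in> E'" "x \<in> T \<Longrightarrow> X *v x \<in> T"
proof -
  have "lie_bracket X X = 0" by (simp add: lie_bracket_def)
  from invariant[OF X this] show "x \<in> E \<Longrightarrow> X *v x \<in> E" "x \<in> E' \<Longrightarrow> X *v x \<in> E'" "x \<in> T \<Longrightarrow> X *v x \<in> T"
    by blast+
qed

text \<open>The action on \<open>E'\<close> is minus the transpose of the action on
  \<open>E\<close>, so only \<open>E\<close> and \<open>T\<close> enter the counts.\<close>

lemma zeroI:
  assumes A: "A \<in> so b" "lie_bracket A X = 0"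
    and zE: "\<And>x. x \<in> E \<Longrightarrow> A *v x = 0" and zT: "\<And>x. x \<in> T \<Longrightarrow> A *v x = 0"
  shows "A = 0"
proof -
  have zE': "A *v y = 0" if "y \<in> E'" for y
    using invariant(2)[OF A that] zE soD[OF A(1)] by (intro E'_pairing) auto
  have "A *v v = 0" for v
  proof -
    obtain x y t where "x \<in> E" "y \<in> E'" "t \<in> T" "v = x + y + t" by (rule decomp)
    then show ?thesis using zE zE' zT by (simp add: mv_simps)
  qed
  then show ?thesis by (simp add: matrix_eq)
qed

lemma eigen_E':
  assumes "\<And>x. x \<in> E \<Longrightarrow> X *v x = a *s x" "y \<in> E'"
  shows "X *v y = - a *s y"
proof -
  have 1: "X *v y + a *s y \<in> E'"
    using vec.subspace_add sub(2) X_invariant(2) vec.subspace_scale assms(2) by blast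
  have 2: "b (X *v y + a *s y) x = 0" if x: "x \<in> E" for x
    using assms(1)[OF x] soD[OF X, of y x] by (simp add: b_add_left b_scale_left b_scale_right)
  have "X *v y + a *s y = 0"
    by (rule E'_pairing[OF 1 2])
  then show ?thesis by (metis eq_neg_iff_add_eq_0 vec.scale_minus_left)
qed

end

lemma ex_nonzero_of_dim:
  fixes S :: "(complex^'n) set"
  assumes "vec.dim S \<noteq> 0" shows "\<exists>x\<in>S. x \<noteq> 0"
  using assms by auto

section \<open>Centralizer bounds according to the dimension of the eigenspace\<close>

context fitting
begin

lemma E_zero:
  assumes "A *v u \<in> E" "E' = vec.span S" "\<And>y. y \<in> S \<Longrightarrow> b (A *v u) y = 0"
  shows "A *v u = 0"
  using assms orth_span[of S "A *v u"] by (intro E_pairing) auto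

lemma T_zero:
  assumes A: "A \<in> so b" "lie_bracket A X = 0" and S: "S \<subseteq> T" "T = vec.span S"
    and z: "\<And>x y. x \<in> S \<Longrightarrow> y \<in> S \<Longrightarrow> b (A *v x) y = 0" and t: "t \<in> T"
  shows "A *v t = 0"
proof (rule mv_zero_span)
  show "t \<in> vec.span S" using S t by simp
  fix x assume x: "x \<in> S"
  show "A *v x = 0"
  proof (rule T_nondeg)
    show "A *v x \<in> T" using invariant(3)[OF A] x S(1) by blast
    fix s assume "s \<in> T"
    then have "s \<in> vec.span S" using S(2) by blast
    then show "b (A *v x) s = 0" using orth_span[of S "A *v x" s] z[OF x] by blast
  qed
qed

text \<open>The centralizer embeds in gl(E) + so(T) with dim E = 2 and dim T = 3, which gives 4 + 3
  = 7.\<close>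

lemma dim_centralizer_2:
  assumes p: "vec.dim E = 2"
  shows "cmat.dim (centralizer X) \<le> 7"
proof -
  obtain u1 u2 where u: "u1 \<in> E" "u2 \<in> E" "E = vec.span {u1, u2}"
    using span2_of_dim2[OF sub(1) p] .
  obtain v1 v2 where v: "v1 \<in> E'" "v2 \<in> E'" "E' = vec.span {v1, v2}"
    using span2_of_dim2[OF sub(2)] p dim_E' by metis
  have "vec.dim T = 3" using dim_T p by simp
  then obtain c1 c2 c3 where c: "c1 \<in> T" "c2 \<in> T" "c3 \<in> T" "T = vec.span {c1, c2, c3}"
    using span3_of_dim3[OF sub(3)] by metis
  let ?fs = "[\<lambda>A. b (A *v u1) v1, \<lambda>A. b (A *v u1) v2, \<lambda>A. b (A *v u2) v1, \<lambda>A. b (A *v u2) v2,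
    \<lambda>A. b (A *v c1) c2, \<lambda>A. b (A *v c1) c3, \<lambda>A. b (A *v c2) c3]"
  have "cmat.dim (centralizer X) \<le> length ?fs"
  proof (rule common_zero_list_imp_dim_le[OF cmat_finite_dimensional subspace_centralizer])
    fix A assume "A \<in> centralizer X" and z: "\<forall>f\<in>set ?fs. f A = 0"
    then have A: "A \<in> so b" "lie_bracket A X = 0" by (auto simp: centralizer_def)
    have "b (A *v u1) v1 = 0" "b (A *v u1) v2 = 0" "b (A *v u2) v1 = 0" "b (A *v u2) v2 = 0"
      and zc: "b (A *v c1) c2 = 0" "b (A *v c1) c3 = 0" "b (A *v c2) c3 = 0"
      using z by simp_all
    then have zu: "A *v u1 = 0" "A *v u2 = 0"
      using E_zero[OF invariant(1)[OF A u(1)] v(3)] E_zero[OF invariant(1)[OF A u(2)] v(3)] by auto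
    show "A = 0"
    proof (rule zeroI[OF A])
      show "A *v x = 0" if "x \<in> E" for x
        using mv_zero_span[of "{u1, u2}" A x] zu that u(3) by auto
      have "b (A *v x) y = 0" if "x \<in> {c1, c2, c3}" "y \<in> {c1, c2, c3}" for x y
        using that zc so_self[OF A(1)] soD[OF A(1), of c2 c1] soD[OF A(1), of c3 c1] soD[OF A(1), of c3 c2]
          b_commute[of c1 "A *v c2"] b_commute[of c1 "A *v c3"] b_commute[of c2 "A *v c3"]
          b_commute[of c2 "A *v c1"] b_commute[of c3 "A *v c1"] b_commute[of c3 "A *v c2"] by auto
      then show "A *v t = 0" if "t \<in> T" for t
        using T_zero[OF A _ c(4) _ that] c(1-3) by blast
    qed
  qed (auto simp: b_matrix_functional)
  then show ?thesis by simp
qed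

lemma geig_no_other_eigenvalue:
  assumes "X *v v - a *s v = d *s v" "d \<noteq> 0" "v \<in> E" shows "v = 0"
  using pw_eigen[OF assms(1), of k] assms(2,3) by (simp add: E_def geig_def)

text \<open>If \<open>x\<close> is not an eigenvector, then \<open>x\<close>, y = (X - a)x and some
  \<open>w\<close> span \<open>E\<close>. A commuting skew matrix is fixed by its values at
  \<open>x\<close> and \<open>w\<close>, which are 6 coefficients, because the line \<open>T\<close>
  contributes so(1) = 0.\<close>

lemma X_on_E_of_dim3:
  assumes p: "vec.dim E = 3" and large: "9 \<le> cmat.dim (centralizer X)" and x: "x \<in> E"
  shows "X *v x = a *s x"
proof (rule ccontr)
  assume neq: "X *v x \<noteq> a *s x"
  define y where "y = X *v x - a *s x"
  have y: "y \<in> E" unfolding y_def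
    using vec.subspace_diff sub(1) X_invariant(1) vec.subspace_scale x by blast
  have x0: "x \<noteq> 0" using neq by auto
  have "y \<notin> vec.span {x}"
  proof
    assume "y \<in> vec.span {x}"
    then obtain d where d: "y = d *s x" by (auto simp: vec.span_singleton)
    then have "d \<noteq> 0" using neq by (auto simp: y_def)
    then show False using geig_no_other_eigenvalue[of x d] d x x0 by (simp add: y_def)
  qed
  then obtain C where C: "C \<subseteq> E" "finite C" "card C + 2 = vec.dim E" "E = vec.span (insert x (insert y C))"
    using extend_pair[OF sub(1) x y x0] by blast
  then obtain w where w: "C = {w}" using p by (auto simp: card_1_singleton_iff)
  obtain v1 v2 v3 where v: "v1 \<in> E'" "v2 \<in> E'" "v3 \<in> E'" "E' = vec.span {v1, v2, v3}"
    using span3_of_dim3[OF sub(2)] p dim_E' by metis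
  have dT: "vec.dim T = 1" using dim_T p by simp
  then obtain e where "e \<in> T" "e \<noteq> 0"
    using ex_nonzero_of_dim by (metis zero_neq_one)
  then have Te: "T = vec.span {e}" using span1_of_dim1[OF sub(3) dT] by blast
  let ?fs = "[\<lambda>A. b (A *v x) v1, \<lambda>A. b (A *v x) v2, \<lambda>A. b (A *v x) v3,
    \<lambda>A. b (A *v w) v1, \<lambda>A. b (A *v w) v2, \<lambda>A. b (A *v w) v3]"
  have "cmat.dim (centralizer X) \<le> length ?fs"
  proof (rule common_zero_list_imp_dim_le[OF cmat_finite_dimensional subspace_centralizer])
    fix A assume "A \<in> centralizer X" and z: "\<forall>f\<in>set ?fs. f A = 0"
    then have A: "A \<in> so b" "lie_bracket A X = 0" by (auto simp: centralizer_def)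
    have wE: "w \<in> E" using C(1) w by simp
    have zz: "b (A *v x) v1 = 0" "b (A *v x) v2 = 0" "b (A *v x) v3 = 0"
       "b (A *v w) v1 = 0" "b (A *v w) v2 = 0" "b (A *v w) v3 = 0"
      using z by simp_all
    then have zu: "A *v x = 0" "A *v w = 0"
      using E_zero[OF invariant(1)[OF A x] v(4)] E_zero[OF invariant(1)[OF A wE] v(4)] by auto
    then have "A *v y = 0" using centralizer_mv[OF A(2), of x] by (simp add: y_def mv_simps)
    show "A = 0"
    proof (rule zeroI[OF A])
      show "A *v t = 0" if "t \<in> E" for t
        using mv_zero_span[of "{x, y, w}" A t] zu \<open>A *v y = 0\<close> that C(4) w by auto
      show "A *v t = 0" if "t \<in> T" for t
        using T_zero[OF A _ Te _ that] \<open>e \<in> T\<close> so_self[OF A(1)] by auto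
    qed
  qed (auto simp: b_matrix_functional)
  then show False using large by simp
qed

lemma exists_axis_of_dim3:
  assumes p: "vec.dim E = 3" and large: "9 \<le> cmat.dim (centralizer X)"
  shows "\<exists>e. b e e \<noteq> 0 \<and> X *v e = 0 \<and> (\<forall>w. b w e = 0 \<longrightarrow> X *v (X *v w) = a\<^sup>2 *s w)"
proof -
  have dT: "vec.dim T = 1" using dim_T p by simp
  then obtain e where e: "e \<in> T" "e \<noteq> 0"
    using ex_nonzero_of_dim by (metis zero_neq_one)
  then have Te: "T = vec.span {e}" using span1_of_dim1[OF sub(3) dT] by blast
  have ee: "b e e \<noteq> 0"
  proof
    assume "b e e = 0"
    then have "b e s = 0" if "s \<in> T" for s using that by (auto simp: Te vec.span_singleton b_simps)
    then show False using T_nondeg e by blast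
  qed
  have XX: "lie_bracket X X = 0" by (simp add: lie_bracket_def)
  have "X *v e = 0" using T_zero[OF X XX _ Te _ e(1)] e(1) so_self[OF X] by auto
  moreover have "X *v (X *v w) = a\<^sup>2 *s w" if "b w e = 0" for w
  proof -
    obtain x y t where w: "x \<in> E" "y \<in> E'" "t \<in> T" "w = x + y + t" by (rule decomp)
    obtain d where d: "t = d *s e" using w(3) by (auto simp: Te vec.span_singleton)
    have "b x e = 0" "b y e = 0" using T_orth[OF e(1)] w b_commute by (metis UnI1 UnI2)+
    then have "d = 0" using that ee by (simp add: w(4) d b_simps)
    then have "w = x + y" by (simp add: w(4) d)
    moreover have "X *v x = a *s x" using X_on_E_of_dim3[OF p large] w(1) .
    moreover have "X *v y = - a *s y" using eigen_E' X_on_E_of_dim3[OF p large] w(2) by blast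
    ultimately show ?thesis
      by (simp add: mv_simps vec.scale_right_distrib power2_eq_square)
  qed
  ultimately show ?thesis using ee by blast
qed

text \<open>Here dim T = 5. If \<open>X\<close> did not vanish on \<open>T\<close>, a commuting
  element would be fixed by one coefficient on \<open>E\<close> and seven on \<open>T\<close>: four
  for a vector \<open>z\<close>, none for \<open>X z\<close>, and three for the remaining basis
  vectors. The total 8 is just below the bound 9.\<close>

lemma X_on_T_of_dim1:
  assumes p: "vec.dim E = 1" and large: "9 \<le> cmat.dim (centralizer X)" and t: "t \<in> T"
  shows "X *v t = 0"
proof (rule ccontr)
  assume neq: "X *v t \<noteq> 0"
  have dT: "vec.dim T = 5" using dim_T p by simp
  obtain z where z: "z \<in> T" "X *v z \<noteq> 0" "b z z \<noteq> 0"
  proof -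
    have "\<exists>z\<in>T. b z z \<noteq> 0"
    proof (rule ccontr)
      assume "\<not> ?thesis"
      then have iso: "b z z = 0" if "z \<in> T" for z using that by blast
      have "b z w = 0" if "z \<in> T" "w \<in> T" for z w
        using iso[of "z + w"] iso[OF that(1)] iso[OF that(2)] vec.subspace_add[OF sub(3) that]
        by (simp add: b_simps b_commute)
      then have "T \<subseteq> {0}" using T_nondeg by blast
      then have "vec.dim T = 0" by simp
      then show False using dT by simp
    qed
    then obtain z0 where z0: "z0 \<in> T" "b z0 z0 \<noteq> 0" by blast
    show thesis
    proof (cases "X *v z0 = 0 \<and> b t t = 0")
      case True
      have tz: "t + z0 \<in> T" "t - z0 \<in> T" using t z0 sub(3) vec.subspace_add vec.subspace_diff by blast+
      \<comment> \<open>The two values add up to 2 b(z0, z0), so they are not both zero.\<close>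
      have "b (t + z0) (t + z0) \<noteq> 0 \<or> b (t - z0) (t - z0) \<noteq> 0"
        using True z0(2) b_commute[of z0 t] by (auto simp: b_simps)
      moreover have "X *v (t + z0) \<noteq> 0" "X *v (t - z0) \<noteq> 0" using True neq by (simp_all add: mv_simps)
      ultimately show thesis using that tz by blast
    qed (use that z0 t neq in blast)
  qed
  \<comment> \<open>\<open>y\<close> is orthogonal to \<open>z\<close> by skewness; as
    \<open>z\<close> is not isotropic and \<open>y\<close> is nonzero, they are independent.\<close>
  define y where "y = X *v z"
  have y: "y \<in> T" using X_invariant(3)[OF z(1)] by (simp add: y_def)
  have z0: "z \<noteq> 0" using z by auto
  have "y \<notin> vec.span {z}"
  proof
    assume "y \<in> vec.span {z}"
    then obtain d where "y = d *s z" by (auto simp: vec.span_singleton)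
    then show False using so_self[OF X, of z] z y_def by (auto simp: b_simps)
  qed
  then obtain C where C: "C \<subseteq> T" "finite C" "card C + 2 = vec.dim T" "T = vec.span (insert z (insert y C))"
    using extend_pair[OF sub(3) z(1) y z0] by blast
  then obtain c1 c2 c3 where c: "C = {c1, c2, c3}" using dT by (auto simp: card_3_iff)
  obtain u where u: "u \<in> E" "u \<noteq> 0"
    using p ex_nonzero_of_dim by (metis zero_neq_one)
  have Eu: "E = vec.span {u}" using span1_of_dim1[OF sub(1) p u] .
  obtain v where v: "v \<in> E'" "v \<noteq> 0"
    using p dim_E' using ex_nonzero_of_dim by (metis zero_neq_one)
  have Ev: "E' = vec.span {v}" using span1_of_dim1[OF sub(2) _ v] p dim_E' by simp
  let ?fs = "[\<lambda>A. b (A *v u) v, \<lambda>A. b (A *v z) y, \<lambda>A. b (A *v z) c1, \<lambda>A. b (A *v z) c2, \<lambda>A. b (A *v z) c3,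
    \<lambda>A. b (A *v c1) c2, \<lambda>A. b (A *v c1) c3, \<lambda>A. b (A *v c2) c3]"
  have "cmat.dim (centralizer X) \<le> length ?fs"
  proof (rule common_zero_list_imp_dim_le[OF cmat_finite_dimensional subspace_centralizer])
    fix A assume "A \<in> centralizer X" and zf: "\<forall>f\<in>set ?fs. f A = 0"
    then have A: "A \<in> so b" "lie_bracket A X = 0" by (auto simp: centralizer_def)
    have zz: "b (A *v u) v = 0" "b (A *v z) y = 0" "b (A *v z) c1 = 0" "b (A *v z) c2 = 0" "b (A *v z) c3 = 0"
      and zc: "b (A *v c1) c2 = 0" "b (A *v c1) c3 = 0" "b (A *v c2) c3 = 0"
      using zf by simp_all
    have swap: "b (A *v p) q = - b (A *v q) p" for p q
      using soD[OF A(1)] b_commute by metis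
    have Au: "A *v u = 0" using E_zero[OF invariant(1)[OF A u(1)] Ev] zz(1) by auto
    have Az: "A *v z = 0"
    proof (rule T_nondeg)
      show "A *v z \<in> T" using invariant(3)[OF A z(1)] .
      have "b (A *v z) x = 0" if "x \<in> insert z (insert y C)" for x
        using that zz so_self[OF A(1)] c by auto
      then show "b (A *v z) s = 0" if "s \<in> T" for s
        using orth_span[of "insert z (insert y C)" "A *v z" s] that C(4) by blast
    qed
    then have Ay: "A *v y = 0" using centralizer_mv[OF A(2), of z] by (simp add: y_def)
    show "A = 0"
    proof (rule zeroI[OF A])
      show "A *v x = 0" if "x \<in> E" for x
        using mv_zero_span[of "{u}" A x] Au that Eu by auto
      have "b (A *v p) q = 0" if "p \<in> insert z (insert y C)" "q \<in> insert z (insert y C)" for p q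
        using that zc so_self[OF A(1)] Az Ay swap[of p q] swap[of c2 c1] swap[of c3 c1] swap[of c3 c2] c by auto
      then show "A *v t = 0" if "t \<in> T" for t
        using T_zero[OF A _ C(4) _ that] C(1) z(1) y by blast
    qed
  qed (auto simp: b_matrix_functional)
  then show False using large by simp
qed

lemma rank2_of_dim1:
  assumes p: "vec.dim E = 1" and large: "9 \<le> cmat.dim (centralizer X)"
  shows "\<exists>u v. b u u = 0 \<and> b v v = 0 \<and> b u v = 1 \<and> X = mscale a (wedge v u)"
proof -
  obtain u where u: "u \<in> E" "u \<noteq> 0"
    using p ex_nonzero_of_dim by (metis zero_neq_one)
  have Eu: "E = vec.span {u}" using span1_of_dim1[OF sub(1) p u] .
  obtain w where w: "w \<in> E'" "b u w \<noteq> 0" using E_pairing u by blast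
  define v where "v = (1 / b u w) *s w"
  have v: "v \<in> E'" using w sub(2) by (simp add: v_def vec.subspace_scale)
  have uv: "b u v = 1" using w by (simp add: v_def b_simps)
  have "v \<noteq> 0" using uv by auto
  then have Ev: "E' = vec.span {v}"
    using span1_of_dim1[OF sub(2) _ v] p dim_E' by simp
  have Xx: "X *v x = a *s x" if x: "x \<in> E" for x
  proof -
    have "X *v x - a *s x \<in> E"
      by (rule vec.subspace_diff[OF sub(1) X_invariant(1)[OF x] vec.subspace_scale[OF sub(1) x]])
    show ?thesis
    proof (cases "x = 0")
      case False
      then have "E = vec.span {x}" using span1_of_dim1[OF sub(1) p x] by blast
      then obtain d where d: "X *v x - a *s x = d *s x"
        using \<open>X *v x - a *s x \<in> E\<close> by (auto simp: vec.span_singleton)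
      then have "d = 0" using geig_no_other_eigenvalue[OF d _ x] False by blast
      then show ?thesis using d by simp
    qed simp
  qed
  have "X *v s = mscale a (wedge v u) *v s" for s
  proof -
    obtain x y t where s: "x \<in> E" "y \<in> E'" "t \<in> T" "s = x + y + t" by (rule decomp)
    obtain d where d: "x = d *s u" using s(1) by (auto simp: Eu vec.span_singleton)
    obtain d' where d': "y = d' *s v" using s(2) by (auto simp: Ev vec.span_singleton)
    have X1: "X *v x = a *s x" and X2: "X *v y = - a *s y" and X3: "X *v t = 0"
      using Xx[OF s(1)] eigen_E'[OF Xx s(2)] X_on_T_of_dim1[OF p large s(3)] by auto
    have "b u t = 0" "b v t = 0" "b u u = 0" "b v v = 0" "b v u = 1"
      using T_orth[OF s(3)] u v uv E_isotropic E'_isotropic b_commute by (metis UnI1 UnI2)+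
    then show ?thesis
      unfolding s(4) mv_simps X1 X2 X3
      by (simp add: d d' wedge_mv b_simps uv vec.scale_right_diff_distrib vec.scale_right_distrib vec_eq_iff)
  qed
  then have "X = mscale a (wedge v u)" by (simp add: matrix_eq)
  then show ?thesis using E_isotropic u E'_isotropic v uv by blast
qed

end

section \<open>The two possible shapes of an element with large centralizer\<close>

text \<open>If X^2 v = a^2 v, then either X v + a v vanishes or it is an eigenvector for
  \<open>a\<close>. The square is needed because a skew matrix itself has trace 0.\<close>

lemma ex_nonzero_eigenvalue:
  fixes X :: "complex^'n^'n"
  assumes "trace (X ** X) \<noteq> 0"
  shows "\<exists>a u. a \<noteq> 0 \<and> u \<noteq> 0 \<and> X *v u = a *s u"
proof -
  obtain c v where c: "c \<noteq> 0" "v \<noteq> 0" "X ** X *v v = c *s v"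
    using trace_nonzero_imp_eigenvalue[OF assms] .
  define a where "a = csqrt c"
  have a: "a \<noteq> 0" "a * a = c" using c(1) by (simp_all add: a_def power2_eq_square[symmetric])
  have XX: "X *v (X *v v) = (a * a) *s v" using c(3) a(2) by (simp add: matrix_vector_mul_assoc)
  show ?thesis
  proof (cases "X *v v + a *s v = 0")
    case True
    then have "X *v v = (- a) *s v" by (metis eq_neg_iff_add_eq_0 vec.scale_minus_left)
    then show ?thesis using a c(2) by (metis neg_equal_0_iff_equal)
  next
    case False
    have "X *v (X *v v + a *s v) = a *s (X *v v + a *s v)"
      by (simp add: mv_simps XX vec.scale_right_distrib add.commute)
    then show ?thesis using False a by blast
  qed
qed

lemma large_centralizer_cases:
  fixes X :: "complex^7^7" and b :: "complex^7 \<Rightarrow> complex^7 \<Rightarrow> complex"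
  assumes b: "bform b" and X: "X \<in> so b" and tr: "trace (X ** X) \<noteq> 0"
    and large: "9 \<le> cmat.dim (bform.centralizer b X)"
  shows "(\<exists>a e. a \<noteq> 0 \<and> b e e \<noteq> 0 \<and> X *v e = 0 \<and> (\<forall>w. b w e = 0 \<longrightarrow> X *v (X *v w) = a\<^sup>2 *s w)) \<or>
    (\<exists>a u v. a \<noteq> 0 \<and> b u u = 0 \<and> b v v = 0 \<and> b u v = 1 \<and> X = mscale a (bform.wedge b v u))"
proof -
  interpret bform b by fact
  obtain a u where eig: "a \<noteq> 0" "u \<noteq> 0" "X *v u = a *s u" using ex_nonzero_eigenvalue[OF tr] by blast
  obtain k1 where k1: "\<And>j. j \<ge> k1 \<Longrightarrow> geig X a j = geig X a k1" using geig_stable by metis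
  obtain k2 where k2: "\<And>j. j \<ge> k2 \<Longrightarrow> geig X (- a) j = geig X (- a) k2" using geig_stable by metis
  \<comment> \<open>Beyond both points of stabilization, and positive so that honest eigenvectors
    lie in the generalized eigenspace.\<close>
  define k where "k = Suc (k1 + k2)"
  have st: "geig X a (k + k) = geig X a k" "geig X (- a) (k + k) = geig X (- a) k"
    using k1[of "k + k"] k1[of k] k2[of "k + k"] k2[of k] by (simp_all add: k_def)
  interpret fitting b X a k "geig X a k" "geig X (- a) k" "perp (geig X a k \<union> geig X (- a) k)"
    by unfold_locales (use X eig st in auto)
  have "u \<in> geig X a k" unfolding geig_def k_def mem_Collect_eq pw_Suc' using eig(3) by simp
  then have "geig X a k \<noteq> {0}" "\<not> geig X a k \<subseteq> {0}" using eig(2) by auto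
  then have "vec.dim (geig X a k) \<noteq> 0" by simp
  then consider "vec.dim (geig X a k) = 1" | "vec.dim (geig X a k) = 2" | "vec.dim (geig X a k) = 3"
    using dim_T by linarith
  then show ?thesis
  proof cases
    case 1
    then show ?thesis using rank2_of_dim1 large eig(1) by blast
  next
    case 2
    then show ?thesis using dim_centralizer_2 large by simp
  next
    case 3
    then show ?thesis using exists_axis_of_dim3 large eig(1) by blast
  qed
qed

section \<open>An element of the complement with a three-dimensional eigenspace\<close>

context g2
begin

lemma trace_wedge_m: "Y \<in> m \<Longrightarrow> trace (wedge x y ** Y) = 2 * b (Y *v y) x"
  using trace_so_wedge[of Y x y] m_so trace_mul_sym[of Y "wedge x y"] by metis

lemma hyperbolic_plane_perp_dual:
  assumes uv: "b u u = 0" "b v v = 0" "b u v = 1" and p: "p \<in> perp {u, v}" "p \<noteq> 0"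
  shows "\<exists>r\<in>perp {u, v}. b r p = 1"
proof -
  obtain y where y: "b p y = 1"
    using separate[OF vec.subspace_single_0, of p] p(2) by auto
  \<comment> \<open>Orthogonal projection off the plane spanned by \<open>u\<close> and
    \<open>v\<close>; the pairing with \<open>p\<close> is unaffected.\<close>
  define r where "r = y - b y v *s u - b y u *s v"
  have "r \<in> perp {u, v}" using uv by (simp add: perp_def r_def b_simps b_commute)
  moreover have "b r p = 1" using p(1) y by (simp add: perp_def r_def b_simps b_commute)
  ultimately show ?thesis by blast
qed

lemma hyperbolic_plane_zeroI:
  assumes uv: "b u u = 0" "b v v = 0" "b u v = 1"
    and z: "b x u = 0" "b x v = 0" "\<And>r. r \<in> perp {u, v} \<Longrightarrow> b x r = 0"
  shows "x = 0"
proof (rule b_eq_0D)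
  fix y
  define r where "r = y - b y v *s u - b y u *s v"
  have r: "r \<in> perp {u, v}" using uv by (simp add: perp_def r_def b_simps b_commute)
  have "y = r + b y v *s u + b y u *s v" by (simp add: r_def)
  then have "b x y = b x r + b y v * b x u + b y u * b x v" by (metis b_add_right b_scale_right)
  then show "b x y = 0" using z r by simp
qed

text \<open>The vectors of T = perp {u, v} orthogonal to all \<open>A u\<close> form a subspace
  stable under so(T), which lies in \<open>g\<close> by \<open>wg\<close>. Such a subspace is 0 or
  \<open>T\<close>, and 0 is excluded because it would make dim m at most 6.\<close>

lemma hyperbolic_plane_stable:
  assumes uv: "b u u = 0" "b v v = 0" "b u v = 1"
    and wg: "\<And>r s. r \<in> perp {u, v} \<Longrightarrow> s \<in> perp {u, v} \<Longrightarrow> wedge r s \<in> g"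
    and A: "A \<in> g" and x: "x \<in> perp {u, v}"
  shows "b (A *v u) x = 0"
proof -
  let ?T = "perp {u, v}"
  define J where "J = {x\<in>?T. \<forall>A\<in>g. b (A *v u) x = 0}"
  have subT: "vec.subspace ?T" by (rule subspace_perp)
  have subJ: "vec.subspace J"
    using subT by (auto simp: J_def vec.subspace_def b_simps)
  have inv: "wedge r s *v x \<in> J" if rs: "r \<in> ?T" "s \<in> ?T" and x: "x \<in> J" for r s x
  proof -
    have "b (A *v u) (wedge r s *v x) = 0" if A: "A \<in> g" for A
    proof -
      have "lie_bracket (wedge r s) A \<in> g" by (rule g_bracket[OF wg[OF rs] A])
      then have "b (lie_bracket (wedge r s) A *v u) x = 0" using x by (simp add: J_def)
      moreover have "wedge r s *v u = 0" using rs by (simp add: wedge_mv perp_def b_commute)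
      ultimately have "b (wedge r s *v (A *v u)) x = 0"
        by (simp add: lie_bracket_mv)
      then show ?thesis using soD[OF wedge_so] by simp
    qed
    moreover have "wedge r s *v x \<in> ?T"
      unfolding wedge_mv using rs subT by (simp add: vec.subspace_diff vec.subspace_scale)
    ultimately show ?thesis by (simp add: J_def)
  qed
  have "\<exists>x\<in>J. x \<noteq> 0"
  proof (rule ccontr)
    assume J0: "\<not> ?thesis"
    obtain B where B: "B \<subseteq> ?T" "vec.independent B" "?T \<subseteq> vec.span B" "card B = vec.dim ?T"
      using vec.basis_exists by blast
    have fB: "finite B" using B(2) by (rule vec.finiteI_independent)
    have "vec.independent {u, v}"
    proof -
      have "u \<notin> vec.span {v}" using uv by (auto simp: vec.span_singleton b_simps)
      moreover have "v \<noteq> 0" using uv by auto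
      ultimately show ?thesis by (auto simp: vec.independent_insert)
    qed
    moreover have "u \<noteq> v" using uv by auto
    ultimately have "vec.dim (vec.span {u, v}) = 2" by (simp add: vec.dim_eq_card_independent)
    then have dT: "vec.dim ?T = 5"
      using dim_perp[OF vec.subspace_span, of "{u, v}"] by (simp add: perp_span)
    \<comment> \<open>If Y u = 0, then \<open>Y\<close> is the wedge of \<open>u\<close> with t = Y
      v, because \<open>Y\<close> is orthogonal to so(T). Orthogonality to \<open>g\<close> then
      says that \<open>t\<close> lies in \<open>J\<close>. With J = 0 the 1 + 5 coefficients of
      \<open>Y u\<close> would thus determine \<open>Y\<close>.\<close>
    have "cmat.dim m \<le> card (insert v B)"
    proof (rule common_zero_imp_dim_le[OF cmat_finite_dimensional subspace_m, where f = "\<lambda>y Y. b (Y *v u) y"])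
      show "finite (insert v B)" using fB by simp
      show "functional mscale (\<lambda>Y. b (Y *v u) i)" for i by (rule b_matrix_functional)
      fix Y assume Y: "Y \<in> m" and z: "\<And>i. i \<in> insert v B \<Longrightarrow> b (Y *v u) i = 0"
      have Yso: "Y \<in> so b" by (rule m_so[OF Y])
      have Yu: "Y *v u = 0"
      proof (rule hyperbolic_plane_zeroI[OF uv])
        show "b (Y *v u) r = 0" if "r \<in> ?T" for r
          using orth_span[of B "Y *v u" r] z that B(3) by blast
      qed (use z so_self[OF Yso] in auto)
      define t where "t = Y *v v"
      have tT: "t \<in> ?T"
        using so_self[OF Yso, of v] soD[OF Yso, of v u] Yu by (simp add: perp_def t_def b_commute)
      have YT: "b (Y *v r) s = 0" if "r \<in> ?T" "s \<in> ?T" for r s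
        using m_orth[OF Y wg[OF that(2,1)]] trace_wedge_m[OF Y, of s r] by simp
      have Y_eq: "Y = wedge u t"
      proof -
        have "Y *v y = wedge u t *v y" for y
        proof -
          define r where "r = y - b y v *s u - b y u *s v"
          have r: "r \<in> perp {u, v}" using uv by (simp add: perp_def r_def b_simps b_commute)
          have y: "y = r + b y v *s u + b y u *s v" by (simp add: r_def)
          have "Y *v r = - b r t *s u"
          proof -
            have "Y *v r + b r t *s u = 0"
            proof (rule hyperbolic_plane_zeroI[OF uv])
              show "b (Y *v r + b r t *s u) u = 0"
                using soD[OF Yso, of r u] Yu uv by (simp add: b_simps)
              show "b (Y *v r + b r t *s u) v = 0"
                using soD[OF Yso, of r v] uv by (simp add: b_simps t_def)
              show "b (Y *v r + b r t *s u) s = 0" if "s \<in> ?T" for s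
                using YT[OF r that] that by (simp add: b_simps perp_def)
            qed
            then show ?thesis by (metis eq_neg_iff_add_eq_0 vec.scale_minus_left)
          qed
          then have "Y *v y = - b r t *s u + b y u *s t"
            by (subst y) (simp add: mv_simps Yu t_def)
          moreover have "wedge u t *v y = b y u *s t - b y t *s u"
            by (simp add: wedge_mv b_commute)
          moreover have "b y t = b r t"
            using tT by (subst y) (simp add: b_simps perp_def)
          ultimately show ?thesis by (simp add: vec.scale_minus_left)
        qed
        then show ?thesis by (simp add: matrix_eq)
      qed
      have "b (A *v u) t = 0" if A: "A \<in> g" for A
      proof -
        have Aso: "A \<in> so b" using A g_so by blast
        have "b (A *v t) u = 0"
          using m_orth[OF Y A] trace_so_wedge[OF Aso, of u t] by (simp add: Y_eq)
        then show ?thesis using soD[OF Aso, of t u] by (simp add: b_commute)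
      qed
      then have "t \<in> J" using tT by (simp add: J_def)
      then have "t = 0" using J0 by blast
      then show "Y = 0" by (simp add: Y_eq wedge_mv matrix_eq)
    qed
    also have "\<dots> \<le> 6" using B(4) dT fB by (simp add: card_insert_if)
    finally show False by (simp add: dim_m)
  qed
  then obtain x0 where x0: "x0 \<in> J" "x0 \<noteq> 0" by blast
  have x0T: "x0 \<in> ?T" using x0(1) by (simp add: J_def)
  obtain q where q: "q \<in> ?T" "b q x0 = 1" using hyperbolic_plane_perp_dual[OF uv x0T x0(2)] by blast
  \<comment> \<open>This vector is \<open>wedge q r\<close> applied to \<open>x0\<close>, so
    \<open>J\<close> contains everything in \<open>T\<close> except possibly the direction
    \<open>q\<close>.\<close>
  have step: "r - b r x0 *s q \<in> J" if "r \<in> ?T" for r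
    using inv[OF q(1) that x0(1)] q(2) by (simp add: wedge_mv)
  have "vec.dim (vec.span {u, v, x0, q}) \<le> card {u, v, x0, q}"
    by (intro vec.dim_le_card) auto
  also have "card {u, v, x0, q} \<le> 4" by (simp add: card_insert_if)
  finally have "vec.dim (vec.span {u, v, x0, q}) \<le> 4" .
  moreover have "vec.dim (vec.span {u, v, x0, q}) + vec.dim (perp {u, v, x0, q}) = 7"
    using dim_perp[OF vec.subspace_span, of "{u, v, x0, q}"] by (simp add: perp_span)
  ultimately have "vec.dim (perp {u, v, x0, q}) \<noteq> 0" by linarith
  then obtain p where p: "p \<in> perp {u, v, x0, q}" "p \<noteq> 0" using ex_nonzero_of_dim by blast
  have pT: "p \<in> ?T" and px: "b p x0 = 0" and pq: "b q p = 0" using p by (auto simp: perp_def b_commute)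
  have pJ: "p \<in> J" using step[OF pT] px by simp
  \<comment> \<open>A second start from \<open>p\<close>, which is in \<open>J\<close> and
    orthogonal to \<open>q\<close>: \<open>wedge r q\<close> sends it to \<open>q\<close>, the
    missing direction.\<close>
  obtain r where r: "r \<in> ?T" "b r p = 1" using hyperbolic_plane_perp_dual[OF uv pT p(2)] by blast
  have qJ: "q \<in> J" using inv[OF r(1) q(1) pJ] r(2) pq by (simp add: wedge_mv)
  have "(x - b x x0 *s q) + b x x0 *s q \<in> J"
    by (rule vec.subspace_add[OF subJ step[OF x] vec.subspace_scale[OF subJ qJ]])
  then show ?thesis using A by (simp add: J_def)
qed

lemma in_hyperbolic_plane:
  assumes uv: "b u u = 0" "b v v = 0" "b u v = 1" and z: "\<And>r. r \<in> perp {u, v} \<Longrightarrow> b x r = 0"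
  shows "x = b x v *s u + b x u *s v"
proof -
  have "x - (b x v *s u + b x u *s v) = 0"
  proof (rule hyperbolic_plane_zeroI[OF uv])
    show "b (x - (b x v *s u + b x u *s v)) r = 0" if "r \<in> perp {u, v}" for r
      using z[OF that] that by (simp add: b_simps perp_def)
  qed (use uv b_commute[of v u] in \<open>simp_all add: b_simps\<close>)
  then show ?thesis by simp
qed

text \<open>A linear pencil of rank two elements in the complement would force \<open>\<ss>\<oo>(T) \<subseteq> \<gg>\<close> for the
  complement \<open>T\<close> of a hyperbolic plane, and the plane would then be invariant.\<close>

lemma not_all_rank2:
  assumes r2: "\<And>X. X \<in> m \<Longrightarrow> trace (X ** X) \<noteq> 0 \<Longrightarrow>
    \<exists>a u v. a \<noteq> 0 \<and> b u u = 0 \<and> b v v = 0 \<and> b u v = 1 \<and> X = mscale a (wedge v u)"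
  shows False
proof -
  obtain X where X: "X \<in> m" "trace (X ** X) \<noteq> 0" using exists_nonisotropic_in_m by blast
  then obtain a u v where a: "a \<noteq> 0" and uv: "b u u = 0" "b v v = 0" "b u v = 1"
    and X_eq: "X = mscale a (wedge v u)" using r2 by meson
  \<comment> \<open>The quadratic relation satisfied by decomposable bivectors, written in matrix
    coefficients.\<close>
  have plucker: "b (Z *v p) q * b (Z *v r) s + b (Z *v q) r * b (Z *v p) s + b (Z *v r) p * b (Z *v q) s = 0"
    if "Z \<in> m" "trace (Z ** Z) \<noteq> 0" for Z p q r s
  proof -
    from that obtain c x y where Z: "Z = mscale c (wedge x y)" using r2 by meson
    show ?thesis
      unfolding Z mscale_mv wedge_mv b_simps by (simp add: b_commute algebra_simps)
  qed
  have vu: "b v u = 1" using uv b_commute by metis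
  have Yrs: "b (Y *v r) s = 0" if Y: "Y \<in> m" and r: "r \<in> perp {u, v}" and s: "s \<in> perp {u, v}" for Y r s
  proof -
    \<comment> \<open>The polynomial t |-> tr((X + tY)^2). Its constant term is nonzero, so
      \<open>r2\<close> applies to X + tY for all but finitely many \<open>t\<close>, and two
      admissible nonzero values exist.\<close>
    let ?q = "[: trace (X ** X), trace (X ** Y) + trace (Y ** X), trace (Y ** Y) :]"
    have tr: "trace ((X + mscale t Y) ** (X + mscale t Y)) = poly ?q t" for t
      by (simp add: mm_simps mscale_mm trace_add trace_mscale algebra_simps)
    have "?q \<noteq> 0" using X(2) by simp
    then have fin: "finite {t. poly ?q t = 0}" by (rule poly_roots_finite)
    obtain t1 where t1: "t1 \<notin> insert 0 {t. poly ?q t = 0}"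
      using ex_new_if_finite[OF infinite_UNIV_char_0 finite.insertI[OF fin]] by blast
    obtain t2 where t2: "t2 \<notin> insert t1 (insert 0 {t. poly ?q t = 0})"
      using ex_new_if_finite[OF infinite_UNIV_char_0 finite.insertI[OF finite.insertI[OF fin]]] by blast
    have rs: "b u r = 0" "b v r = 0" "b u s = 0" "b v s = 0" "b r u = 0" "b r v = 0"
      using r s by (auto simp: perp_def b_commute)
    let ?k = "b (Y *v u) v * b (Y *v r) s + b (Y *v v) r * b (Y *v u) s + b (Y *v r) u * b (Y *v v) s"
    \<comment> \<open>The relation for X + tY at (u, v, r, s) has no constant term, as
      \<open>X\<close> satisfies it. Dividing by \<open>t\<close> leaves an affine expression, and
      two zeros force its constant term to vanish.\<close>
    have eq: "a * b (Y *v r) s + t * ?k = 0" if "t \<noteq> 0" "poly ?q t \<noteq> 0" for t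
    proof -
      have "X + mscale t Y \<in> m" using X(1) Y subspace_m by (simp add: cmat.subspace_add cmat.subspace_scale)
      from plucker[OF this, of u v r s, unfolded tr, OF that(2)]
      have "t * (a * b (Y *v r) s + t * ?k) = 0"
        unfolding mv_simps X_eq wedge_mv by (simp add: b_simps rs uv vu algebra_simps)
      then show ?thesis using that(1) by simp
    qed
    have lin: "c = 0" if "c + t1 * d = 0" "c + t2 * d = 0" for c d :: complex
    proof -
      have "(t1 - t2) * d = (c + t1 * d) - (c + t2 * d)" by (simp add: left_diff_distrib)
      then have "d = 0" using that t2 by auto
      then show ?thesis using that by simp
    qed
    have "a * b (Y *v r) s = 0" using lin[OF eq eq] t1 t2 by blast
    then show ?thesis using a by simp
  qed
  have wg: "wedge r s \<in> g" if "r \<in> perp {u, v}" "s \<in> perp {u, v}" for r s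
  proof (rule in_gI[OF wedge_so])
    fix Y assume Y: "Y \<in> m"
    show "trace (wedge r s ** Y) = 0"
      using trace_wedge_m[OF Y, of r s] Yrs[OF Y that(2,1)] by simp
  qed
  have wg': "wedge r s \<in> g" if "r \<in> perp {v, u}" "s \<in> perp {v, u}" for r s
    using wg that by (simp add: insert_commute)
  have comb: "c *s u + d *s v \<in> vec.span {u, v}" "c *s v + d *s u \<in> vec.span {u, v}" for c d
    by (rule vec.span_add; rule vec.span_scale, rule vec.span_base, simp)+
  have "A *v w \<in> vec.span {u, v}" if A: "A \<in> g" and w: "w \<in> vec.span {u, v}" for A w
  proof -
    have "A *v u \<in> vec.span {u, v}"
      by (subst in_hyperbolic_plane[OF uv hyperbolic_plane_stable[OF uv wg A]])
        (simp_all add: comb)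
    moreover have "A *v v \<in> vec.span {u, v}"
      by (subst in_hyperbolic_plane[OF uv(2,1) vu hyperbolic_plane_stable[OF uv(2,1) vu wg' A]])
        (simp_all add: comb)
    ultimately have "{u, v} \<subseteq> {w. A *v w \<in> vec.span {u, v}}" by simp
    moreover have "vec.subspace {w. A *v w \<in> vec.span {u, v}}"
      by (auto simp: vec.subspace_def mv_simps vec.span_zero vec.span_add vec.span_scale)
    ultimately have "vec.span {u, v} \<subseteq> {w. A *v w \<in> vec.span {u, v}}" by (rule vec.span_minimal)
    then show ?thesis using w by blast
  qed
  then have "vec.span {u, v} = {0} \<or> vec.span {u, v} = UNIV"
    by (intro g_irredD vec.subspace_span)
  moreover have "u \<in> vec.span {u, v}" "u \<noteq> 0" using uv by (auto intro: vec.span_base)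
  moreover have "vec.span {u, v} \<noteq> UNIV"
  proof
    assume "vec.span {u, v} = UNIV"
    then have "vec.dim (UNIV :: (complex^7) set) \<le> card {u, v}"
      by (intro vec.dim_le_card) auto
    also have "\<dots> \<le> 2" by (simp add: card_insert_if)
    finally show False by (simp add: vec_dim_card del: vec.dim_UNIV)
  qed
  ultimately show False by blast
qed

text \<open>The value -1 fits the formula Z^2 w = b(v,w) v - b(v,v) w found later for the element
  \<open>Z\<close> attached to \<open>v\<close>: on the complement of \<open>v\<close> it becomes
  Z^2 = 1.\<close>

definition axis_element :: "complex^7^7 \<Rightarrow> complex^7 \<Rightarrow> bool" where
  "axis_element X e \<longleftrightarrow> X \<in> m \<and> b e e = -1 \<and> X *v e = 0 \<and> (\<forall>w. b w e = 0 \<longrightarrow> X *v (X *v w) = w)"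

lemma ex_axis_element: "\<exists>X e. axis_element X e"
proof (rule ccontr)
  assume none: "\<not> ?thesis"
  have "\<exists>a u v. a \<noteq> 0 \<and> b u u = 0 \<and> b v v = 0 \<and> b u v = 1 \<and> X = mscale a (wedge v u)"
    if X: "X \<in> m" "trace (X ** X) \<noteq> 0" for X
  proof -
    have "X \<noteq> 0" using X by auto
    from large_centralizer_cases[OF bform_axioms m_so[OF X(1)] X(2) dim_centralizer[OF X(1) this]]
    show ?thesis
    proof
      assume "\<exists>a e. a \<noteq> 0 \<and> b e e \<noteq> 0 \<and> X *v e = 0 \<and> (\<forall>w. b w e = 0 \<longrightarrow> X *v (X *v w) = a\<^sup>2 *s w)"
      then obtain a e where a: "a \<noteq> 0" "b e e \<noteq> 0" "X *v e = 0"
        and sq: "\<And>w. b w e = 0 \<Longrightarrow> X *v (X *v w) = a\<^sup>2 *s w" by blast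
      define c where "c = csqrt (- 1 / b e e)"
      have c: "c * c * b e e = -1" "c \<noteq> 0"
        using a(2) by (simp_all add: c_def power2_eq_square[symmetric] flip: power2_eq_square)
      have "axis_element (mscale (1 / a) X) (c *s e)"
        using X(1) subspace_m a c sq
        by (simp add: axis_element_def cmat.subspace_scale mscale_mv mv_scale b_simps power2_eq_square mult.assoc)
      then show ?thesis using none by blast
    qed
  qed
  then show False by (rule not_all_rank2)
qed

end

section \<open>Frames\<close>

text \<open>A Witt basis. That the seven vectors span is expressed by \<open>complete\<close>, since
  equality of vectors is always tested by pairing with the frame.\<close>

locale frame = bform b for b :: "complex^7 \<Rightarrow> complex^7 \<Rightarrow> complex" +
  fixes e :: "complex^7" and x y :: "3 \<Rightarrow> complex^7"
  assumes ee: "b e e = -1" and ex: "b e (x i) = 0" and ey: "b e (y i) = 0"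
    and xx: "b (x i) (x j) = 0" and yy: "b (y i) (y j) = 0"
    and xy: "b (x i) (y j) = (if i = j then 1 else 0)"
    and complete: "b v e = 0 \<Longrightarrow> (\<And>i. b v (x i) = 0) \<Longrightarrow> (\<And>i. b v (y i) = 0) \<Longrightarrow> v = 0"

context g2
begin

lemma axis_element_frame:
  assumes "axis_element X e"
  shows "\<exists>x y. frame b e x y \<and> (\<forall>i. X *v x i = x i \<and> X *v y i = - y i)"
proof -
  have Xm: "X \<in> m" and ee: "b e e = -1" and Xe: "X *v e = 0"
    and sq: "\<And>w. b w e = 0 \<Longrightarrow> X *v (X *v w) = w"
    using assms by (auto simp: axis_element_def)
  have Xso: "X \<in> so b" by (rule m_so[OF Xm])
  have cube: "X *v (X *v (X *v w)) = X *v w" for w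
  proof (rule sq)
    show "b (X *v w) e = 0" using soD[OF Xso, of w e] Xe by simp
  qed
  have geig1: "v \<in> geig X c (Suc 0) \<longleftrightarrow> X *v v = c *s v" for v c
    by (simp add: geig_def pw_Suc)
  \<comment> \<open>\<open>X\<close> is semisimple, so exponent 1 suffices: X^3 = X turns (X - c)^2
    v = 0 with c^2 = 1 into X v = c v.\<close>
  have st: "geig X c 2 = geig X c (Suc 0)" if c: "c * c = 1" for c
  proof
    show "geig X c (Suc 0) \<subseteq> geig X c 2" by (auto simp: geig_def pw_mono)
    show "geig X c 2 \<subseteq> geig X c (Suc 0)"
    proof
      fix v assume "v \<in> geig X c 2"
      then have "X *v (X *v v - c *s v) - c *s (X *v v - c *s v) = 0"
        by (simp add: geig_def numeral_2_eq_2 pw_Suc)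
      then have 2: "X *v (X *v v) = (2 * c) *s (X *v v) - (c * c) *s v"
        by (simp add: mv_simps vec.scale_right_diff_distrib) (simp add: vec_eq_iff algebra_simps)
      have "X *v v = (2 * c) *s (X *v (X *v v)) - X *v v"
        using arg_cong[OF 2, of "(*v) X"] by (simp add: cube mv_simps c)
      then have "X *v v = (2 * c) *s ((2 * c) *s (X *v v) - v) - X *v v"
        by (simp add: 2 c)
      then have "(X *v v) $ i = (2 * c) * ((2 * c) * (X *v v) $ i - v $ i) - (X *v v) $ i" for i
        by (metis vector_smult_component vector_minus_component)
      then have "2 * (X *v v) $ i = 4 * (c * c) * (X *v v) $ i - 2 * (c * v $ i)" for i
        by (simp add: algebra_simps)
      then have "(X *v v) $ i = c * v $ i" for i by (simp add: c)
      then have "X *v v = c *s v" by (simp add: vec_eq_iff)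
      then show "v \<in> geig X c (Suc 0)" by (simp add: geig1)
    qed
  qed
  interpret fitting b X 1 "Suc 0" "geig X 1 (Suc 0)" "geig X (- 1) (Suc 0)" "perp (geig X 1 (Suc 0) \<union> geig X (- 1) (Suc 0))"
    by unfold_locales (use Xso st[of 1] st[of "-1"] in \<open>auto simp: numeral_2_eq_2\<close>)
  let ?E = "geig X 1 (Suc 0)" and ?E' = "geig X (- 1) (Suc 0)"
  let ?T = "perp (?E \<union> ?E')"
  have XE: "X *v v = v" if "v \<in> ?E" for v using that by (simp add: geig1)
  have XE': "X *v v = - v" if "v \<in> ?E'" for v
    using that by (simp add: geig1 vec.scale_minus_left)
  \<comment> \<open>After removing the \<open>e\<close>-component, X^2 s = s. Then s + X s and s - X
    s are eigenvectors for 1 and -1 lying in \<open>T\<close>, so they are orthogonal to the dual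
    eigenspace and vanish.\<close>
  have Te: "t = - b t e *s e" if t: "t \<in> ?T" for t
  proof -
    define s where "s = t + b t e *s e"
    have "b e z = 0" if "z \<in> ?E \<union> ?E'" for z
    proof -
      have "b e (X *v z) = 0" using soD[OF Xso, of e z] Xe by simp
      then show ?thesis using that XE XE' by (auto simp: b_minus_right)
    qed
    then have "e \<in> ?T" by (auto simp: perp_def b_commute)
    then have sT: "s \<in> ?T" unfolding s_def
      by (intro vec.subspace_add[OF sub(3) t] vec.subspace_scale[OF sub(3)])
    have Xs: "X *v (X *v s) = s" by (rule sq) (simp add: s_def b_simps ee)
    have XsT: "X *v s \<in> ?T" by (rule X_invariant(3)[OF sT])
    have "s + X *v s = 0"
    proof (rule E_pairing)
      show "s + X *v s \<in> ?E" by (simp add: geig1 mv_simps Xs add.commute)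
      show "b (s + X *v s) z = 0" if "z \<in> ?E'" for z
        using T_orth[OF vec.subspace_add[OF sub(3) sT XsT]] that by blast
    qed
    moreover have "s - X *v s = 0"
    proof (rule E'_pairing)
      show "s - X *v s \<in> ?E'" by (simp add: geig1 mv_simps Xs vec.scale_minus_left)
      show "b (s - X *v s) z = 0" if "z \<in> ?E" for z
        using T_orth[OF vec.subspace_diff[OF sub(3) sT XsT]] that by blast
    qed
    ultimately have "s = 0" by (simp add: vec_eq_iff)
    then show ?thesis unfolding s_def by (metis eq_neg_iff_add_eq_0 vec.scale_minus_left)
  qed
  have "?T \<subseteq> vec.span {e}"
    using Te vec.span_singleton[of e] by fast
  then have "vec.dim ?T \<le> card {e}" by (intro vec.dim_le_card) auto
  then have p3: "vec.dim ?E = 3" using dim_T by simp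
  obtain B where B: "B \<subseteq> ?E" "vec.independent B" "?E \<subseteq> vec.span B" "card B = vec.dim ?E"
    using vec.basis_exists by blast
  have "finite B" using B(2) by (rule vec.finiteI_independent)
  then obtain x where x: "bij_betw x (UNIV :: 3 set) B"
    using finite_same_card_bij[of "UNIV :: 3 set" B] B(4) p3 by auto
  have xE: "x i \<in> ?E" for i using B(1) x by (auto simp: bij_betw_def)
  \<comment> \<open>The dual basis: a vector with the right products exists somewhere, and its
    component in \<open>E'\<close> has the same products with \<open>E\<close>.\<close>
  have "\<exists>y\<in>?E'. \<forall>j. b (x j) y = (if j = i then 1 else 0)" for i
  proof -
    have Bx: "B - {x i} = x ` (UNIV - {i})" using x by (auto simp: bij_betw_def inj_def)
    have "x i \<notin> vec.span (B - {x i})"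
      using B(2) x by (auto simp: vec.dependent_def bij_betw_def)
    then obtain y where y: "\<And>u. u \<in> vec.span (B - {x i}) \<Longrightarrow> b u y = 0" "b (x i) y = 1"
      using separate[OF vec.subspace_span] by blast
    obtain p q t where pqt: "p \<in> ?E" "q \<in> ?E'" "t \<in> ?T" "y = p + q + t" by (rule decomp)
    have "b (x j) q = b (x j) y" for j
      using E_isotropic[OF xE pqt(1)] T_orth[OF pqt(3), of "x j"] xE
      by (simp add: pqt(4) b_simps b_commute)
    moreover have "b (x j) y = (if j = i then 1 else 0)" for j
      using y(1)[OF vec.span_base, of "x j"] y(2) Bx by auto
    ultimately show ?thesis by (intro bexI[OF _ pqt(2)]) simp
  qed
  then obtain y where yE: "\<And>i. y i \<in> ?E'" and xy: "\<And>i j. b (x j) (y i) = (if j = i then 1 else 0)"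
    by metis
  have eT: "b e v = 0" if "v \<in> ?E \<union> ?E'" for v
  proof -
    have "b e (X *v v) = 0" using soD[OF Xso, of e v] Xe by simp
    then show ?thesis using that XE XE' by (auto simp: b_minus_right)
  qed
  have "frame b e x y"
  proof unfold_locales
    show "b e e = -1" by (rule ee)
    show "b e (x i) = 0" "b e (y i) = 0" for i using eT xE yE by blast+
    show "b (x i) (x j) = 0" for i j by (rule E_isotropic[OF xE xE])
    show "b (y i) (y j) = 0" for i j by (rule E'_isotropic[OF yE yE])
    show "b (x i) (y j) = (if i = j then 1 else 0)" for i j by (rule xy)
    fix v assume ve: "b v e = 0" and vx: "\<And>i. b v (x i) = 0" and vy: "\<And>i. b v (y i) = 0"
    obtain p q t where v: "p \<in> ?E" "q \<in> ?E'" "t \<in> ?T" "v = p + q + t" by (rule decomp)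
    have "b e p = 0" "b e q = 0" using eT v by blast+
    then have "b t e = 0" using ve v(4) by (simp add: b_simps b_commute)
    then have "t = 0" using Te[OF v(3)] by simp
    have "q = 0"
    proof (rule E'_pairing[OF v(2)])
      fix z assume z: "z \<in> ?E"
      have "b v u = 0" if "u \<in> B" for u using vx that x by (auto simp: bij_betw_def)
      then have "b v z = 0" using orth_span[of B v z] B(3) z by blast
      then show "b q z = 0" using E_isotropic[OF v(1) z] \<open>t = 0\<close> by (simp add: v(4) b_simps)
    qed
    have "vec.subspace {p. p = (\<Sum>i\<in>UNIV. b p (y i) *s x i)}"
    proof (rule vec.subspaceI; clarify)
      show "0 = (\<Sum>i\<in>UNIV. b 0 (y i) *s x i)" by simp
    next
      fix p q assume "p = (\<Sum>i\<in>UNIV. b p (y i) *s x i)" "q = (\<Sum>i\<in>UNIV. b q (y i) *s x i)"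
      moreover have "(\<Sum>i\<in>UNIV. b (p + q) (y i) *s x i) = (\<Sum>i\<in>UNIV. b p (y i) *s x i) + (\<Sum>i\<in>UNIV. b q (y i) *s x i)"
        by (simp add: b_simps vec.scale_left_distrib sum.distrib)
      ultimately show "p + q = (\<Sum>i\<in>UNIV. b (p + q) (y i) *s x i)" by simp
    next
      fix c p assume "p = (\<Sum>i\<in>UNIV. b p (y i) *s x i)"
      moreover have "(\<Sum>i\<in>UNIV. b (c *s p) (y i) *s x i) = c *s (\<Sum>i\<in>UNIV. b p (y i) *s x i)"
        by (simp add: b_simps vec.scale_sum_right)
      ultimately show "c *s p = (\<Sum>i\<in>UNIV. b (c *s p) (y i) *s x i)" by simp
    qed
    moreover have "B \<subseteq> {p. p = (\<Sum>i\<in>UNIV. b p (y i) *s x i)}"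
    proof
      fix u assume "u \<in> B"
      then obtain j where j: "u = x j" using x by (auto simp: bij_betw_def)
      have "(\<Sum>i\<in>UNIV. b (x j) (y i) *s x i) = (\<Sum>i\<in>UNIV. if i = j then x i else 0)"
        by (intro sum.cong) (auto simp: xy)
      then show "u \<in> {p. p = (\<Sum>i\<in>UNIV. b p (y i) *s x i)}" by (simp add: j)
    qed
    ultimately have "p = (\<Sum>i\<in>UNIV. b p (y i) *s x i)"
      using vec.span_minimal[of B] B(3) v(1) by blast
    moreover have "b p (y i) = 0" for i
      using vy[of i] \<open>t = 0\<close> \<open>q = 0\<close> by (simp add: v(4))
    ultimately have "p = 0" by simp
    then show "v = 0" using \<open>t = 0\<close> \<open>q = 0\<close> by (simp add: v(4))
  qed
  then show ?thesis using XE[OF xE] XE'[OF yE] by blast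
qed

end

section \<open>Vector algebra in C^3 and coordinates of so(7) in a frame\<close>

definition dot :: "complex^3 \<Rightarrow> complex^3 \<Rightarrow> complex" where
  "dot p q = p $ 1 * q $ 1 + p $ 2 * q $ 2 + p $ 3 * q $ 3"

text \<open>The cross product, which realizes the identification of the second exterior power of C^3
  with its dual.\<close>

definition cr :: "complex^3 \<Rightarrow> complex^3 \<Rightarrow> complex^3" where
  "cr p q = vector [p $ 2 * q $ 3 - p $ 3 * q $ 2, p $ 3 * q $ 1 - p $ 1 * q $ 3, p $ 1 * q $ 2 - p $ 2 * q $ 1]"

lemma cr_nth [simp]: "cr p q $ 1 = p $ 2 * q $ 3 - p $ 3 * q $ 2"
  "cr p q $ 2 = p $ 3 * q $ 1 - p $ 1 * q $ 3" "cr p q $ 3 = p $ 1 * q $ 2 - p $ 2 * q $ 1"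
  by (simp_all add: cr_def)

lemma vec3_eq_iff: "(p :: complex^3) = q \<longleftrightarrow> p $ 1 = q $ 1 \<and> p $ 2 = q $ 2 \<and> p $ 3 = q $ 3"
  by (simp add: vec_eq_iff forall_3)

lemma mv3_nth: "((M :: complex^3^3) *v p) $ i = M $ i $ 1 * p $ 1 + M $ i $ 2 * p $ 2 + M $ i $ 3 * p $ 3"
  by (simp add: matrix_vector_mult_def sum_3)

lemma vm3_nth: "(p v* (M :: complex^3^3)) $ i = M $ 1 $ i * p $ 1 + M $ 2 $ i * p $ 2 + M $ 3 $ i * p $ 3"
  by (simp add: vector_matrix_mult_def sum_3 mult.commute)

lemma mm3_nth: "((M :: complex^3^3) ** N) $ i $ j = M $ i $ 1 * N $ 1 $ j + M $ i $ 2 * N $ 2 $ j + M $ i $ 3 * N $ 3 $ j"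
  by (simp add: matrix_matrix_mult_def sum_3)

lemma lie_bracket3_nth: "lie_bracket (M :: complex^3^3) N $ i $ j = (M ** N) $ i $ j - (N ** M) $ i $ j"
  by (simp add: lie_bracket_def)

lemma trace3: "trace (M :: complex^3^3) = M $ 1 $ 1 + M $ 2 $ 2 + M $ 3 $ 3"
  by (simp add: trace_def sum_3)

lemma transpose_nth [simp]: "transpose M $ i $ j = M $ j $ i"
  by (simp add: transpose_def)

lemmas coord3 = vec3_eq_iff mv3_nth vm3_nth mm3_nth trace3 dot_def

context frame
begin

lemma frame_products: "b (x i) e = 0" "b (y i) e = 0" "b (y i) (x j) = (if i = j then 1 else 0)"
  using ex ey xy b_commute by auto

definition F :: "complex \<Rightarrow> complex^3 \<Rightarrow> complex^3 \<Rightarrow> complex^7" where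
  "F t p q = t *s e + (\<Sum>i\<in>UNIV. p $ i *s x i) + (\<Sum>i\<in>UNIV. q $ i *s y i)"

lemma b_F: "b (F t p q) e = - t" "b (F t p q) (x i) = q $ i" "b (F t p q) (y i) = p $ i"
proof -
  have d: "(\<Sum>j\<in>UNIV. r $ j * (if j = i then 1 else 0)) = r $ i" for r :: "complex^3"
    by (simp add: if_distrib cong: if_cong)
  show "b (F t p q) e = - t" "b (F t p q) (x i) = q $ i" "b (F t p q) (y i) = p $ i"
    by (simp_all add: F_def b_simps b_sum_left frame_products ee ex ey xx yy xy d)
qed

lemma b_F_F: "b (F t p q) (F t' p' q') = - t * t' + dot p q' + dot q p'"
proof -
  have "b (F t p q) (F t' p' q') = t' * b (F t p q) e + (\<Sum>i\<in>UNIV. p' $ i * b (F t p q) (x i)) +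
     (\<Sum>i\<in>UNIV. q' $ i * b (F t p q) (y i))"
    unfolding F_def[of t'] by (simp only: b_add_right b_scale_right b_sum_right)
  then show ?thesis by (simp add: b_F dot_def sum_3 mult.commute)
qed

lemma eqI:
  assumes "b v e = b w e" "\<And>i. b v (x i) = b w (x i)" "\<And>i. b v (y i) = b w (y i)"
  shows "v = w"
  using complete[of "v - w"] assms by (simp add: b_simps)

lemma F_coords: "v = F (- b v e) (\<chi> i. b v (y i)) (\<chi> i. b v (x i))"
  by (rule eqI) (simp_all add: b_F)

lemma F_cases: obtains t p q where "v = F t p q"
  using F_coords by blast

lemma F_inject [simp]: "F t p q = F t' p' q' \<longleftrightarrow> t = t' \<and> p = p' \<and> q = q'"
  by (metis b_F(1) b_F(2) b_F(3) neg_equal_iff_equal vec_eq_iff)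

lemma F_add: "F t p q + F t' p' q' = F (t + t') (p + p') (q + q')"
  and F_scale: "c *s F t p q = F (c * t) (c *s p) (c *s q)"
  and F_diff: "F t p q - F t' p' q' = F (t - t') (p - p') (q - q')"
  by (rule eqI; simp add: b_F b_simps)+

lemma F_zero [simp]: "F 0 0 0 = 0"
  by (simp add: F_def)

lemma F_eq_0 [simp]: "F t p q = 0 \<longleftrightarrow> t = 0 \<and> p = 0 \<and> q = 0"
  using F_inject[of t p q 0 0 0] by simp

lemma e_F: "e = F 1 0 0" and x_F: "x i = F 0 (axis i 1) 0" and y_F: "y i = F 0 0 (axis i 1)"
  by (rule eqI; simp add: b_F ee ex ey xx yy xy frame_products axis_def)+

lemma matrix_F_eqI:
  assumes "\<And>t p q. A *v F t p q = B *v F t p q" shows "A = B"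
  by (metis assms F_cases matrix_eq)

text \<open>The basis dual to \<open>e\<close>, \<open>x i\<close>, \<open>y i\<close> for
  \<open>b\<close> is - \<open>e\<close>, \<open>y i\<close>, \<open>x i\<close>; this explains the
  sign and the exchange of \<open>x\<close> and \<open>y\<close>.\<close>

lemma trace_frame:
  "trace A = - b (A *v e) e + (\<Sum>i\<in>UNIV. b (A *v x i) (y i) + b (A *v y i) (x i))"
proof -
  let ?o = "\<lambda>z w. matrix (\<lambda>v. b z v *s w)"
  have o: "?o z w *v v = b z v *s w" for z w v
    by (rule matrix_works) (simp add: Vector_Spaces.linear_iff vec.vector_space_axioms b_simps vec.scale_left_distrib)
  have tr_o: "trace (A ** ?o z w) = b (A *v w) z" for z w
  proof -
    have "(A ** ?o z w) $ i $ i = (A *v w) $ i * b z (axis i 1)" for i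
    proof -
      have "(A ** ?o z w) $ i $ i = ((A ** ?o z w) *v axis i 1) $ i"
        by (simp add: mv_axis column_def)
      then show ?thesis by (simp flip: matrix_vector_mul_assoc add: o mv_simps)
    qed
    then show ?thesis by (simp add: trace_def b_axis_sum[of z "A *v w", symmetric] b_commute)
  qed
  have "mat 1 = mscale (-1) (?o e e) + (\<Sum>i\<in>UNIV. ?o (y i) (x i) + ?o (x i) (y i))"
  proof (rule matrix_F_eqI)
    fix t p q
    show "mat 1 *v F t p q = (mscale (-1) (?o e e) + (\<Sum>i\<in>UNIV. ?o (y i) (x i) + ?o (x i) (y i))) *v F t p q"
      unfolding sum_3 mv_simps o b_commute[of _ "F t p q"] b_F
      by (simp add: F_def sum_3 vec_eq_iff)
  qed
  then have "A = A ** (mscale (-1) (?o e e) + (\<Sum>i\<in>UNIV. ?o (y i) (x i) + ?o (x i) (y i)))"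
    by (metis matrix_mul_rid)
  also have "trace \<dots> = - b (A *v e) e + (\<Sum>i\<in>UNIV. b (A *v x i) (y i) + b (A *v y i) (x i))"
    by (simp add: sum_3 mm_simps mscale_mm trace_add trace_sub trace_mscale tr_o)
  finally show ?thesis .
qed

lemma trace_frame_F:
  "trace A = - b (A *v F 1 0 0) (F 1 0 0) +
    (\<Sum>i\<in>UNIV. b (A *v F 0 (axis i 1) 0) (F 0 0 (axis i 1)) + b (A *v F 0 0 (axis i 1)) (F 0 (axis i 1) 0))"
  unfolding e_F[symmetric] x_F[symmetric] y_F[symmetric] by (rule trace_frame)

text \<open>The matrices \<open>Om M a a' c c'\<close> are the elements of \<open>\<ss>\<oo>(7)\<close> in the frame; \<open>M \<in> \<gg>\<ll>(3)\<close> acts on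
  \<open>a\<close>, \<open>c\<close> by the standard representation and on \<open>a'\<close>, \<open>c'\<close> by its dual, up to multiples of the trace.\<close>

definition Om :: "complex^3^3 \<Rightarrow> complex^3 \<Rightarrow> complex^3 \<Rightarrow> complex^3 \<Rightarrow> complex^3 \<Rightarrow> complex^7^7" where
  "Om M a a' c c' = matrix (\<lambda>v. let t = - b v e; p = (\<chi> i. b v (y i)); q = (\<chi> i. b v (x i)) in
     F (dot a' p + dot a q) (M *v p + t *s a + cr c' q) (- (transpose M *v q) + t *s a' + cr c p))"

lemma Om_F:
  "Om M a a' c c' *v F t p q =
     F (dot a' p + dot a q) (M *v p + t *s a + cr c' q) (- (transpose M *v q) + t *s a' + cr c p)"
proof -
  have "Om M a a' c c' *v v = (let t = - b v e; p = (\<chi> i. b v (y i)); q = (\<chi> i. b v (x i)) in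
     F (dot a' p + dot a q) (M *v p + t *s a + cr c' q) (- (transpose M *v q) + t *s a' + cr c p))" for v
    unfolding Om_def
    by (rule matrix_works)
      (simp add: Vector_Spaces.linear_iff vec.vector_space_axioms Let_def F_add F_scale b_simps coord3 algebra_simps)
  from this[of "F t p q"] show ?thesis by (simp add: b_F)
qed

lemma Om_inject [simp]:
  "Om M a a' c c' = Om N u u' w w' \<longleftrightarrow> M = N \<and> a = u \<and> a' = u' \<and> c = w \<and> c' = w'"
proof
  assume eq: "Om M a a' c c' = Om N u u' w w'"
  have eqF: "F (dot a' p + dot a q) (M *v p + t *s a + cr c' q) (- (transpose M *v q) + t *s a' + cr c p) =
    F (dot u' p + dot u q) (N *v p + t *s u + cr w' q) (- (transpose N *v q) + t *s u' + cr w p)" for t p q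
    using Om_F[of M a a' c c' t p q] Om_F[of N u u' w w' t p q] eq by simp
  have Fi: "M *v p + t *s a + cr c' q = N *v p + t *s u + cr w' q"
    "- (transpose M *v q) + t *s a' + cr c p = - (transpose N *v q) + t *s u' + cr w p" for t p q
    using eqF[of p q t] unfolding F_inject by blast+
  have "M *v p = N *v p" for p using Fi(1)[of p 0 0] by (simp add: vec3_eq_iff)
  then have "M = N" by (simp add: matrix_eq)
  moreover have "a = u" "a' = u'" using Fi(1)[of 0 1 0] Fi(2)[of 0 1 0] by (simp_all add: vec3_eq_iff mv3_nth vm3_nth)
  moreover have "c' = w'" using Fi(1)[of 0 0 "axis 1 1"] Fi(1)[of 0 0 "axis 2 1"]
    by (simp add: vec3_eq_iff mv3_nth vm3_nth axis_def)
  moreover have "c = w" using Fi(2)[of 0 0 "axis 1 1"] Fi(2)[of 0 0 "axis 2 1"]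
    by (simp add: vec3_eq_iff mv3_nth vm3_nth axis_def)
  ultimately show "M = N \<and> a = u \<and> a' = u' \<and> c = w \<and> c' = w'" by blast
qed simp

lemma Om_add: "Om M a a' c c' + Om N u u' w w' = Om (M + N) (a + u) (a' + u') (c + w) (c' + w')"
  by (rule matrix_F_eqI) (simp add: mv_simps Om_F F_add coord3 algebra_simps)

lemma Om_scale: "mscale k (Om M a a' c c') = Om (mscale k M) (k *s a) (k *s a') (k *s c) (k *s c')"
  by (rule matrix_F_eqI) (simp add: mv_simps Om_F F_scale coord3 algebra_simps)

lemma Om_diff: "Om M a a' c c' - Om N u u' w w' = Om (M - N) (a - u) (a' - u') (c - w) (c' - w')"
  by (rule matrix_F_eqI) (simp add: mv_simps Om_F F_diff coord3 algebra_simps)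

lemma Om_so: "Om M a a' c c' \<in> so b"
proof (rule soI)
  fix v w
  obtain t p q t' p' q' where "v = F t p q" "w = F t' p' q'" by (metis F_cases)
  then show "b (Om M a a' c c' *v v) w = - b v (Om M a a' c c' *v w)"
    by (simp add: Om_F b_F_F coord3 algebra_simps)
qed

lemma so_Om:
  assumes A: "A \<in> so b"
  obtains M a a' c c' where "A = Om M a a' c c'"
proof -
  define M :: "complex^3^3" where "M = (\<chi> i j. b (A *v x j) (y i))"
  define a :: "complex^3" where "a = (\<chi> i. b (A *v e) (y i))"
  define a' :: "complex^3" where "a' = (\<chi> i. b (A *v e) (x i))"
  \<comment> \<open>A skew 3 by 3 block acts as the cross product with a vector; the index pairs 23,
    31, 12 are its components.\<close>
  define c :: "complex^3" where "c = vector [b (A *v x 2) (x 3), b (A *v x 3) (x 1), b (A *v x 1) (x 2)]"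
  define c' :: "complex^3" where "c' = vector [b (A *v y 2) (y 3), b (A *v y 3) (y 1), b (A *v y 1) (y 2)]"
  have swap: "b (A *v v) w = - b (A *v w) v" for v w
    using soD[OF A, of v w] b_commute[of v "A *v w"] by simp
  have AF: "A *v F t p q = t *s (A *v e) + (\<Sum>i\<in>UNIV. p $ i *s (A *v x i)) + (\<Sum>i\<in>UNIV. q $ i *s (A *v y i))" for t p q
    unfolding F_def sum_3 by (simp add: mv_simps)
  have "A = Om M a a' c c'"
  proof (rule matrix_F_eqI)
    fix t p q
    show "A *v F t p q = Om M a a' c c' *v F t p q"
    proof (rule eqI)
      show "b (A *v F t p q) e = b (Om M a a' c c' *v F t p q) e"
        unfolding AF Om_F b_F sum_3 b_simps swap[of "x _" e] swap[of "y _" e] so_self[OF A]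
        by (simp add: dot_def a_def a'_def algebra_simps)
      have "b (A *v F t p q) (x i) = b (Om M a a' c c' *v F t p q) (x i)" if "i = 1 \<or> i = 2 \<or> i = 3" for i
        using that unfolding AF Om_F b_F sum_3 b_simps swap[of "y _" "x _"]
        by (elim disjE; simp add: mv3_nth vm3_nth M_def a'_def c_def so_self[OF A] swap[of "x 2" "x 1"] swap[of "x 3" "x 2"] swap[of "x 1" "x 3"] algebra_simps)
      then show "b (A *v F t p q) (x i) = b (Om M a a' c c' *v F t p q) (x i)" for i
        using exhaust_3 by blast
      have "b (A *v F t p q) (y i) = b (Om M a a' c c' *v F t p q) (y i)" if "i = 1 \<or> i = 2 \<or> i = 3" for i
        using that unfolding AF Om_F b_F sum_3 b_simps
        by (elim disjE; simp add: mv3_nth vm3_nth M_def a_def c'_def so_self[OF A] swap[of "y 2" "y 1"] swap[of "y 3" "y 2"] swap[of "y 1" "y 3"] algebra_simps)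
      then show "b (A *v F t p q) (y i) = b (Om M a a' c c' *v F t p q) (y i)" for i
        using exhaust_3 by blast
    qed
  qed
  then show thesis by (rule that)
qed

lemma trace_Om_Om:
  "trace (Om M a a' c c' ** Om N u u' w w') =
     2 * trace (M ** N) + 2 * (dot a u' + dot a' u - dot c w' - dot c' w)"
  unfolding trace_frame_F sum_3 matrix_vector_mul_assoc[symmetric] Om_F b_F_F
  by (simp add: coord3 axis_def algebra_simps)

text \<open>The outer product terms below come from the triple product identity for \<open>cr\<close>.\<close>

lemma bracket_Om:
  "lie_bracket (Om 0 a a' c c') (Om 0 u u' w w') =
     Om (\<chi> i j. a $ i * u' $ j - u $ i * a' $ j + w $ i * c' $ j - c $ i * w' $ j
            + (if i = j then dot w' c - dot c' w else 0))
       (cr c' u' - cr w' a') (cr c u - cr w a) (cr u' a') (cr u a)"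
  by (rule matrix_F_eqI) (simp add: lie_bracket_mv Om_F F_diff coord3 algebra_simps)

text \<open>For general \<open>N\<close> the components \<open>c\<close> and \<open>c'\<close> would
  be twisted by multiples of tr N, because the cross product respects gl(3) only up to the
  determinant.\<close>

lemma bracket_Om_trace_free:
  assumes "trace N = 0"
  shows "lie_bracket (Om N 0 0 0 0) (Om M a a' c c') =
     Om (lie_bracket N M) (N *v a) (- (transpose N *v a')) (N *v c) (- (transpose N *v c'))"
proof -
  have N: "N $ 3 $ 3 = - N $ 1 $ 1 - N $ 2 $ 2" using assms by (simp add: trace3 algebra_simps) (metis add.commute add.assoc add_eq_0_iff diff_conv_add_uminus minus_add_distrib)
  show ?thesis
    by (rule matrix_F_eqI)
      (simp add: lie_bracket_mv lie_bracket3_nth Om_F F_diff coord3 N algebra_simps)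
qed

end

section \<open>The structure of \<open>\<gg>\<^sub>2\<close> in a frame\<close>

lemma matrix_unit_mv: "matrix_unit i j *v (p :: complex^'n) = p $ j *s axis i 1"
  by (simp add: vec_eq_iff matrix_vector_mult_def matrix_unit_nth axis_def if_distrib if_distribR
      cong: if_cong)

lemma transpose_matrix_unit: "transpose (matrix_unit i j) = matrix_unit j i"
  by (auto simp: vec_eq_iff matrix_unit_nth)

lemma trace_matrix_unit: "trace (matrix_unit i j :: complex^'n^'n) = (if i = j then 1 else 0)"
proof (cases "i = j")
  case True
  then show ?thesis by (simp add: trace_def matrix_unit_nth)
next
  case False
  then have "\<not> (k = i \<and> k = j)" for k by blast
  then have "matrix_unit i j $ k $ k = (0 :: complex)" for k by (simp only: matrix_unit_nth if_False)
  then show ?thesis using False by (simp add: trace_def)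
qed

lemma ex_third: "\<exists>k::3. k \<noteq> i \<and> k \<noteq> j"
proof -
  have "card {i, j} < CARD(3)" by (simp add: card_insert_if)
  then have "{i, j} \<noteq> UNIV" by (metis less_irrefl)
  then show ?thesis by blast
qed

lemma vec3_axis: "(p :: complex^3) = p $ 1 *s axis 1 1 + p $ 2 *s axis 2 1 + p $ 3 *s axis 3 1"
  by (simp add: vec3_eq_iff axis_def)

lemma cr_zero [simp]: "cr 0 p = 0" "cr p 0 = 0"
  by (simp_all add: vec3_eq_iff)

lemma cr_scale: "cr (k *s p) q = k *s cr p q" "cr p (k *s q) = k *s cr p q"
  by (simp_all add: vec3_eq_iff algebra_simps)

lemma dot_zero [simp]: "dot 0 p = 0" "dot p 0 = 0"
  by (simp_all add: dot_def)

lemma dot_scale: "dot (k *s p) q = k * dot p q" "dot p (k *s q) = k * dot p q"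
  by (simp_all add: dot_def algebra_simps)

lemma dot_add: "dot (p + p') q = dot p q + dot p' q"
  by (simp add: dot_def algebra_simps)

lemma dot_commute: "dot p q = dot q p"
  by (simp add: dot_def mult.commute)

lemma dot_eq_0D: "(\<And>q. dot p q = 0) \<Longrightarrow> p = 0"
proof -
  assume z: "\<And>q. dot p q = 0"
  show "p = 0" using z[of "axis 1 1"] z[of "axis 2 1"] z[of "axis 3 1"] by (simp add: vec3_eq_iff dot_def axis_def)
qed

locale g2_frame = g2 b g + frame b e x y for b g e x y +
  fixes X
  assumes X: "axis_element X e" and Xx: "X *v x i = x i" and Xy: "X *v y i = - y i"
begin

lemma Xm: "X \<in> m" and Xe: "X *v e = 0"
  using X by (auto simp: axis_element_def)

lemma X_Om: "X = Om (mat 1) 0 0 0 0"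
proof (rule matrix_F_eqI)
  fix t p q
  have "X *v F t p q = F 0 p (- q)"
    unfolding F_def sum_3 by (simp add: mv_simps Xe Xx Xy vec.scale_minus_left)
  then show "X *v F t p q = Om (mat 1) 0 0 0 0 *v F t p q"
    by (simp add: Om_F transpose_mat del: transpose_matrix_vector)
qed

lemma bracket_X: "lie_bracket (Om M a a' c c') X = Om 0 (- a) a' (2 *s c) (- (2 *s c'))"
  unfolding X_Om
  by (rule matrix_F_eqI)
    (simp add: lie_bracket_mv Om_F F_diff transpose_mat del: transpose_matrix_vector, simp add: coord3 algebra_simps)

lemma trace_X: "trace (Om M a a' c c' ** X) = 2 * trace M"
  unfolding X_Om trace_Om_Om by simp

lemma g_trace_free: "Om M a a' c c' \<in> g \<Longrightarrow> trace M = 0"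
  using m_orth[OF Xm] trace_X by fastforce

text \<open>Bracketing with \<open>X\<close> multiplies \<open>a\<close>, \<open>a'\<close>,
  \<open>c\<close>, \<open>c'\<close> by the nonzero weights -1, 1, 2, -2 and kills the gl(3)
  block.\<close>

lemma centralizer_Om: "A \<in> centralizer X \<longleftrightarrow> (\<exists>M. A = Om M 0 0 0 0)"
proof
  assume "A \<in> centralizer X"
  then have A: "A \<in> so b" "lie_bracket A X = 0" by (auto simp: centralizer_def)
  obtain M a a' c c' where Om: "A = Om M a a' c c'" using so_Om[OF A(1)] .
  have "Om 0 (- a) a' (2 *s c) (- (2 *s c')) = Om 0 0 0 0 0"
    using A(2) bracket_X Om Om_scale[of 0 0 0 0 0 0] by simp
  then show "\<exists>M. A = Om M 0 0 0 0" by (auto simp: Om)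
next
  assume "\<exists>M. A = Om M 0 0 0 0"
  then obtain M where "A = Om M 0 0 0 0" ..
  then show "A \<in> centralizer X"
    using Om_scale[of 0 0 0 0 0 0] by (simp add: centralizer_def Om_so bracket_X)
qed

lemma Om_zero: "Om 0 0 0 0 0 = 0"
  using Om_scale[of 0 0 0 0 0 0] by simp

lemma dim_centralizer_X: "cmat.dim (centralizer X) \<le> 9"
proof -
  have "cmat.dim (centralizer X) \<le> card (UNIV :: (3 \<times> 3) set)"
  proof (rule common_zero_imp_dim_le[OF cmat_finite_dimensional subspace_centralizer, where f = "\<lambda>(i,j) A. b (A *v x j) (y i)"])
    fix A assume "A \<in> centralizer X" and z: "\<And>p. p \<in> UNIV \<Longrightarrow> (\<lambda>(i,j) A. b (A *v x j) (y i)) p A = 0"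
    then obtain M where A: "A = Om M 0 0 0 0" by (auto simp: centralizer_Om)
    have "M $ i $ j = 0" for i j
      using z[of "(i,j)"] unfolding prod.case x_F A Om_F b_F by (simp add: mv_axis column_def)
    then have "M = 0" by (simp add: vec_eq_iff)
    then show "A = 0" by (simp add: A Om_zero)
  qed (auto simp: b_matrix_functional)
  then show ?thesis by simp
qed

text \<open>The part of the centralizer inside \<open>g\<close> has dimension at least 8, and
  \<open>X\<close> adds a ninth direction, so together they fill gl(3). Hence \<open>M\<close> lies
  in \<open>g\<close> up to a multiple of \<open>X\<close>, and that multiple is 0 because both the
  trace of \<open>M\<close> and the pairing of \<open>g\<close> with \<open>X\<close>
  vanish.\<close>

lemma trace_free_in_g:
  assumes "trace M = 0" shows "Om M 0 0 0 0 \<in> g"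
proof -
  let ?C = "g \<inter> centralizer X"
  have sub: "cmat.subspace ?C" by (intro cmat.subspace_inter subspace_g subspace_centralizer)
  have trX: "trace (X ** X) = 6"
    using trace_X[of "mat 1" 0 0 0 0] by (simp add: X_Om[symmetric] trace_I)
  then have "X \<noteq> 0" by auto
  then have "X \<notin> g" using Xm g_inter_m by auto
  then have "X \<notin> cmat.span ?C" using sub by (metis IntD1 cmat.span_eq_iff)
  then have "cmat.dim (cmat.span (insert X ?C)) = cmat.dim ?C + 1"
    by (simp add: cmatf.dim_insert)
  then have dim: "9 \<le> cmat.dim (cmat.span (insert X ?C))"
    using dim_centralizer_g[OF Xm \<open>X \<noteq> 0\<close>] by simp
  have "cmat.span (insert X ?C) \<subseteq> centralizer X"
    using self_centralizer[OF m_so[OF Xm]] by (intro cmat.span_minimal subspace_centralizer) auto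
  then have "cmat.span (insert X ?C) = centralizer X"
    using dim dim_centralizer_X
    by (intro cmatf.subspace_dim_equal cmat.subspace_span subspace_centralizer) auto
  then have "Om M 0 0 0 0 \<in> cmat.span (insert X ?C)" by (auto simp: centralizer_Om)
  then obtain k where "Om M 0 0 0 0 - mscale k X \<in> cmat.span ?C"
    by (auto simp: cmat.span_insert)
  then have A: "Om M 0 0 0 0 - mscale k X \<in> g" using sub by (metis IntD1 cmat.span_eq_iff)
  have "trace ((Om M 0 0 0 0 - mscale k X) ** X) = 0" using m_orth[OF Xm A] .
  then have "k = 0" by (simp add: mm_simps mscale_mm trace_sub trace_mscale trace_X assms trX)
  then show ?thesis using A by simp
qed

text \<open>As all of sl(3) lies in \<open>g\<close>, what remains unknown is an sl(3)-submodule of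
  two copies of C^3 (slots \<open>a\<close>, \<open>c\<close>) and two of its dual (slots
  \<open>a'\<close>, \<open>c'\<close>).\<close>

definition D :: "complex^3 \<Rightarrow> complex^3 \<Rightarrow> complex^3 \<Rightarrow> complex^3 \<Rightarrow> bool" where
  "D a a' c c' \<longleftrightarrow> Om 0 a a' c c' \<in> g"

lemma D_of_g: "Om M a a' c c' \<in> g \<Longrightarrow> D a a' c c'"
  using cmat.subspace_diff[OF subspace_g _ trace_free_in_g[OF g_trace_free], of "Om M a a' c c'" M a a' c c']
  by (simp add: D_def Om_diff)

lemma g_of_D: "trace M = 0 \<Longrightarrow> D a a' c c' \<Longrightarrow> Om M a a' c c' \<in> g"
  using cmat.subspace_add[OF subspace_g trace_free_in_g, of M "Om 0 a a' c c'"]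
  by (simp add: D_def Om_add)

lemma D_add: "D a a' c c' \<Longrightarrow> D u u' w w' \<Longrightarrow> D (a + u) (a' + u') (c + w) (c' + w')"
  using cmat.subspace_add[OF subspace_g, of "Om 0 a a' c c'" "Om 0 u u' w w'"] by (simp add: D_def Om_add)

lemma D_scale: "D a a' c c' \<Longrightarrow> D (k *s a) (k *s a') (k *s c) (k *s c')"
  using cmat.subspace_scale[OF subspace_g, of "Om 0 a a' c c'" k] by (simp add: D_def Om_scale)

lemma D_unit:
  assumes "D a a' c c'" "i \<noteq> j"
  shows "D (a $ j *s axis i 1) (- (a' $ i *s axis j 1)) (c $ j *s axis i 1) (- (c' $ i *s axis j 1))"
proof -
  have tr: "trace (matrix_unit i j :: complex^3^3) = 0" using assms(2) by (simp add: trace_matrix_unit)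
  from g_bracket[OF trace_free_in_g[OF this] assms(1)[unfolded D_def]]
  show ?thesis
    unfolding bracket_Om_trace_free[OF tr] transpose_matrix_unit matrix_unit_mv by (rule D_of_g)
qed

text \<open>Irreducible submodules of an isotypic component are graphs of scalars: \<open>P\<close>
  names a diagonal copy of C^3 inside the slots \<open>a\<close>, \<open>c\<close>, and
  \<open>R\<close> a copy of the dual inside \<open>a'\<close>, \<open>c'\<close>.\<close>

definition P :: "complex \<Rightarrow> complex \<Rightarrow> bool" where
  "P \<alpha> \<gamma> \<longleftrightarrow> (\<forall>v. D (\<alpha> *s v) 0 (\<gamma> *s v) 0)"

definition R :: "complex \<Rightarrow> complex \<Rightarrow> bool" where
  "R \<beta> \<delta> \<longleftrightarrow> (\<forall>v. D 0 (\<beta> *s v) 0 (\<delta> *s v))"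

lemma P_I:
  assumes "\<And>k. D (\<alpha> *s axis k 1) 0 (\<gamma> *s axis k 1) 0" shows "P \<alpha> \<gamma>"
  unfolding P_def
proof
  fix v
  have "D (v $ k *s (\<alpha> *s axis k 1)) 0 (v $ k *s (\<gamma> *s axis k 1)) 0" for k
    using D_scale[OF assms[of k], where k = "v $ k"] by simp
  from D_add[OF D_add[OF this[of 1] this[of 2]] this[of 3]]
  show "D (\<alpha> *s v) 0 (\<gamma> *s v) 0"
    by (subst (2 1) vec3_axis[of v]) (simp add: vec.scale_right_distrib mult.commute)
qed

lemma R_I:
  assumes "\<And>k. D 0 (\<beta> *s axis k 1) 0 (\<delta> *s axis k 1)" shows "R \<beta> \<delta>"
  unfolding R_def
proof
  fix v
  have "D 0 (v $ k *s (\<beta> *s axis k 1)) 0 (v $ k *s (\<delta> *s axis k 1))" for k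
    using D_scale[OF assms[of k], where k = "v $ k"] by simp
  from D_add[OF D_add[OF this[of 1] this[of 2]] this[of 3]]
  show "D 0 (\<beta> *s v) 0 (\<delta> *s v)"
    by (subst (2 1) vec3_axis[of v]) (simp add: vec.scale_right_distrib mult.commute)
qed

text \<open>Root vectors of \<open>\<ss>\<ll>(3)\<close> isolate the standard and the dual components.\<close>

lemma P_of_D:
  assumes "D a a' c c'" shows "P (a $ j) (c $ j)"
proof (rule P_I)
  have ne: "D (a $ j *s axis k 1) 0 (c $ j *s axis k 1) 0" if k: "k \<noteq> j" for k
  proof -
    obtain i where i: "i \<noteq> j" "i \<noteq> k" using ex_third by blast
    \<comment> \<open>E_ij followed by E_ki carries the j-th coordinate to axis \<open>k\<close> and
      kills the dual slots, since k and j differ. The case k = j below takes one more root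
      vector.\<close>
    from D_unit[OF D_unit[OF assms i(1)] i(2)[symmetric]] k i
    show ?thesis by (simp add: axis_def)
  qed
  fix k
  show "D (a $ j *s axis k 1) 0 (c $ j *s axis k 1) 0"
  proof (cases "k = j")
    case True
    obtain i where i: "i \<noteq> j" using ex_third by blast
    from D_unit[OF ne[OF i] i[symmetric]] True show ?thesis by (simp add: axis_def)
  qed (rule ne)
qed

lemma R_of_D:
  assumes "D a a' c c'" shows "R (a' $ j) (c' $ j)"
proof (rule R_I)
  have ne: "D 0 (a' $ j *s axis k 1) 0 (c' $ j *s axis k 1)" if k: "k \<noteq> j" for k
  proof -
    obtain i where i: "i \<noteq> j" "i \<noteq> k" using ex_third by blast
    from D_unit[OF D_unit[OF assms i(1)[symmetric]] i(2)] k i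
    show ?thesis by (simp add: axis_def)
  qed
  fix k
  show "D 0 (a' $ j *s axis k 1) 0 (c' $ j *s axis k 1)"
  proof (cases "k = j")
    case True
    obtain i where i: "i \<noteq> j" using ex_third by blast
    from D_scale[OF D_unit[OF ne[OF i] i], of "-1"] True show ?thesis by (simp add: axis_def vec.scale_minus_left)
  qed (rule ne)
qed

text \<open>The scalar relation says that the gl(3) block of the bracket is trace-free, as it must
  be for an element of \<open>g\<close>.\<close>

lemma D_bracket:
  assumes "D a a' c c'" "D u u' w w'"
  shows "D (cr c' u' - cr w' a') (cr c u - cr w a) (cr u' a') (cr u a)"
    and "dot a u' - dot u a' = 2 * dot c' w - 2 * dot c w'"
proof -
  note br = g_bracket[OF assms[unfolded D_def], unfolded bracket_Om]
  show "D (cr c' u' - cr w' a') (cr c u - cr w a) (cr u' a') (cr u a)" using D_of_g[OF br] .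
  show "dot a u' - dot u a' = 2 * dot c' w - 2 * dot c w'"
    using g_trace_free[OF br] by (simp add: trace3 dot_def algebra_simps)
qed

lemma subspace_F: "vec.subspace {F 0 p 0 |p. True}" "vec.subspace {F 0 0 q |q. True}" "vec.subspace {F t 0 0 |t. True}"
  by (rule vec.subspaceI; force simp: F_add F_scale simp flip: F_zero)+

lemma not_invariant:
  assumes "vec.subspace W" "F t p q \<in> W" "F t p q \<noteq> 0" "F t' p' q' \<notin> W"
    and "\<And>M a a' c c' w. Om M a a' c c' \<in> g \<Longrightarrow> w \<in> W \<Longrightarrow> Om M a a' c c' *v w \<in> W"
  shows False
proof -
  have "A *v w \<in> W" if "A \<in> g" "w \<in> W" for A w
    using that so_Om[of A] g_so assms(5) by (metis subsetD)
  then have "W = {0} \<or> W = UNIV" by (rule g_irredD[OF assms(1)])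
  then show False using assms by auto
qed

lemma P_D: "P \<alpha> \<gamma> \<Longrightarrow> D (\<alpha> *s v) 0 (\<gamma> *s v) 0" and R_D: "R \<beta> \<delta> \<Longrightarrow> D 0 (\<beta> *s v) 0 (\<delta> *s v)"
  by (simp_all add: P_def R_def)

lemma P_add: "P \<alpha> \<gamma> \<Longrightarrow> P \<alpha>' \<gamma>' \<Longrightarrow> P (\<alpha> + \<alpha>') (\<gamma> + \<gamma>')"
  using D_add by (fastforce simp: P_def vec.scale_left_distrib)

lemma R_add: "R \<alpha> \<gamma> \<Longrightarrow> R \<alpha>' \<gamma>' \<Longrightarrow> R (\<alpha> + \<alpha>') (\<gamma> + \<gamma>')"
  using D_add by (fastforce simp: R_def vec.scale_left_distrib)

text \<open>The bracket of two vectors from a copy of C^3 is their cross product in a dual copy; it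
  is evaluated on the first two axes and read off on the third.\<close>

lemma PP: "P \<alpha> \<gamma> \<Longrightarrow> R (2 * \<alpha> * \<gamma>) (- (\<alpha> * \<alpha>))"
  using R_of_D[OF D_bracket(1)[OF P_D[of \<alpha> \<gamma> "axis 1 1"] P_D[of \<alpha> \<gamma> "axis 2 1"]], of 3]
  by (simp add: cr_def axis_def algebra_simps)

lemma RR: "R \<beta> \<delta> \<Longrightarrow> P (2 * \<beta> * \<delta>) (- (\<beta> * \<beta>))"
  using P_of_D[OF D_bracket(1)[OF R_D[of \<beta> \<delta> "axis 1 1"] R_D[of \<beta> \<delta> "axis 2 1"]], of 3]
  by (simp add: cr_def axis_def algebra_simps)

text \<open>Otherwise \<open>g\<close> annihilates \<open>e\<close>, and the line through
  \<open>e\<close> is invariant.\<close>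

lemma ex_P_or_R: "(\<exists>\<alpha> \<gamma>. P \<alpha> \<gamma> \<and> \<alpha> \<noteq> 0) \<or> (\<exists>\<beta> \<delta>. R \<beta> \<delta> \<and> \<beta> \<noteq> 0)"
proof (rule ccontr)
  assume none: "\<not> ?thesis"
  have z: "a = 0 \<and> a' = 0" if "D a a' c c'" for a a' c c'
  proof -
    have "a $ i = 0" "a' $ i = 0" for i
      using P_of_D[OF that, of i] R_of_D[OF that, of i] none by blast+
    then show ?thesis by (simp add: vec_eq_iff)
  qed
  show False
    by (rule not_invariant[OF subspace_F(3), of 1 0 0 0 0 "axis 1 1"])
      (auto simp: axis_eq_0_iff Om_F dest!: z[OF D_of_g])
qed

text \<open>Suppose \<alpha> = 0 throughout. Then \<open>RR\<close> forces \<beta> \<delta> = 0 for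
  every \<open>R\<close>, and adding a pair with \<beta> nonzero forces \<delta> = 0 for every
  \<open>R\<close>. So the slots \<open>a\<close> and \<open>c'\<close> are empty, which makes the
  span of the \<open>y i\<close> invariant.\<close>

lemma ex_P: "\<exists>\<gamma>. P 1 \<gamma>"
proof (rule ccontr)
  assume none: "\<not> ?thesis"
  have scale: "P (k * \<alpha>) (k * \<gamma>)" if "P \<alpha> \<gamma>" for k \<alpha> \<gamma>
    using D_scale[OF P_D[OF that], of k] by (simp add: P_def)
  have P0: "\<alpha> = 0" if "P \<alpha> \<gamma>" for \<alpha> \<gamma>
  proof (rule ccontr)
    assume "\<alpha> \<noteq> 0"
    then have "P 1 (\<gamma> / \<alpha>)" using scale[OF that, of "1 / \<alpha>"] by simp
    then show False using none by blast
  qed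
  then obtain \<beta> \<delta> where R: "R \<beta> \<delta>" "\<beta> \<noteq> 0" using ex_P_or_R by blast
  have prod: "\<beta>' * \<delta>' = 0" if "R \<beta>' \<delta>'" for \<beta>' \<delta>' using P0[OF RR[OF that]] by simp
  have R0: "\<delta>' = 0" if "R \<beta>' \<delta>'" for \<beta>' \<delta>'
    using prod[OF that] prod[OF R(1)] prod[OF R_add[OF R(1) that]] R(2) by (auto simp: algebra_simps)
  have z: "a = 0 \<and> c' = 0" if "D a a' c c'" for a a' c c'
    using P0[OF P_of_D[OF that]] R0[OF R_of_D[OF that]] by (auto simp: vec_eq_iff)
  show False
    by (rule not_invariant[OF subspace_F(2), of 0 0 "axis 1 1" 1 0 0])
      (auto simp: axis_eq_0_iff Om_F dest!: z[OF D_of_g])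
qed

text \<open>The argument of \<open>ex_P\<close> with the two dual modules exchanged; now the span of
  the \<open>x i\<close> would be invariant.\<close>

lemma ex_R: "\<exists>\<delta>. R 1 \<delta>"
proof (rule ccontr)
  assume none: "\<not> ?thesis"
  have scale: "R (k * \<alpha>) (k * \<gamma>)" if "R \<alpha> \<gamma>" for k \<alpha> \<gamma>
    using D_scale[OF R_D[OF that], of k] by (simp add: R_def)
  have R0: "\<alpha> = 0" if "R \<alpha> \<gamma>" for \<alpha> \<gamma>
  proof (rule ccontr)
    assume "\<alpha> \<noteq> 0"
    then have "R 1 (\<gamma> / \<alpha>)" using scale[OF that, of "1 / \<alpha>"] by simp
    then show False using none by blast
  qed
  then obtain \<beta> \<delta> where P: "P \<beta> \<delta>" "\<beta> \<noteq> 0" using ex_P_or_R by blast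
  have prod: "\<beta>' * \<delta>' = 0" if "P \<beta>' \<delta>'" for \<beta>' \<delta>' using R0[OF PP[OF that]] by simp
  have P0: "\<delta>' = 0" if "P \<beta>' \<delta>'" for \<beta>' \<delta>'
    using prod[OF that] prod[OF P(1)] prod[OF P_add[OF P(1) that]] P(2) by (auto simp: algebra_simps)
  have z: "a' = 0 \<and> c = 0" if "D a a' c c'" for a a' c c'
    using R0[OF R_of_D[OF that]] P0[OF P_of_D[OF that]] by (auto simp: vec_eq_iff)
  show False
    by (rule not_invariant[OF subspace_F(1), of 0 "axis 1 1" 0 1 0 0])
      (auto simp: axis_eq_0_iff Om_F dest!: z[OF D_of_g])
qed

lemma g_structure:
  "\<exists>\<gamma> \<delta>. 1 + 2 * \<gamma> * \<delta> = 0 \<and> g = {Om M a a' (\<gamma> *s a) (\<delta> *s a') |M a a'. trace M = 0}"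
proof -
  obtain \<gamma> where P: "P 1 \<gamma>" using ex_P by blast
  obtain \<delta> where R: "R 1 \<delta>" using ex_R by blast
  have PD: "D v 0 (\<gamma> *s v) 0" and RD: "D 0 v 0 (\<delta> *s v)" for v
    using P_D[OF P, of v] R_D[OF R, of v] by simp_all
  have gd: "1 + 2 * \<gamma> * \<delta> = 0"
  proof -
    have "- (2 * (\<gamma> * \<delta>)) = 1"
      using D_bracket(2)[OF PD[of "axis 1 1"] RD[of "axis 1 1"]] by (simp add: dot_def axis_def)
    then show ?thesis by algebra
  qed
  have gd': "- (2 * \<gamma> * \<delta>) = 1" using gd by algebra
  \<comment> \<open>The trace relation against the known families \<open>RD\<close> and
    \<open>PD\<close> gives a = -2 \<delta> c and a' = -2 \<gamma> c', so no second copy of either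
    module fits into \<open>g\<close>.\<close>
  have "c = \<gamma> *s a \<and> c' = \<delta> *s a'" if D: "D a a' c c'" for a a' c c'
  proof
    have "a + (2 * \<delta>) *s c = 0"
    proof (rule dot_eq_0D)
      fix q
      show "dot (a + (2 * \<delta>) *s c) q = 0"
        using D_bracket(2)[OF D RD[of q]] by (simp add: dot_add dot_scale)
    qed
    then have "a = - ((2 * \<delta>) *s c)" by (simp add: add_eq_0_iff2)
    then have "\<gamma> *s a = (- (2 * \<gamma> * \<delta>)) *s c" by (simp add: vec_eq_iff)
    then show "c = \<gamma> *s a" by (simp only: gd' vec.scale_one)
    have "a' + (2 * \<gamma>) *s c' = 0"
    proof (rule dot_eq_0D)
      fix q
      have "- dot a' q = 2 * (\<gamma> * dot c' q)"
        using D_bracket(2)[OF D PD[of q]] dot_commute[of q a'] by (simp add: dot_scale)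
      then have "dot a' q + 2 * \<gamma> * dot c' q = 0" by algebra
      then show "dot (a' + (2 * \<gamma>) *s c') q = 0" by (simp add: dot_add dot_scale)
    qed
    then have "a' = - ((2 * \<gamma>) *s c')" by (simp add: add_eq_0_iff2)
    then have "\<delta> *s a' = (- (2 * \<gamma> * \<delta>)) *s c'" by (simp add: vec_eq_iff)
    then show "c' = \<delta> *s a'" by (simp only: gd' vec.scale_one)
  qed
  note uniq = this
  have "A \<in> g \<longleftrightarrow> (\<exists>M a a'. A = Om M a a' (\<gamma> *s a) (\<delta> *s a') \<and> trace M = 0)" for A
  proof
    assume A: "A \<in> g"
    then obtain M a a' c c' where Om: "A = Om M a a' c c'" using so_Om g_so by blast
    then show "\<exists>M a a'. A = Om M a a' (\<gamma> *s a) (\<delta> *s a') \<and> trace M = 0"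
      using A uniq D_of_g g_trace_free by blast
  next
    assume "\<exists>M a a'. A = Om M a a' (\<gamma> *s a) (\<delta> *s a') \<and> trace M = 0"
    then obtain M a a' where A: "A = Om M a a' (\<gamma> *s a) (\<delta> *s a')" "trace M = 0" by blast
    have "D a a' (\<gamma> *s a) (\<delta> *s a')" using D_add[OF PD[of a] RD[of a']] by simp
    then show "A \<in> g" using A g_of_D by simp
  qed
  then have "g = {Om M a a' (\<gamma> *s a) (\<delta> *s a') |M a a'. trace M = 0}" by blast
  then show ?thesis using gd by blast
qed

text \<open>The witness is the element of the complement corresponding to \<open>v\<close> under the isomorphism
  of \<open>\<gg>\<close>-modules between \<open>\<complex>\<^sup>7\<close> and the complement; it extends \<open>e \<mapsto> X\<close>.\<close>

lemma axis_element_everywhere: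
  assumes v: "b v v = -1"
  shows "\<exists>Z. axis_element Z v"
proof -
  obtain \<gamma> \<delta> where gd: "1 + 2 * \<gamma> * \<delta> = 0"
    and g: "g = {Om M a a' (\<gamma> *s a) (\<delta> *s a') |M a a'. trace M = 0}" using g_structure by blast
  \<comment> \<open>Orthogonality of \<open>Z\<close> to \<open>g\<close> requires 1 - \<gamma> k2 =
    0 and 1 + \<delta> k1 = 0; the relation between \<gamma> and \<delta> turns the solutions into
    these values, with product 2.\<close>
  define k1 k2 where "k1 = 2 * \<gamma>" and "k2 = - 2 * \<delta>"
  have k: "k1 * k2 = 2" using gd unfolding k1_def k2_def by algebra
  then have k': "k1 * (k2 * z) = 2 * z" for z by (simp flip: mult.assoc)
  obtain t p q where vF: "v = F t p q" by (rule F_cases)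
  define Z where "Z = Om (mat t) (- p) q (k1 *s p) (k2 *s q)"
  have matt: "mat t *v r = t *s r" "r v* mat t = t *s r" for r :: "complex^3"
    by (simp_all add: vec3_eq_iff mv3_nth vm3_nth mat_def)
  have ZF: "Z *v F s r u = F (dot q r - dot p u) (t *s r - s *s p + k2 *s cr q u) (- (t *s u) + s *s q + k1 *s cr p r)" for s r u
    by (simp add: Z_def Om_F matt transpose_mat cr_scale) (simp add: coord3 algebra_simps)
  have "Z \<in> m"
  proof (rule in_mI)
    show "Z \<in> so b" by (simp add: Z_def Om_so)
    fix B assume "B \<in> g"
    then obtain M a a' where B: "B = Om M a a' (\<gamma> *s a) (\<delta> *s a')" "trace M = 0" by (auto simp: g)
    have "trace (M ** mat t) = t * trace M" by (simp add: trace3 mm3_nth mat_def algebra_simps)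
    then have "trace (B ** Z) = 2 * (dot a q - dot a' p - dot (\<gamma> *s a) (k2 *s q) - dot (\<delta> *s a') (k1 *s p))"
      unfolding B(1) Z_def trace_Om_Om by (simp add: B(2) dot_def algebra_simps)
    also have "\<dots> = 2 * (1 + 2 * \<gamma> * \<delta>) * (dot a q - dot a' p)"
      by (simp only: dot_scale k1_def k2_def) (simp add: algebra_simps)
    finally show "trace (B ** Z) = 0" by (simp add: gd)
  qed
  moreover have "Z *v v = 0"
    unfolding vF ZF by (simp add: coord3)
  moreover have "Z *v (Z *v w) = w" if w: "b w v = 0" for w
  proof -
    obtain s r u where wF: "w = F s r u" by (rule F_cases)
    \<comment> \<open>The double product identity of a seven-dimensional cross product, with
      \<open>Z\<close> as product by \<open>v\<close>.\<close>
    have "Z *v (Z *v w) = b v w *s v - b v v *s w"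
      unfolding wF vF ZF F_scale F_diff b_F_F
      by (simp add: coord3 algebra_simps k k')
    then show ?thesis using v w b_commute[of w v] by simp
  qed
  ultimately show ?thesis using v by (auto simp: axis_element_def)
qed

end

text \<open>One frame is needed to describe \<open>g\<close>; the description gives an axis element
  at any prescribed \<open>v\<close>, and its eigenspaces give the frame there.\<close>

lemma (in g2) ex_frame_at:
  assumes "b v v = -1"
  shows "\<exists>x y X. g2_frame b g v x y X"
proof -
  obtain X e where X: "axis_element X e" using ex_axis_element by blast
  obtain x y where xy: "frame b e x y" "\<forall>i. X *v x i = x i \<and> X *v y i = - y i"
    using axis_element_frame[OF X] by blast
  interpret fr: g2_frame b g e x y X
    using xy X by (simp add: g2_frame_def g2_frame_axioms_def g2_axioms)
  obtain Z where Z: "axis_element Z v" using fr.axis_element_everywhere[OF assms] by blast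
  obtain x y where xy: "frame b v x y" "\<forall>i. Z *v x i = x i \<and> Z *v y i = - y i"
    using axis_element_frame[OF Z] by blast
  have "g2_frame b g v x y Z"
    using xy Z by (simp add: g2_frame_def g2_frame_axioms_def g2_axioms)
  then show ?thesis by blast
qed

section \<open>The Killing complement\<close>

lemma lie_bracket_simps:
  "lie_bracket (A + B) C = lie_bracket A C + lie_bracket B C"
  "lie_bracket A (B + C) = lie_bracket A B + lie_bracket A C"
  "lie_bracket (mscale k A) B = mscale k (lie_bracket A B)"
  "lie_bracket A (mscale k B) = mscale k (lie_bracket A B)"
  by (simp_all add: lie_bracket_def mm_simps mscale_mm cmat.scale_right_diff_distrib)

lemma lie_bracket_swap: "lie_bracket B A = - lie_bracket A B"
  by (simp add: lie_bracket_def)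

lemma lie_bracket_zero [simp]: "lie_bracket A 0 = 0"
  by (simp add: lie_bracket_def)

lemma lie_bracket_jacobi:
  "lie_bracket (lie_bracket A B) C = lie_bracket A (lie_bracket B C) - lie_bracket B (lie_bracket A C)"
  by (simp add: lie_bracket_def mm_simps matrix_mul_assoc)

text \<open>The spanning family \<open>w\<close> with coordinate functionals \<open>l\<close> need not be independent.\<close>

lemma trace_on_eq:
  assumes S: "cmat.subspace S" and I: "finite I" and w: "\<And>i. i \<in> I \<Longrightarrow> w i \<in> S"
    and l: "\<And>i. i \<in> I \<Longrightarrow> functional mscale (l i)"
    and expand: "\<And>v. v \<in> S \<Longrightarrow> v = (\<Sum>i\<in>I. mscale (l i v) (w i))"
    and f_add: "\<And>u v. f (u + v) = f u + f v" and f_scale: "\<And>c v. f (mscale c v) = mscale c (f v)"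
    and fS: "\<And>v. v \<in> S \<Longrightarrow> f v \<in> S"
  shows "trace_on S f = (\<Sum>i\<in>I. l i (f (w i)))"
proof -
  define B where "B = (SOME B. cmat.independent B \<and> cmat.span B = S)"
  have "\<exists>B. cmat.independent B \<and> cmat.span B = S"
    using cmat.basis_exists[of S] S by (metis cmat.span_subspace)
  then have B: "cmat.independent B" "cmat.span B = S"
    unfolding B_def by (metis (mono_tags, lifting) someI_ex)+
  have fB: "finite B" using B(1) by (rule cmatf.finiteI_independent)
  have f0: "f 0 = 0" using f_scale[of 0 0] by simp
  have f_sum: "f (\<Sum>j\<in>J. h j) = (\<Sum>j\<in>J. f (h j))" for J :: "(complex^'a^'b) set" and h
    by (induction J rule: infinite_finite_induct) (simp_all add: f0 f_add)
  have l_sum: "l i (\<Sum>j\<in>J. h j) = (\<Sum>j\<in>J. l i (h j))" if "i \<in> I" for i J and h :: "complex^'a^'b \<Rightarrow> _"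
  proof -
    have "l i (u + v) = l i u + l i v" "l i 0 = 0" for u v
      using l[OF that] functional_zero[OF cmat.module_axioms l[OF that]] by (simp_all add: functional_def)
    then show ?thesis by (induction J rule: infinite_finite_induct) simp_all
  qed
  have rep: "cmat.representation B (f u) u = (\<Sum>i\<in>I. l i (f u) * cmat.representation B (w i) u)" if u: "u \<in> B" for u
  proof -
    have "f u \<in> S" using u B(2) fS by (metis cmat.span_base)
    then have "cmat.representation B (f u) = cmat.representation B (\<Sum>i\<in>I. mscale (l i (f u)) (w i))"
      using expand by metis
    also have "cmat.representation B (\<Sum>i\<in>I. mscale (l i (f u)) (w i)) =
        (\<lambda>v. \<Sum>i\<in>I. cmat.representation B (mscale (l i (f u)) (w i)) v)"
      using w B S by (intro cmat.representation_sum) (auto simp: cmat.subspace_scale)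
    finally have "cmat.representation B (f u) u = (\<Sum>i\<in>I. cmat.representation B (mscale (l i (f u)) (w i)) u)"
      by (rule fun_cong)
    also have "\<dots> = (\<Sum>i\<in>I. l i (f u) * cmat.representation B (w i) u)"
      using w B by (intro sum.cong) (auto simp: cmat.representation_scale)
    finally show ?thesis .
  qed
  \<comment> \<open>The identity tr(WL) = tr(LW): \<open>l\<close> followed by the combination of
    the \<open>w i\<close> is the identity of \<open>S\<close>, so the trace may be taken over
    \<open>I\<close> instead of the chosen basis \<open>B\<close>.\<close>
  have "trace_on S f = (\<Sum>u\<in>B. \<Sum>i\<in>I. l i (f u) * cmat.representation B (w i) u)"
    by (simp add: trace_on_def Let_def B_def[symmetric] rep)
  also have "\<dots> = (\<Sum>i\<in>I. \<Sum>u\<in>B. l i (f u) * cmat.representation B (w i) u)"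
    by (rule sum.swap)
  also have "\<dots> = (\<Sum>i\<in>I. l i (f (w i)))"
  proof (rule sum.cong)
    fix i assume i: "i \<in> I"
    have "w i = (\<Sum>u\<in>B. mscale (cmat.representation B (w i) u) u)"
      using cmat.sum_representation_eq[OF B(1) _ fB subset_refl, of "w i"] w[OF i] B(2) by simp
    then have "f (w i) = (\<Sum>u\<in>B. mscale (cmat.representation B (w i) u) (f u))"
      by (metis (mono_tags, lifting) f_sum f_scale sum.cong)
    then have "l i (f (w i)) = (\<Sum>u\<in>B. l i (mscale (cmat.representation B (w i) u) (f u)))"
      using l_sum[OF i] by simp
    then show "(\<Sum>u\<in>B. l i (f u) * cmat.representation B (w i) u) = l i (f (w i))"
      using l[OF i] by (simp add: functional_def mult.commute)
  qed simp
  finally show ?thesis .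
qed

text \<open>The trace of ad M ad N on gl(n) is 2n tr(MN) - 2 tr M tr N, here with n = 3.\<close>

lemma trace_ad_ad:
  fixes M N :: "complex^3^3"
  shows "(\<Sum>(i,j)\<in>UNIV. lie_bracket M (lie_bracket N (matrix_unit i j)) $ i $ j) = 6 * trace (M ** N) - 2 * trace M * trace N"
  unfolding UNIV_Times_UNIV[symmetric] sum.cartesian_product[symmetric] sum_3
  by (simp add: coord3 lie_bracket3_nth matrix_unit_nth algebra_simps)

lemma trace_form_sl_nondegenerate:
  fixes M :: "complex^3^3"
  assumes tr: "trace M = 0" and z: "\<And>N. trace N = 0 \<Longrightarrow> trace (M ** N) = 0"
  shows "M = 0"
proof -
  have off: "M $ i $ j = 0" if "i \<noteq> j" for i j
  proof -
    have "trace (M ** matrix_unit j i) = M $ i $ j"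
      using exhaust_3[of i] exhaust_3[of j] by (elim disjE; simp add: coord3 matrix_unit_nth)
    then show ?thesis using z[of "matrix_unit j i"] that by (simp add: trace_matrix_unit)
  qed
  have "trace (M ** (matrix_unit 1 1 - matrix_unit i i)) = M $ 1 $ 1 - M $ i $ i" for i
    using exhaust_3[of i] by (elim disjE; simp add: coord3 matrix_unit_nth)
  then have diag: "M $ i $ i = M $ 1 $ 1" for i
    using z[of "matrix_unit 1 1 - matrix_unit i i"] by (simp add: trace_sub trace_matrix_unit)
  have "3 * M $ 1 $ 1 = 0" using tr diag[of 2] diag[of 3] by (simp add: trace3)
  then have "M $ i $ j = 0" for i j using off[of i j] diag[of i] by (cases "i = j") auto
  then show ?thesis by (simp add: vec_eq_iff)
qed

lemma trace_lie_bracket [simp]: "trace (lie_bracket A B) = 0"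
  by (simp add: lie_bracket_def trace_sub trace_mul_sym[of A])

context frame
begin

lemma bracket_Om_full:
  assumes "trace M = 0" "trace N = 0"
  shows "lie_bracket (Om M a a' c c') (Om N u u' w w') =
     Om (lie_bracket M N + (\<chi> i j. a $ i * u' $ j - u $ i * a' $ j + w $ i * c' $ j - c $ i * w' $ j
            + (if i = j then dot w' c - dot c' w else 0)))
       (M *v u - N *v a + (cr c' u' - cr w' a')) (transpose N *v a' - transpose M *v u' + (cr c u - cr w a))
       (M *v w - N *v c + cr u' a') (transpose N *v c' - transpose M *v w' + cr u a)"
proof -
  have split: "Om M a a' c c' = Om M 0 0 0 0 + Om 0 a a' c c'" for M a a' c c'
    by (simp add: Om_add)
  have 1: "lie_bracket (Om M 0 0 0 0) (Om N u u' w w') =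
     Om (lie_bracket M N) (M *v u) (- (transpose M *v u')) (M *v w) (- (transpose M *v w'))"
    by (rule bracket_Om_trace_free[OF assms(1)])
  have "lie_bracket (Om 0 a a' c c') (Om N 0 0 0 0) = - lie_bracket (Om N 0 0 0 0) (Om 0 a a' c c')"
    by (rule lie_bracket_swap)
  also have "\<dots> = mscale (- 1) (Om 0 (N *v a) (- (transpose N *v a')) (N *v c) (- (transpose N *v c')))"
    unfolding bracket_Om_trace_free[OF assms(2)] by (simp add: lie_bracket_def)
  also have "\<dots> = Om 0 (- (N *v a)) (transpose N *v a') (- (N *v c)) (transpose N *v c')"
    by (simp add: Om_scale vec.scale_minus_left)
  finally have 2: "lie_bracket (Om 0 a a' c c') (Om N 0 0 0 0) = \<dots>" .
  have "lie_bracket (Om M a a' c c') (Om N u u' w w') =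
      lie_bracket (Om M 0 0 0 0) (Om N u u' w w') +
      (lie_bracket (Om 0 a a' c c') (Om N 0 0 0 0) + lie_bracket (Om 0 a a' c c') (Om 0 u u' w w'))"
  proof -
    have "lie_bracket (Om M a a' c c') (Om N u u' w w') =
        lie_bracket (Om M 0 0 0 0) (Om N u u' w w') + lie_bracket (Om 0 a a' c c') (Om N u u' w w')"
      by (subst split[of M]) (rule lie_bracket_simps)
    also have "lie_bracket (Om 0 a a' c c') (Om N u u' w w') =
        lie_bracket (Om 0 a a' c c') (Om N 0 0 0 0) + lie_bracket (Om 0 a a' c c') (Om 0 u u' w w')"
      by (subst split[of N]) (rule lie_bracket_simps)
    finally show ?thesis .
  qed
  then show ?thesis
    unfolding 1 2 bracket_Om Om_add by (simp add: algebra_simps)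
qed

end

section \<open>Killing form, complement and the module isomorphisms in normal form\<close>

locale g2_normal_form = g2_frame +
  fixes \<gamma> \<delta> :: complex
  assumes gd: "1 + 2 * \<gamma> * \<delta> = 0"
    and g_eq: "g = {Om M a a' (\<gamma> *s a) (\<delta> *s a') |M a a'. trace M = 0}"
begin

abbreviation "Th M a a' \<equiv> Om M a a' (\<gamma> *s a) (\<delta> *s a')"

lemma Th_00: "Th M 0 0 = Om M 0 0 0 0"
  by simp

lemma Th_in_g: "trace M = 0 \<Longrightarrow> Th M a a' \<in> g"
  by (auto simp: g_eq)

lemma g_cases:
  assumes "A \<in> g" obtains M a a' where "A = Th M a a'" "trace M = 0"
  using assms by (auto simp: g_eq)

lemma Om_nth: "b (Om M a a' c c' *v x j) (y i) = M $ i $ j"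
    "b (Om M a a' c c' *v e) (y i) = a $ i" "b (Om M a a' c c' *v e) (x i) = a' $ i"
  unfolding x_F[of j]
  by (simp_all add: Om_F b_F mv_axis column_def) (simp_all add: e_F[symmetric] Om_F[of _ _ _ _ _ 1 0 0, folded e_F] b_F)

text \<open>Fifteen elements for dimension 14: the nine matrix units are projected to sl(3) by
  subtracting a third of the identity from the diagonal ones. The redundancy keeps the coordinates
  equal to plain matrix entries.\<close>

definition fam :: "(3 \<times> 3) + (3 + 3) \<Rightarrow> complex^7^7" where
  "fam k = (case k of Inl (i, j) \<Rightarrow> Th (matrix_unit i j - mscale (if i = j then 1 / 3 else 0) (mat 1)) 0 0
     | Inr (Inl i) \<Rightarrow> Th 0 (axis i 1) 0 | Inr (Inr i) \<Rightarrow> Th 0 0 (axis i 1))"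

definition fam_coord :: "(3 \<times> 3) + (3 + 3) \<Rightarrow> complex^7^7 \<Rightarrow> complex" where
  "fam_coord k A = (case k of Inl (i, j) \<Rightarrow> b (A *v x j) (y i)
     | Inr (Inl i) \<Rightarrow> b (A *v e) (y i) | Inr (Inr i) \<Rightarrow> b (A *v e) (x i))"

lemma sum_fam: "(\<Sum>k\<in>UNIV. h k) = (\<Sum>(i,j)\<in>UNIV. h (Inl (i, j))) + ((\<Sum>i\<in>UNIV. h (Inr (Inl i))) + (\<Sum>i\<in>UNIV. h (Inr (Inr i))))"
  for h :: "(3 \<times> 3) + (3 + 3) \<Rightarrow> 'z::comm_monoid_add"
  by (simp only: UNIV_Plus_UNIV[symmetric] sum.Plus[OF finite finite] split_def prod.collapse o_def)

lemma fam_expand: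
  assumes "A \<in> g" shows "A = (\<Sum>k\<in>UNIV. mscale (fam_coord k A) (fam k))"
proof -
  obtain M a a' where A: "A = Th M a a'" "trace M = 0" using g_cases[OF assms] .
  have M: "M $ 3 $ 3 = - M $ 1 $ 1 - M $ 2 $ 2" using A(2) unfolding trace3 by algebra
  have "(\<Sum>k\<in>UNIV. mscale (fam_coord k A) (fam k)) = Th M a a'"
    unfolding sum_fam UNIV_Times_UNIV[symmetric] sum.cartesian_product[symmetric] sum_3
      fam_def fam_coord_def A(1) sum.case prod.case Om_nth Om_scale Om_add Om_inject
    by (simp add: vec_eq_iff forall_3 matrix_unit_nth mat_def axis_def M algebra_simps)
  then show ?thesis using A by simp
qed

text \<open>The factor 8 is 6 from the adjoint action on sl(3) plus 1 from each of C^3 and its dual.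
  The parts \<open>a\<close>, \<open>a'\<close> shift the Z/3-grading of \<open>g\<close> and so
  contribute nothing to the diagonal.\<close>

lemma killing_form_Th:
  assumes M: "trace M = 0" and N: "trace N = 0"
  shows "killing_form g (Th M a a') (Th N 0 0) = 8 * trace (M ** N)"
proof -
  let ?f = "\<lambda>Z. lie_bracket (Th M a a') (lie_bracket (Th N 0 0) Z)"
  have "trace_on g ?f = (\<Sum>k\<in>UNIV. fam_coord k (?f (fam k)))"
  proof (rule trace_on_eq[OF subspace_g])
    show "fam k \<in> g" for k
    proof (cases k)
      case (Inl p)
      obtain i j where p: "p = (i, j)" by (cases p)
      show ?thesis
        unfolding fam_def Inl p sum.case prod.case
        by (rule Th_in_g) (simp add: trace_sub trace_mscale trace_matrix_unit trace_I)
    next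
      case (Inr r)
      have "Th 0 a a' \<in> g" for a a' by (rule Th_in_g) simp
      then show ?thesis unfolding fam_def Inr sum.case by (cases r) (simp_all only: sum.case)
    qed
    show "functional mscale (fam_coord k)" for k
      unfolding fam_coord_def by (cases k rule: sum.exhaust; (rename_tac p, case_tac p)?)
        (auto simp: b_matrix_functional)
    show "v \<in> g \<Longrightarrow> v = (\<Sum>k\<in>UNIV. mscale (fam_coord k v) (fam k))" for v by (rule fam_expand)
    show "?f v \<in> g" if "v \<in> g" for v using that g_bracket Th_in_g M N by blast
  qed (simp_all add: lie_bracket_simps)
  also have "\<dots> = (\<Sum>(i,j)\<in>UNIV. lie_bracket M (lie_bracket N (matrix_unit i j)) $ i $ j)
      + ((\<Sum>i\<in>UNIV. (M *v (N *v axis i 1)) $ i) + (\<Sum>i\<in>UNIV. (transpose M *v (transpose N *v axis i 1)) $ i))"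
    unfolding sum_fam
  proof (intro arg_cong2[where f = "(+)"] sum.cong refl)
    fix ij :: "3 \<times> 3" obtain i j where ij: "ij = (i, j)" by (cases ij)
    let ?k = "if i = j then 1 / 3 else 0 :: complex"
    \<comment> \<open>Scalar matrices commute with \<open>N\<close>, so the sum over projected units
      equals the trace over gl(3).\<close>
    have E: "lie_bracket N (matrix_unit i j - mscale ?k (mat 1)) = lie_bracket N (matrix_unit i j)"
      by (simp add: lie_bracket_def mm_simps mscale_mm)
    have tr: "trace (matrix_unit i j - mscale ?k (mat 1) :: complex^3^3) = 0"
      by (simp add: trace_sub trace_mscale trace_matrix_unit trace_I)
    show "(case ij of (i, j) \<Rightarrow> fam_coord (Inl (i, j)) (?f (fam (Inl (i, j))))) =
        (case ij of (i, j) \<Rightarrow> lie_bracket M (lie_bracket N (matrix_unit i j)) $ i $ j)"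
      unfolding ij prod.case fam_coord_def fam_def sum.case
        Th_00 bracket_Om_trace_free[OF N] E
      by (subst bracket_Om_full[OF M]) (simp_all add: Om_nth)
  next
    fix i :: 3
    show "fam_coord (Inr (Inl i)) (?f (fam (Inr (Inl i)))) = (M *v (N *v axis i 1)) $ i"
      unfolding fam_coord_def fam_def sum.case Th_00 bracket_Om_trace_free[OF N]
      by (subst bracket_Om_full[OF M]) (simp_all add: Om_nth lie_bracket_def)
    show "fam_coord (Inr (Inr i)) (?f (fam (Inr (Inr i)))) = (transpose M *v (transpose N *v axis i 1)) $ i"
      unfolding fam_coord_def fam_def sum.case Th_00 bracket_Om_trace_free[OF N]
      by (subst bracket_Om_full[OF M]) (simp_all add: Om_nth lie_bracket_def vm3_nth algebra_simps)
  qed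
  also have "\<dots> = 8 * trace (M ** N)"
    unfolding trace_ad_ad sum_3 using M N by (simp add: coord3 axis_def algebra_simps)
  finally show ?thesis by (simp add: killing_form_def)
qed

abbreviation "H \<equiv> {v. b v e = 0}"
abbreviation "K \<equiv> g \<inter> so_preserving b H"

lemma H_eq: "H = {F 0 p q |p q. True}"
proof -
  have "v \<in> H \<longleftrightarrow> (\<exists>p q. v = F 0 p q)" for v
    by (cases v rule: F_cases) (auto simp: b_F)
  then show ?thesis by blast
qed

lemma K_eq: "K = {Th M 0 0 |M. trace M = 0}"
proof
  show "K \<subseteq> {Th M 0 0 |M. trace M = 0}"
  proof
    fix A assume A: "A \<in> K"
    then obtain M a a' where Th: "A = Th M a a'" "trace M = 0" using g_cases by blast
    have "b (A *v F 0 p q) e = 0" for p q using A by (auto simp: so_preserving_def b_F)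
    then have z: "dot a' p + dot a q = 0" for p q
      unfolding Th(1) Om_F b_F by (metis neg_equal_0_iff_equal)
    have "a' = 0" by (rule dot_eq_0D) (use z[of _ 0] in simp)
    moreover have "a = 0" by (rule dot_eq_0D) (use z[of 0] in simp)
    ultimately show "A \<in> {Th M 0 0 |M. trace M = 0}" using Th by blast
  qed
  show "{Th M 0 0 |M. trace M = 0} \<subseteq> K"
    using Th_in_g[of _ 0 0] Om_so by (auto simp: so_preserving_def H_eq Om_F)
qed

lemma complement_eq: "killing_complement g K = {Th 0 a a' |a a'. True}"
proof
  show "killing_complement g K \<subseteq> {Th 0 a a' |a a'. True}"
  proof
    fix A assume A: "A \<in> killing_complement g K"
    then have "A \<in> g" by (simp add: killing_complement_def)
    then obtain M a a' where Th: "A = Th M a a'" "trace M = 0" by (rule g_cases)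
    have "trace (M ** N) = 0" if "trace N = 0" for N
    proof -
      have "killing_form g A (Th N 0 0) = 0"
        using A that K_eq by (auto simp: killing_complement_def)
      then show ?thesis unfolding Th(1) killing_form_Th[OF Th(2) that] by simp
    qed
    then have "M = 0" by (rule trace_form_sl_nondegenerate[OF Th(2)])
    then show "A \<in> {Th 0 a a' |a a'. True}" using Th by blast
  qed
  show "{Th 0 a a' |a a'. True} \<subseteq> killing_complement g K"
    using Th_in_g[of 0] killing_form_Th[of 0] unfolding killing_complement_def K_eq by auto
qed

definition \<phi> :: "complex^3^3 \<Rightarrow> complex^7^7" where
  "\<phi> M = Th M 0 0"

lemma \<phi>_linear: "linear_on mscale mscale V \<phi>"
  by (simp add: linear_on_def \<phi>_def Om_add Om_scale)

lemma \<phi>_bracket: "trace M = 0 \<Longrightarrow> \<phi> (lie_bracket M N) = lie_bracket (\<phi> M) (\<phi> N)"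
  by (simp add: \<phi>_def bracket_Om_trace_free)

lemma \<phi>_Th: "trace M = 0 \<Longrightarrow> lie_bracket (\<phi> M) (Th 0 a a') = Th 0 (M *v a) (- (transpose M *v a'))"
  by (simp add: \<phi>_def bracket_Om_trace_free mv_scale del: transpose_matrix_vector)

lemma \<phi>_iso: "lie_isomorphism sl K \<phi>"
  unfolding lie_isomorphism_def
proof (intro conjI ballI)
  show "linear_on mscale mscale sl \<phi>" by (rule \<phi>_linear)
  show "bij_betw \<phi> sl K"
    by (auto simp: bij_betw_def inj_on_def \<phi>_def K_eq sl_def)
qed (auto simp: \<phi>_bracket sl_def)

lemma rep_complement: "lie_rep sl mscale (killing_complement g K) (\<lambda>A. lie_bracket (\<phi> A))"
  unfolding lie_rep_def
proof (intro conjI ballI)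
  show "vector_space (mscale :: complex \<Rightarrow> complex^7^7 \<Rightarrow> _)" by (rule cmat.vector_space_axioms)
  show "cmat.subspace (killing_complement g K)"
    unfolding complement_eq
  proof (rule cmat.subspaceI)
    have "Th 0 0 0 = 0" using Om_zero by simp
    then show "0 \<in> {Th 0 a a' |a a'. True}" by (metis (mono_tags, lifting) mem_Collect_eq)
    have "Th 0 a a' + Th 0 c c' = Th 0 (a + c) (a' + c')" for a a' c c'
      by (simp add: Om_add vec.scale_right_distrib)
    then show "A + B \<in> {Th 0 a a' |a a'. True}"
      if "A \<in> {Th 0 a a' |a a'. True}" "B \<in> {Th 0 a a' |a a'. True}" for A B
      using that by blast
    have "mscale k (Th 0 a a') = Th 0 (k *s a) (k *s a')" for k a a'
      by (simp add: Om_scale mult.commute)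
    then show "mscale k A \<in> {Th 0 a a' |a a'. True}" if "A \<in> {Th 0 a a' |a a'. True}" for k A
      using that by blast
  qed
  fix M assume "M \<in> (sl :: (complex^3^3) set)"
  then have M: "trace M = 0" by (simp add: sl_def)
  show "linear_on mscale mscale (killing_complement g K) (lie_bracket (\<phi> M))"
    by (simp add: linear_on_def lie_bracket_simps)
  show "lie_bracket (\<phi> M) ` killing_complement g K \<subseteq> killing_complement g K"
    unfolding complement_eq using \<phi>_Th[OF M] by blast
  fix N v
  show "lie_bracket (\<phi> (lie_bracket M N)) v =
      lie_bracket (\<phi> M) (lie_bracket (\<phi> N) v) - lie_bracket (\<phi> N) (lie_bracket (\<phi> M) v)"
    by (simp only: \<phi>_bracket[OF M] lie_bracket_jacobi)
next
  show "linear_on mscale mscale sl (\<lambda>A. lie_bracket (\<phi> A) v)" for v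
    using \<phi>_linear[of sl] by (simp add: linear_on_def lie_bracket_simps)
qed

lemma rep_H: "lie_rep sl (*s) H (\<lambda>A. (*v) (\<phi> A))"
  unfolding lie_rep_def
proof (intro conjI ballI)
  show "vector_space ((*s) :: complex \<Rightarrow> complex^7 \<Rightarrow> _)" by (rule vec.vector_space_axioms)
  show "vec.subspace H" by (auto simp: vec.subspace_def b_simps)
  fix M assume "M \<in> (sl :: (complex^3^3) set)"
  then have M: "trace M = 0" by (simp add: sl_def)
  show "linear_on (*s) (*s) H ((*v) (\<phi> M))"
    by (simp add: linear_on_def mv_simps)
  show "(*v) (\<phi> M) ` H \<subseteq> H" unfolding H_eq by (auto simp: \<phi>_def Om_F)
  fix N v
  show "\<phi> (lie_bracket M N) *v v = \<phi> M *v (\<phi> N *v v) - \<phi> N *v (\<phi> M *v v)"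
    by (simp only: \<phi>_bracket[OF M] lie_bracket_mv)
next
  show "linear_on mscale (*s) sl (\<lambda>A. \<phi> A *v v)" for v
    using \<phi>_linear[of sl] by (simp add: linear_on_def mv_simps)
qed

lemma rep_pair: "lie_rep sl pair_scale UNIV (std_plus_dual :: complex^3^3 \<Rightarrow> _)"
proof -
  have vs: "vector_space (pair_scale :: complex \<Rightarrow> (complex^3) \<times> (complex^3) \<Rightarrow> _)"
    by unfold_locales (simp_all add: pair_scale_def vec.scale_right_distrib vec.scale_left_distrib)
  then interpret ps: vector_space "pair_scale :: complex \<Rightarrow> (complex^3) \<times> (complex^3) \<Rightarrow> _" .
  show ?thesis
    unfolding lie_rep_def using vs ps.subspace_UNIV
    by (auto simp: linear_on_def std_plus_dual_def pair_scale_def coord3 lie_bracket3_nth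
        algebra_simps prod_eq_iff)
qed

text \<open>Evaluation at \<open>e\<close> is equivariant because sl(3) annihilates
  \<open>e\<close>: the bracket of \<phi> M with \<open>A\<close>, applied to \<open>e\<close>, is
  \<phi> M (A e).\<close>

lemma equivalent_H:
  "equivalent_reps sl mscale (killing_complement g K) (\<lambda>A. lie_bracket (\<phi> A)) (*s) H (\<lambda>A. (*v) (\<phi> A))"
  unfolding equivalent_reps_def
proof (intro conjI rep_complement rep_H exI ballI)
  let ?f = "\<lambda>A :: complex^7^7. A *v e"
  have fTh: "Th M a a' *v e = F 0 a a'" for M a a'
    using Om_F[of M a a' "\<gamma> *s a" "\<delta> *s a'" 1 0 0] by (simp flip: e_F)
  show "linear_on mscale (*s) (killing_complement g K) ?f"
    by (simp add: linear_on_def mv_simps)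
  show "bij_betw ?f (killing_complement g K) H"
    unfolding bij_betw_def complement_eq unfolding H_eq
  proof
    show "inj_on ?f {Th 0 a a' |a a'. True}" by (auto simp: inj_on_def fTh)
    show "?f ` {Th 0 a a' |a a'. True} = {F 0 p q |p q. True}"
    proof
      show "?f ` {Th 0 a a' |a a'. True} \<subseteq> {F 0 p q |p q. True}" using fTh by blast
      have "F 0 p q \<in> ?f ` {Th 0 a a' |a a'. True}" for p q
        by (rule image_eqI[where x = "Th 0 p q"]) (simp_all only: fTh, blast)
      then show "{F 0 p q |p q. True} \<subseteq> ?f ` {Th 0 a a' |a a'. True}" by blast
    qed
  qed
  fix M v assume "M \<in> (sl :: (complex^3^3) set)"
  have "\<phi> M *v e = 0" using fTh[of M 0 0] by (simp add: \<phi>_def)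
  then show "lie_bracket (\<phi> M) v *v e = \<phi> M *v (v *v e)"
    by (simp add: lie_bracket_mv)
qed

lemma equivalent_pair:
  "equivalent_reps sl mscale (killing_complement g K) (\<lambda>A. lie_bracket (\<phi> A)) pair_scale UNIV std_plus_dual"
  unfolding equivalent_reps_def
proof (intro conjI rep_complement rep_pair exI ballI)
  let ?f = "\<lambda>A :: complex^7^7. (\<chi> i. b (A *v e) (y i), \<chi> i. b (A *v e) (x i)) :: (complex^3) \<times> (complex^3)"
  have fTh: "?f (Th M a a') = (a, a')" for M a a'
    by (simp add: Om_nth)
  show "linear_on mscale pair_scale (killing_complement g K) ?f"
    by (simp add: linear_on_def mv_simps b_simps pair_scale_def vec_eq_iff)
  show "bij_betw ?f (killing_complement g K) UNIV"
    unfolding bij_betw_def complement_eq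
  proof
    show "inj_on ?f {Th 0 a a' |a a'. True}"
    proof (rule inj_onI)
      fix A B assume "A \<in> {Th 0 a a' |a a'. True}" "B \<in> {Th 0 a a' |a a'. True}" "?f A = ?f B"
      then show "A = B" using fTh by force
    qed
    show "?f ` {Th 0 a a' |a a'. True} = UNIV"
    proof -
      have "p \<in> ?f ` {Th 0 a a' |a a'. True}" for p
        using fTh[of 0 "fst p" "snd p"] by (intro image_eqI[of _ _ "Th 0 (fst p) (snd p)"]) auto
      then show ?thesis by blast
    qed
  qed
  fix M v assume "M \<in> (sl :: (complex^3^3) set)" and v: "v \<in> killing_complement g K"
  then have M: "trace M = 0" by (simp add: sl_def)
  obtain a a' where v: "v = Th 0 a a'" using v by (auto simp: complement_eq)
  show "?f (lie_bracket (\<phi> M) v) = std_plus_dual M (?f v)"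
    unfolding v \<phi>_Th[OF M] fTh by (simp add: std_plus_dual_def)
qed

end

text \<open>A normal vector of \<open>H\<close> is not isotropic, since otherwise it would lie in
  \<open>H\<close> and be orthogonal to it; it can then be scaled by a complex square root.\<close>

lemma (in bform) nondegenerate_hyperplane:
  assumes H: "vec.subspace H" "vec.dim H + 1 = CARD('n)" "nondegenerate_on b H"
  obtains e where "b e e = -1" "H = {v. b v e = 0}"
proof -
  have "vec.dim (perp H) \<noteq> 0" using dim_perp[OF H(1)] H(2) by linarith
  then obtain v where v: "v \<in> perp H" "v \<noteq> 0" using ex_nonzero_of_dim by blast
  have sub: "H \<subseteq> {w. b w v = 0}" using v(1) by (auto simp: perp_def)
  have eq: "H = {w. b w v = 0}"
  proof (rule vec.subspace_dim_equal[OF H(1) _ sub])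
    show "vec.subspace {w. b w v = 0}" by (auto simp: vec.subspace_def b_simps)
    have "{w. b w v = 0} = perp {v}" by (auto simp: perp_def b_commute)
    then show "vec.dim {w. b w v = 0} \<le> vec.dim H"
      using dim_perp[OF vec.subspace_span, of "{v}"] v(2) H(2) by (simp add: perp_span)
  qed
  have vv: "b v v \<noteq> 0"
  proof
    assume "b v v = 0"
    then have "v \<in> H" by (simp add: eq)
    moreover have "\<forall>y\<in>H. b v y = 0" using v(1) by (auto simp: perp_def b_commute)
    ultimately show False using H(3) v(2) by (auto simp: nondegenerate_on_def)
  qed
  define c where "c = csqrt (- 1 / b v v)"
  have c2: "c * c = - 1 / b v v" by (simp add: c_def flip: power2_eq_square)
  then have c: "c * c * b v v = -1" "c \<noteq> 0" using vv by auto
  show thesis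
    by (rule that[of "c *s v"]) (use c eq in \<open>simp_all add: b_simps mult.assoc\<close>)
qed

theorem proposition2p1:
  fixes \<beta> :: "complex^7 \<Rightarrow> complex^7 \<Rightarrow> complex"
    and \<gg> :: "(complex^7^7) set"
    and H :: "(complex^7) set"
  assumes "symmetric_form \<beta>" and "nondegenerate_on \<beta> UNIV"
    and "g2_in_so7 \<beta> \<gg>"
    and "vec.subspace H" and "vec.dim H = 6" and "nondegenerate_on \<beta> H"
  shows "\<exists>\<phi> :: complex^3^3 \<Rightarrow> complex^7^7.
           lie_isomorphism sl (\<gg> \<inter> so_preserving \<beta> H) \<phi> \<and>
           equivalent_reps sl
             mscale (killing_complement \<gg> (\<gg> \<inter> so_preserving \<beta> H)) (\<lambda>A. lie_bracket (\<phi> A))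
             (*s) H (\<lambda>A. (*v) (\<phi> A)) \<and>
           equivalent_reps sl
             mscale (killing_complement \<gg> (\<gg> \<inter> so_preserving \<beta> H)) (\<lambda>A. lie_bracket (\<phi> A))
             pair_scale UNIV std_plus_dual"
proof -
  interpret g2 \<beta> \<gg> by unfold_locales (use assms in auto)
  obtain e where e: "\<beta> e e = -1" "H = {v. \<beta> v e = 0}"
    using nondegenerate_hyperplane[OF assms(4) _ assms(6)] assms(5) by auto
  \<comment> \<open>The frame is built on the normal vector of the given hyperspace, so that
    \<open>H\<close> becomes the span of the \<open>x i\<close> and \<open>y i\<close>.\<close>
  obtain x y X where "g2_frame \<beta> \<gg> e x y X" using ex_frame_at[OF e(1)] by blast
  then interpret g2_frame \<beta> \<gg> e x y X .
  obtain c d where "1 + 2 * c * d = 0" "\<gg> = {Om M a a' (c *s a) (d *s a') |M a a'. trace M = 0}"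
    using g_structure by blast
  then interpret g2_normal_form \<beta> \<gg> e x y X c d
    by unfold_locales
  show ?thesis
    unfolding e(2) using \<phi>_iso equivalent_H equivalent_pair by blast
qed

end
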